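(* If a Hausdorff pseudocompact Abelian topological group contains no infinite compact subsets, then it is Pontryagin reflexive.
   Context: A topological space is pseudocompact if every real-valued continuous function on it is bounded. For a topological Abelian group $G$, $G^\wedge$ denotes the group of continuous homomorphisms $G\to\mathbb{T}$ ($\mathbb{T}$ the circle group) with the compact-open topology, and $\alpha_G\colon G\to G^{\wedge\wedge}$ is the evaluation homomorphism $\alpha_G(x)(\chi)=\chi(x)$. $G$ is Pontryagin reflexive if $\alpha_G$ is a topological isomorphism. *)

theory Defs
  imports "HOL-Analysis.Analysis" "HOL-Algebra.Group"
begin

definition circle_top :: "complex topology" where
  "circle_top = top_of_set (sphere 0 1)"

definition topological_abelian_group :: "('a, 'm) monoid_scheme \<Rightarrow> 'a topology \<Rightarrow> bool" where
  "topological_abelian_group G X \<longleftrightarrow>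
     comm_group G \<and> topspace X = carrier G \<and>
     continuous_map (prod_topology X X) X (\<lambda>(x, y). x \<otimes>\<^bsub>G\<^esub> y) \<and>
     continuous_map X X (\<lambda>x. inv\<^bsub>G\<^esub> x)"

definition pseudocompact :: "'a topology \<Rightarrow> bool" where
  "pseudocompact X \<longleftrightarrow>
     (\<forall>f. continuous_map X euclideanreal f \<longrightarrow> bounded (f ` topspace X))"

definition compact_open_topology :: "'a topology \<Rightarrow> 'b topology \<Rightarrow> ('a \<Rightarrow> 'b) set \<Rightarrow> ('a \<Rightarrow> 'b) topology" where
  "compact_open_topology X Y C =
     subtopology (topology_generated_by {{f. f ` K \<subseteq> U} | K U. compactin X K \<and> openin Y U}) C"

definition characters :: "('a, 'm) monoid_scheme \<Rightarrow> 'a topology \<Rightarrow> ('a \<Rightarrow> complex) set" where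
  "characters G X =
     {ch. continuous_map X circle_top ch \<and> ch \<in> extensional (carrier G) \<and>
          (\<forall>x\<in>carrier G. \<forall>y\<in>carrier G. ch (x \<otimes>\<^bsub>G\<^esub> y) = ch x * ch y)}"

definition dual_group :: "('a, 'm) monoid_scheme \<Rightarrow> 'a topology \<Rightarrow> ('a \<Rightarrow> complex) monoid" where
  "dual_group G X =
     \<lparr>carrier = characters G X,
      mult = (\<lambda>ch ps. \<lambda>x\<in>carrier G. ch x * ps x),
      one = (\<lambda>x\<in>carrier G. 1)\<rparr>"

definition dual_topology :: "('a, 'm) monoid_scheme \<Rightarrow> 'a topology \<Rightarrow> ('a \<Rightarrow> complex) topology" where
  "dual_topology G X = compact_open_topology X circle_top (characters G X)"

definition evaluation_map :: "('a, 'm) monoid_scheme \<Rightarrow> 'a topology \<Rightarrow> 'a \<Rightarrow> (('a \<Rightarrow> complex) \<Rightarrow> complex)" where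
  "evaluation_map G X x = (\<lambda>ch\<in>characters G X. ch x)"

definition pontryagin_reflexive :: "('a, 'm) monoid_scheme \<Rightarrow> 'a topology \<Rightarrow> bool" where
  "pontryagin_reflexive G X \<longleftrightarrow>
     evaluation_map G X \<in> iso G (dual_group (dual_group G X) (dual_topology G X)) \<and>
     homeomorphic_map X (dual_topology (dual_group G X) (dual_topology G X)) (evaluation_map G X)"

end

theory Submission
  imports Defs
begin

text \<open>
  Since the compact sets of \<open>G\<close> are finite, its dual carries the topology of pointwise convergence.
  Three facts then give reflexivity.

  The characters determine the topology of \<open>G\<close>. A neighbourhood of the identity yields a continuous
  invariant pseudometric, totally bounded by pseudocompactness. Fix an invariant mean and let a
  convolution operator act on the normalised autocorrelations
  \<open>\<phi>(x) = M\<^sub>t u(x t) cnj (u t)\<close>. The pairs of \<open>\<phi>\<close> and its convolution form a set with compact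
  closure, which is stable under replacing \<open>u\<close> by combinations of \<open>u\<close> and a translate of \<open>u\<close>. At a point
  where a strictly convex function of the second component is maximal, the two combinations with
  opposite signs must agree, and this forces \<open>\<phi>\<close> to be a continuous character.

  Compact sets of characters are finite. The image of \<open>G\<close> under countably many characters is
  pseudocompact and metrizable, hence compact. So a sequence in a compact set of characters has a
  pointwise convergent subsequence, which by Baire's theorem is uniformly Cauchy up to a small constant
  and hence eventually constant, as the circle has no small subgroups.

  The characters of the dual are evaluations, by orthogonality to trigonometric polynomials with
  respect to an invariant mean on the dual. Hence the bidual is \<open>G\<close>, again with the
  topology of pointwise convergence on the characters.
\<close>

section \<open>Invariant means\<close>

text \<open>The group need not be compact, and an invariant mean is in general only finitely
  additive, so there is no complete Hilbert space on which a compact convolution operator would have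
  eigenvectors. Maximising over a compact set of correlation pairs takes the place of the spectral
  theorem. Pairs are needed because \<open>u\<close> is merely bounded: its autocorrelation has no
  modulus of continuity and cannot be controlled on a countable set, whereas the convolution with a
  fixed Lipschitz kernel is Lipschitz with a constant independent of \<open>u\<close>. The first
  component supplies the eigenvalue, the second the eigenfunction, and through the second the
  eigenvalue becomes continuous. What enters the convex function is not the second component itself
  but its difference along the point to be separated. A multiplier with value one at that point
  would make a bounded function grow linearly, so the character is not merely nontrivial but differs
  from one where it is required to.\<close>

locale mean =
  fixes A :: "'a set" and M :: "('a \<Rightarrow> complex) \<Rightarrow> complex"
  assumes add: "\<lbrakk>bounded (f ` A); bounded (g ` A)\<rbrakk> \<Longrightarrow> M (\<lambda>x. f x + g x) = M f + M g"
    and scale: "bounded (f ` A) \<Longrightarrow> M (\<lambda>x. c * f x) = c * M f"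
    and one: "M (\<lambda>x. 1) = 1"
    and dominated: "\<lbrakk>bounded (f ` A); bounded (g ` A); \<And>x. x \<in> A \<Longrightarrow> norm (f x) \<le> Re (g x)\<rbrakk>
      \<Longrightarrow> norm (M f) \<le> Re (M g)"
begin

lemma const: "M (\<lambda>x. c) = c"
  using scale[of "\<lambda>x. 1" c] one by (cases "A = {}") (auto simp: image_constant_conv)

lemma norm_le:
  assumes "\<And>x. x \<in> A \<Longrightarrow> norm (f x) \<le> C"
  shows "norm (M f) \<le> C"
proof -
  have "bounded (f ` A)" using assms by (auto simp: bounded_iff)
  moreover have "bounded ((\<lambda>x. complex_of_real C) ` A)" by (auto simp: bounded_iff)
  ultimately show ?thesis using dominated[of f "\<lambda>x. of_real C"] assms const by simp
qed

lemma diff: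
  assumes "bounded (f ` A)" "bounded (g ` A)"
  shows "M (\<lambda>x. f x - g x) = M f - M g"
proof -
  have "bounded ((\<lambda>x. - 1 * g x) ` A)" using assms(2) by (auto simp: bounded_iff)
  then show ?thesis using add[OF assms(1), of "\<lambda>x. -1 * g x"] scale[OF assms(2), of "-1"] by simp
qed

text \<open>Means act on total functions; domination of \<open>f - g\<close> by the constant 0 is
  what makes them see only the values on \<open>A\<close>.\<close>

lemma cong:
  assumes "bounded (f ` A)" "\<And>x. x \<in> A \<Longrightarrow> f x = g x"
  shows "M f = M g"
proof -
  have "bounded (g ` A)" using assms by (metis image_cong)
  then have "M f - M g = M (\<lambda>x. f x - g x)" using assms diff by simp
  moreover have "norm (M (\<lambda>x. f x - g x)) \<le> 0" by (rule norm_le) (simp add: assms)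
  ultimately show ?thesis by simp
qed

text \<open>\<open>f\<close> dominates itself, and \<open>norm z \<le> Re z\<close> forces
  \<open>z\<close> to be real and nonnegative.\<close>

lemma nonneg:
  assumes "bounded (f ` A)" "\<And>x. x \<in> A \<Longrightarrow> f x \<in> \<real>\<^sub>\<ge>\<^sub>0"
  shows "M f \<in> \<real>\<^sub>\<ge>\<^sub>0"
proof -
  have "norm (M f) \<le> Re (M f)"
    by (rule dominated) (use assms in \<open>auto simp: complex_nonneg_Reals_iff cmod_eq_Re\<close>)
  then have "Re (M f) = norm (M f)" using complex_Re_le_cmod[of "M f"] by simp
  then have "Re (M f) \<ge> 0" "Im (M f) = 0" using cmod_power2[of "M f"] by simp_all
  then show ?thesis by (simp add: complex_nonneg_Reals_iff)
qed

lemma Re_mono: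
  assumes "bounded (f ` A)" "bounded (g ` A)" "\<And>x. x \<in> A \<Longrightarrow> f x \<in> \<real> \<and> g x \<in> \<real> \<and> Re (f x) \<le> Re (g x)"
  shows "Re (M f) \<le> Re (M g)"
proof -
  have "M (\<lambda>x. g x - f x) \<in> \<real>\<^sub>\<ge>\<^sub>0"
    by (rule nonneg) (use assms in \<open>auto simp: bounded_minus_comp complex_nonneg_Reals_iff complex_is_Real_iff\<close>)
  then show ?thesis using assms diff[of g f] by (auto simp: complex_nonneg_Reals_iff)
qed

lemma sum:
  assumes "finite I" "\<And>i. i \<in> I \<Longrightarrow> bounded (f i ` A)"
  shows "M (\<lambda>x. \<Sum>i\<in>I. f i x) = (\<Sum>i\<in>I. M (f i)) \<and> bounded ((\<lambda>x. \<Sum>i\<in>I. f i x) ` A)"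
  using assms
proof (induction I rule: finite_induct)
  case empty
  then show ?case using const[of 0] by (auto simp: bounded_iff)
next
  case (insert i I)
  then show ?case using add[of "f i" "\<lambda>x. \<Sum>i\<in>I. f i x"] bounded_plus_comp by auto
qed

end

lemma mean_at_point: "a \<in> A \<Longrightarrow> mean A (\<lambda>f. f a)"
  by unfold_locales auto

text \<open>Averaging along the orbit of \<open>b\<close>, as in the Markov-Kakutani theorem: the
  difference telescopes to two boundary terms divided by \<open>n\<close>. In the last claim
  translation by \<open>a\<close> commutes with the averaging, so almost invariance gained earlier
  survives.\<close>

lemma (in comm_group) mean_translate_average:
  assumes "mean (carrier G) M" and b: "b \<in> carrier G" and n: "n > (0::nat)"
  defines "N \<equiv> \<lambda>f. M (\<lambda>x. (\<Sum>k<n. f (b [^] k \<otimes> x)) / of_nat n)"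
  shows "mean (carrier G) N"
    and "(\<And>x. x \<in> carrier G \<Longrightarrow> norm (f x) \<le> C) \<Longrightarrow> norm (N (\<lambda>x. f (b \<otimes> x)) - N f) \<le> 2 * C / n"
    and "\<lbrakk>a \<in> carrier G; \<And>f C. (\<And>x. x \<in> carrier G \<Longrightarrow> norm (f x) \<le> C) \<Longrightarrow>
            norm (M (\<lambda>x. f (a \<otimes> x)) - M f) \<le> 2 * C / m;
          \<And>x. x \<in> carrier G \<Longrightarrow> norm (f x) \<le> C\<rbrakk> \<Longrightarrow>
            norm (N (\<lambda>x. f (a \<otimes> x)) - N f) \<le> 2 * C / m"
proof -
  interpret mean "carrier G" M by fact
  define R where "R = (\<lambda>f x. (\<Sum>k<n. f (b [^] k \<otimes> x)) / of_nat n :: complex)"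
  have R_le: "norm (R f x) \<le> C" if "\<And>x. x \<in> carrier G \<Longrightarrow> norm (f x) \<le> C" "x \<in> carrier G" for f C x
  proof -
    have "norm (\<Sum>k<n. f (b [^] k \<otimes> x)) \<le> real (card {..<n}) * C"
      by (rule sum_norm_bound) (use that b in auto)
    then show ?thesis using n by (simp add: R_def norm_divide field_simps)
  qed
  have bR: "bounded (R f ` carrier G)" if "bounded (f ` carrier G)" for f
  proof -
    from that obtain C where "\<And>x. x \<in> carrier G \<Longrightarrow> norm (f x) \<le> C" by (auto simp: bounded_iff)
    then show ?thesis using R_le by (auto simp: bounded_iff intro!: exI[of _ C])
  qed
  have N: "N f = M (R f)" for f by (simp add: N_def R_def)
  show "mean (carrier G) N"
  proof
    fix f g :: "'a \<Rightarrow> complex" and c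
    assume f: "bounded (f ` carrier G)"
    show "N (\<lambda>x. c * f x) = c * N f"
      using scale[OF bR[OF f], of c] by (simp add: N R_def sum_distrib_left)
    assume g: "bounded (g ` carrier G)"
    show "N (\<lambda>x. f x + g x) = N f + N g"
      using add[OF bR[OF f] bR[OF g]] by (simp add: N R_def sum.distrib add_divide_distrib)
    assume le: "\<And>x. x \<in> carrier G \<Longrightarrow> norm (f x) \<le> Re (g x)"
    show "norm (N f) \<le> Re (N g)"
      unfolding N
    proof (rule dominated[OF bR[OF f] bR[OF g]])
      fix x assume x: "x \<in> carrier G"
      have "norm (\<Sum>k<n. f (b [^] k \<otimes> x)) \<le> (\<Sum>k<n. Re (g (b [^] k \<otimes> x)))"
        by (rule sum_norm_le) (use le b x in auto)
      then show "norm (R f x) \<le> Re (R g x)"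
        using n by (simp add: R_def norm_divide divide_right_mono)
    qed
  next
    show "N (\<lambda>x. 1) = 1" using n one by (simp add: N_def)
  qed
  show "norm (N (\<lambda>x. f (b \<otimes> x)) - N f) \<le> 2 * C / n" if C: "\<And>x. x \<in> carrier G \<Longrightarrow> norm (f x) \<le> C"
  proof -
    have f: "bounded (f ` carrier G)" "bounded ((\<lambda>x. f (b \<otimes> x)) ` carrier G)"
      using C b by (auto simp: bounded_iff)
    have "N (\<lambda>x. f (b \<otimes> x)) - N f = M (\<lambda>x. R (\<lambda>x. f (b \<otimes> x)) x - R f x)"
      using diff[OF bR[OF f(2)] bR[OF f(1)]] by (simp add: N)
    also have "norm \<dots> \<le> 2 * C / n"
    proof (rule norm_le)
      fix x assume x: "x \<in> carrier G"
      have "(\<Sum>k<n. f (b \<otimes> (b [^] k \<otimes> x))) = (\<Sum>k<n. f (b [^] Suc k \<otimes> x))"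
        by (rule sum.cong) (use b x in \<open>auto simp: m_assoc[symmetric] m_comm\<close>)
      then have "R (\<lambda>x. f (b \<otimes> x)) x - R f x = (f (b [^] n \<otimes> x) - f (b [^] (0::nat) \<otimes> x)) / of_nat n"
        using sum_lessThan_telescope[of "\<lambda>k. f (b [^] k \<otimes> x)" n]
        by (simp add: R_def sum_subtractf diff_divide_distrib[symmetric])
      moreover have "norm (f (b [^] n \<otimes> x) - f (b [^] (0::nat) \<otimes> x)) \<le> C + C"
        by (rule order_trans[OF norm_triangle_ineq4]) (intro add_mono C; use b x in simp)
      ultimately show "norm (R (\<lambda>x. f (b \<otimes> x)) x - R f x) \<le> 2 * C / n"
        by (simp add: norm_divide divide_right_mono)
    qed
    finally show ?thesis .
  qed
  show "norm (N (\<lambda>x. f (a \<otimes> x)) - N f) \<le> 2 * C / m"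
    if a: "a \<in> carrier G" and M: "\<And>f C. (\<And>x. x \<in> carrier G \<Longrightarrow> norm (f x) \<le> C) \<Longrightarrow>
            norm (M (\<lambda>x. f (a \<otimes> x)) - M f) \<le> 2 * C / m"
      and C: "\<And>x. x \<in> carrier G \<Longrightarrow> norm (f x) \<le> C"
  proof -
    have "bounded ((\<lambda>x. f (a \<otimes> x)) ` carrier G)"
      using C a by (auto simp: bounded_iff)
    then have "N (\<lambda>x. f (a \<otimes> x)) = M (\<lambda>x. R f (a \<otimes> x))"
      unfolding N
      by (intro cong bR) (use a b in \<open>auto simp: R_def m_lcomm intro!: sum.cong\<close>)
    then show ?thesis using M[OF R_le[OF C]] by (simp add: N)
  qed
qed

lemma (in comm_group) exists_almost_invariant_mean:
  assumes "finite F" "F \<subseteq> carrier G" and n: "n > (0::nat)"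
  shows "\<exists>M. mean (carrier G) M \<and> (\<forall>a\<in>F. \<forall>f C. (\<forall>x\<in>carrier G. norm (f x) \<le> C) \<longrightarrow>
            norm (M (\<lambda>x. f (a \<otimes> x)) - M f) \<le> 2 * C / n)"
  using assms(1,2)
proof (induction F rule: finite_induct)
  case empty
  then show ?case using mean_at_point[OF one_closed] by auto
next
  case (insert b F)
  then obtain M where M: "mean (carrier G) M" "\<And>a f C. \<lbrakk>a \<in> F; \<And>x. x \<in> carrier G \<Longrightarrow> norm (f x) \<le> C\<rbrakk> \<Longrightarrow>
            norm (M (\<lambda>x. f (a \<otimes> x)) - M f) \<le> 2 * C / n" by auto
  have b: "b \<in> carrier G" and F: "F \<subseteq> carrier G" using insert by auto
  note T = mean_translate_average[OF M(1) b n]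
  show ?case
    by (rule exI, intro conjI, rule T(1), intro ballI allI impI)
       (use T(2,3) M(2) F in \<open>auto simp: subset_eq\<close>)
qed

definition invariant_mean :: "('a, 'm) monoid_scheme \<Rightarrow> (('a \<Rightarrow> complex) \<Rightarrow> complex) \<Rightarrow> bool" where
  "invariant_mean G M \<longleftrightarrow> mean (carrier G) M \<and>
     (\<forall>a\<in>carrier G. \<forall>f. bounded (f ` carrier G) \<longrightarrow> M (\<lambda>x. f (a \<otimes>\<^bsub>G\<^esub> x)) = M f)"

lemma compact_PiE_UNIV:
  fixes S :: "'i \<Rightarrow> 'b::topological_space set"
  assumes "\<And>i. compact (S i)"
  shows "compact (PiE UNIV S)"
proof -
  have "compactin (product_topology (\<lambda>i. euclidean) UNIV) (PiE UNIV S)"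
    using assms by (auto simp: compactin_PiE)
  then show ?thesis by (simp add: euclidean_product_topology)
qed

text \<open>Each axiom of \<open>mean\<close> compares finitely many coordinates \<open>M f\<close>
  by an equality or a weak inequality, hence is a closed condition in the product topology.\<close>

lemma closed_mean: "closed {M. mean A M}"
proof -
  have ev: "continuous_on UNIV (\<lambda>M. M f)" for f :: "'a \<Rightarrow> complex" by (rule continuous_on_product_coordinates)
  show ?thesis
    unfolding mean_def
    by (intro closed_Collect_conj closed_Collect_all closed_Collect_imp closed_Collect_eq closed_Collect_le
        continuous_intros ev open_Collect_const)
qed

theorem (in comm_group) exists_invariant_mean: "\<exists>M. invariant_mean G M"
proof -
  \<comment> \<open>Coordinates at unbounded functions are pinned to 0: the axioms leave them free,
    and without a bound there the product would not be compact.\<close>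
  define B where "B = (\<lambda>f::'a \<Rightarrow> complex. if bounded (f ` carrier G) then cball 0 (SUP x\<in>carrier G. norm (f x)) else {0::complex})"
  define K where "K = PiE UNIV B \<inter> {M. mean (carrier G) M}"
  define D where "D = (\<lambda>(a,n). {M. \<forall>(f :: 'a \<Rightarrow> complex) C. (\<forall>x\<in>carrier G. norm (f x) \<le> C) \<longrightarrow>
            norm (M (\<lambda>x. f (a \<otimes> x)) - M f :: complex) \<le> 2 * C / real (Suc n)})"
  have ev: "continuous_on UNIV (\<lambda>M. M f)" for f :: "'a \<Rightarrow> complex" by (rule continuous_on_product_coordinates)
  have "compact K"
    unfolding K_def by (intro compact_Int_closed compact_PiE_UNIV closed_mean) (auto simp: B_def)
  moreover have "\<And>T. T \<in> D ` (carrier G \<times> UNIV) \<Longrightarrow> closed T"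
    by (auto simp: D_def intro!: closed_Collect_all closed_Collect_imp closed_Collect_le
        continuous_intros ev open_Collect_const)
  moreover have "K \<inter> \<Inter>F' \<noteq> {}" if F': "finite F'" "F' \<subseteq> D ` (carrier G \<times> UNIV)" for F'
  proof -
    obtain I where I: "finite I" "I \<subseteq> carrier G \<times> UNIV" "F' = D ` I"
      using finite_subset_image[OF F'] by blast
    \<comment> \<open>One mean whose precision is the largest index in the finite family serves all
      constraints, as the bounds decrease with the index.\<close>
    obtain n where n: "\<And>i. i \<in> I \<Longrightarrow> snd i \<le> n"
      using finite_imageI[OF I(1), of snd] by (meson Max_ge imageI)
    have "finite (fst ` I)" "fst ` I \<subseteq> carrier G" using I by auto
    from exists_almost_invariant_mean[OF this zero_less_Suc[of n]]
    obtain M where M: "mean (carrier G) M" "\<And>a f C. \<lbrakk>a \<in> fst ` I; \<And>x. x \<in> carrier G \<Longrightarrow> norm (f x) \<le> C\<rbrakk> \<Longrightarrow>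
            norm (M (\<lambda>x. f (a \<otimes> x)) - M f) \<le> 2 * C / real (Suc n)" by blast
    interpret M: mean "carrier G" M by fact
    \<comment> \<open>Setting the values at unbounded functions to 0 moves the mean into the box and
      respects the axioms, which speak of bounded functions only.\<close>
    define M' where "M' = (\<lambda>f. if bounded (f ` carrier G) then M f else 0)"
    have bt: "bounded ((\<lambda>x. f (a \<otimes> x)) ` carrier G)" if "bounded (f ` carrier G)" "a \<in> carrier G" for f :: "'a \<Rightarrow> complex" and a
      by (rule bounded_subset[OF that(1)]) (use that in auto)
    have "M' \<in> PiE UNIV B"
    proof -
      have "norm (M f) \<le> (SUP x\<in>carrier G. norm (f x))" if f: "bounded (f ` carrier G)" for f
        by (rule M.norm_le, rule cSUP_upper) (use f in \<open>auto simp: bounded_iff bdd_above_def\<close>)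
      then show ?thesis by (auto simp: M'_def B_def)
    qed
    moreover have "mean (carrier G) M'"
    proof
      fix f g :: "'a \<Rightarrow> complex" and c
      assume f: "bounded (f ` carrier G)"
      have "bounded ((\<lambda>x. c * f x) ` carrier G)"
        using bounded_linear_image[OF f bounded_linear_mult_right[of c]] by (simp add: image_image)
      then show "M' (\<lambda>x. c * f x) = c * M' f" using f by (simp add: M'_def M.scale)
      assume g: "bounded (g ` carrier G)"
      show "M' (\<lambda>x. f x + g x) = M' f + M' g" using f g by (simp add: M'_def M.add bounded_plus_comp)
      assume "\<And>x. x \<in> carrier G \<Longrightarrow> norm (f x) \<le> Re (g x)"
      then show "norm (M' f) \<le> Re (M' g)" using f g M.dominated by (simp add: M'_def)
    next
      show "M' (\<lambda>x. 1) = 1" using M.one by (auto simp: M'_def bounded_iff)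
    qed
    moreover have "M' \<in> D i" if "i \<in> I" for i
    proof -
      obtain a k where i: "i = (a,k)" by (cases i)
      have a: "a \<in> fst ` I" "a \<in> carrier G" and k: "k \<le> n" using i that I n by force+
      have "norm (M' (\<lambda>x. f (a \<otimes> x)) - M' f) \<le> 2 * C / real (Suc k)" if C: "\<forall>x\<in>carrier G. norm (f x) \<le> C" for f C
      proof -
        have f: "bounded (f ` carrier G)" using C by (auto simp: bounded_iff)
        have "C \<ge> 0" using C by (meson norm_ge_zero one_closed order_trans)
        have "norm (M (\<lambda>x. f (a \<otimes> x)) - M f) \<le> 2 * C / real (Suc n)" using M(2) a C by blast
        also have "\<dots> \<le> 2 * C / real (Suc k)" using \<open>C \<ge> 0\<close> k by (intro divide_left_mono) auto
        finally show ?thesis using f bt[OF f a(2)] by (simp add: M'_def)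
      qed
      then show ?thesis by (simp add: D_def i)
    qed
    ultimately have "M' \<in> K \<inter> \<Inter>F'" using I by (auto simp: K_def)
    then show ?thesis by blast
  qed
  ultimately have "K \<inter> \<Inter>(D ` (carrier G \<times> UNIV)) \<noteq> {}" by (rule compact_imp_fip)
  then obtain M where M: "mean (carrier G) M" "\<And>a n. a \<in> carrier G \<Longrightarrow> M \<in> D (a,n)" by (auto simp: K_def)
  have "M (\<lambda>x. f (a \<otimes> x)) = M f" if a: "a \<in> carrier G" and f: "bounded (f ` carrier G)" for f a
  proof -
    obtain C where C: "\<forall>x\<in>carrier G. norm (f x) \<le> C" using f by (auto simp: bounded_iff)
    have "norm (M (\<lambda>x. f (a \<otimes> x)) - M f) \<le> 2 * C / real (Suc n)" for n
      using M(2)[OF a, of n] C by (auto simp: D_def)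
    moreover have "(\<lambda>n. 2 * C / real (Suc n)) \<longlonglongrightarrow> 0"
      using LIMSEQ_Suc[OF lim_const_over_n] by blast
    ultimately have "norm (M (\<lambda>x. f (a \<otimes> x)) - M f) \<le> 0"
      by (meson LIMSEQ_le_const)
    then show ?thesis by simp
  qed
  then show ?thesis using M(1) by (auto simp: invariant_mean_def)
qed

section \<open>Uniformly continuous functions and invariant pseudometrics\<close>

locale topological_comm_group = comm_group G for G (structure) +
  fixes X :: "'a topology"
  assumes topspace_eq: "topspace X = carrier G"
    and continuous_mult: "continuous_map (prod_topology X X) X (\<lambda>(x, y). x \<otimes> y)"
    and continuous_inv: "continuous_map X X (\<lambda>x. inv x)"
begin

lemma continuous_translation:
  assumes "a \<in> carrier G"
  shows "continuous_map X X (\<lambda>x. a \<otimes> x)"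
proof -
  have "continuous_map X (prod_topology X X) (\<lambda>x. (a, x))"
    using assms topspace_eq by (intro continuous_map_pairedI) auto
  from continuous_map_compose[OF this continuous_mult] show ?thesis by (simp add: o_def)
qed

lemma openin_translation:
  assumes "a \<in> carrier G" "openin X U"
  shows "openin X {x \<in> carrier G. a \<otimes> x \<in> U}"
  using openin_continuous_map_preimage[OF continuous_translation[OF assms(1)] assms(2)] topspace_eq by simp

lemma symmetric_square_root_nbhd:
  assumes "openin X U" "\<one> \<in> U"
  obtains V where "openin X V" "\<one> \<in> V" "\<And>x y. \<lbrakk>x \<in> V; y \<in> V\<rbrakk> \<Longrightarrow> x \<otimes> y \<in> U" "\<And>x. x \<in> V \<Longrightarrow> inv x \<in> V"
proof -
  have "openin (prod_topology X X) {z \<in> topspace (prod_topology X X). (case z of (x, y) \<Rightarrow> x \<otimes> y) \<in> U}"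
    using openin_continuous_map_preimage[OF continuous_mult assms(1)] .
  moreover have "(\<one>, \<one>) \<in> {z \<in> topspace (prod_topology X X). (case z of (x, y) \<Rightarrow> x \<otimes> y) \<in> U}"
    using assms topspace_eq by simp
  ultimately have "\<exists>A B. openin X A \<and> openin X B \<and> \<one> \<in> A \<and> \<one> \<in> B \<and>
    A \<times> B \<subseteq> {z \<in> topspace (prod_topology X X). (case z of (x, y) \<Rightarrow> x \<otimes> y) \<in> U}"
    by (rule openin_prod_topology_alt[THEN iffD1, rule_format])
  then obtain A B where AB: "openin X A" "openin X B" "\<one> \<in> A" "\<one> \<in> B"
    "A \<times> B \<subseteq> {z \<in> topspace (prod_topology X X). (case z of (x, y) \<Rightarrow> x \<otimes> y) \<in> U}"
    by (elim exE conjE)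
  define V where "V = (A \<inter> B) \<inter> {x \<in> topspace X. inv x \<in> A \<inter> B}"
  show ?thesis
  proof
    show "openin X V" unfolding V_def
      by (intro openin_Int AB openin_continuous_map_preimage[OF continuous_inv])
    show "\<one> \<in> V" using AB topspace_eq by (simp add: V_def)
    show "x \<otimes> y \<in> U" if "x \<in> V" "y \<in> V" for x y using that AB(5) by (auto simp: V_def)
    show "inv x \<in> V" if "x \<in> V" for x using that topspace_eq by (auto simp: V_def)
  qed
qed

end

lemma topological_comm_groupI: "topological_abelian_group G X \<Longrightarrow> topological_comm_group G X"
  by (simp add: topological_abelian_group_def topological_comm_group_def topological_comm_group_axioms_def)

text \<open>The set attached to \<open>k / 2 ^ n\<close> in the Birkhoff-Kakutani construction. The
  integer part of this number selects \<open>{\<one>}\<close>, \<open>U 0\<close> or the whole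
  group, and every binary digit one at place \<open>i\<close> after the point adds a factor from
  \<open>U i\<close>.\<close>

primrec (in monoid) dyadic_nbhd :: "(nat \<Rightarrow> 'a set) \<Rightarrow> nat \<Rightarrow> nat \<Rightarrow> 'a set" where
  "dyadic_nbhd U 0 k = (if k = 0 then {\<one>} else if k = 1 then U 0 else carrier G)"
| "dyadic_nbhd U (Suc n) k = (if even k then dyadic_nbhd U n (k div 2)
     else {x \<otimes> u | x u. x \<in> dyadic_nbhd U n (k div 2) \<and> u \<in> U (Suc n)})"

context comm_group
begin

context
  fixes U :: "nat \<Rightarrow> 'a set"
  assumes U_carrier: "U n \<subseteq> carrier G" and U_one: "\<one> \<in> U n"
    and U_square: "\<lbrakk>x \<in> U (Suc n); y \<in> U (Suc n)\<rbrakk> \<Longrightarrow> x \<otimes> y \<in> U n"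
    and U_inv: "x \<in> U n \<Longrightarrow> inv x \<in> U n"
begin

lemma dyadic_nbhd_carrier: "dyadic_nbhd U n k \<subseteq> carrier G"
proof (induction n arbitrary: k)
  case 0
  show ?case using U_carrier by auto
next
  case (Suc n)
  then show ?case using U_carrier[of "Suc n"] m_closed by (auto simp: subset_eq)
qed

text \<open>A carry in binary addition: for odd \<open>k\<close> the last factor from
  \<open>U (Suc n)\<close> and the new one multiply into \<open>U n\<close>, and the step is made
  one level up.\<close>

lemma dyadic_nbhd_step: "\<lbrakk>x \<in> dyadic_nbhd U n k; u \<in> U n\<rbrakk> \<Longrightarrow> x \<otimes> u \<in> dyadic_nbhd U n (Suc k)"
proof (induction n arbitrary: k x u)
  case 0
  then show ?case using U_carrier[of 0] by (auto split: if_splits)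
next
  case (Suc n)
  show ?case
  proof (cases "even k")
    case True
    then show ?thesis using Suc.prems by auto
  next
    case False
    then obtain y v where y: "y \<in> dyadic_nbhd U n (k div 2)" "v \<in> U (Suc n)" "x = y \<otimes> v"
      using Suc.prems by auto
    have "x \<otimes> u = y \<otimes> (v \<otimes> u)"
      using y Suc.prems dyadic_nbhd_carrier[of n] U_carrier[of "Suc n"] by (auto simp: m_assoc subset_eq)
    then have "x \<otimes> u \<in> dyadic_nbhd U n (Suc (k div 2))"
      using Suc.IH y U_square Suc.prems by simp
    then show ?thesis using False by simp
  qed
qed

lemma dyadic_nbhd_mono:
  assumes "k \<le> l"
  shows "dyadic_nbhd U n k \<subseteq> dyadic_nbhd U n l"
proof -
  have "dyadic_nbhd U n k \<subseteq> dyadic_nbhd U n (Suc k)" for k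
    using dyadic_nbhd_step[OF _ U_one] dyadic_nbhd_carrier[of n k] by force
  then show ?thesis using lift_Suc_mono_le[of "dyadic_nbhd U n"] assms by blast
qed

lemma dyadic_nbhd_refine: "dyadic_nbhd U (n + m) (k * 2 ^ m) = dyadic_nbhd U n k"
  by (induction m) auto

definition dyadic_fun :: "'a \<Rightarrow> real" where
  "dyadic_fun x = Inf {real k / 2 ^ n | k n. x \<in> dyadic_nbhd U n k}"

lemma dyadic_fun_le: "x \<in> dyadic_nbhd U n k \<Longrightarrow> dyadic_fun x \<le> real k / 2 ^ n"
  unfolding dyadic_fun_def by (rule cInf_lower) (blast, rule bdd_belowI[of _ 0], auto)

lemma dyadic_fun_ge:
  assumes "x \<in> carrier G" "\<And>k n. x \<in> dyadic_nbhd U n k \<Longrightarrow> c \<le> real k / 2 ^ n"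
  shows "c \<le> dyadic_fun x"
proof -
  have "x \<in> dyadic_nbhd U 0 2" using assms by simp
  then have "{real k / 2 ^ n | k n. x \<in> dyadic_nbhd U n k} \<noteq> {}" by blast
  then show ?thesis unfolding dyadic_fun_def by (rule cInf_greatest) (use assms in auto)
qed

lemma dyadic_fun_translate_le:
  assumes x: "x \<in> carrier G" and u: "u \<in> U n"
  shows "dyadic_fun (x \<otimes> u) \<le> dyadic_fun x + 2 / 2 ^ n"
proof -
  have "dyadic_fun (x \<otimes> u) - 2 / 2 ^ n \<le> real k / 2 ^ m" if k: "x \<in> dyadic_nbhd U m k" for k m
  proof -
    \<comment> \<open>\<open>i / 2 ^ n\<close> rounds \<open>k / 2 ^ m\<close> up to the grid of
      mesh \<open>1 / 2 ^ n\<close>, adding at most one mesh; multiplying by \<open>u\<close> costs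
      a second one, whence the constant 2.\<close>
    define i where "i = Suc (k * 2 ^ n div 2 ^ m)"
    have le: "k * 2 ^ n \<le> i * 2 ^ m" unfolding i_def
      by (metis add.commute dividend_less_div_times less_imp_le mult_Suc zero_less_numeral zero_less_power)
    have "x \<in> dyadic_nbhd U (n + m) (k * 2 ^ n)"
      using k dyadic_nbhd_refine[of m n k] by (simp add: add.commute)
    then have "x \<in> dyadic_nbhd U (n + m) (i * 2 ^ m)" using dyadic_nbhd_mono[OF le] by blast
    then have "x \<otimes> u \<in> dyadic_nbhd U n (Suc i)"
      using dyadic_nbhd_step u by (simp add: dyadic_nbhd_refine)
    then have "dyadic_fun (x \<otimes> u) \<le> (real (k * 2 ^ n div 2 ^ m) + 2) / 2 ^ n"
      using dyadic_fun_le[of "x \<otimes> u" n "Suc i"] by (simp add: i_def add.commute)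
    also have "\<dots> \<le> (real (k * 2 ^ n) / real (2 ^ m) + 2) / 2 ^ n"
      using of_nat_div_le_of_nat[of "k * 2 ^ n" "2 ^ m"] by (intro divide_right_mono) auto
    also have "\<dots> = real k / 2 ^ m + 2 / 2 ^ n" by (simp add: field_simps)
    finally show ?thesis by simp
  qed
  then have "dyadic_fun (x \<otimes> u) - 2 / 2 ^ n \<le> dyadic_fun x" by (rule dyadic_fun_ge[OF x])
  then show ?thesis by simp
qed

lemma dyadic_fun_translate:
  assumes x: "x \<in> carrier G" and u: "u \<in> U n"
  shows "\<bar>dyadic_fun (x \<otimes> u) - dyadic_fun x\<bar> \<le> 2 / 2 ^ n"
proof -
  have uc: "u \<in> carrier G" using u U_carrier by blast
  have "x \<otimes> u \<otimes> inv u = x" using x uc by (simp add: m_assoc)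
  then show ?thesis
    using dyadic_fun_translate_le[OF x u] dyadic_fun_translate_le[OF _ U_inv[OF u], of "x \<otimes> u"] x uc by auto
qed

lemma dyadic_fun_one: "dyadic_fun \<one> = 0"
  using dyadic_fun_le[of \<one> 0 0] dyadic_fun_ge[of \<one> 0] by simp

lemma dyadic_fun_bounds: "x \<in> carrier G \<Longrightarrow> 0 \<le> dyadic_fun x \<and> dyadic_fun x \<le> 2"
  using dyadic_fun_le[of x 0 2] dyadic_fun_ge[of x 0] by simp

lemma dyadic_fun_outside:
  assumes "x \<in> carrier G" "x \<notin> U 0"
  shows "1 \<le> dyadic_fun x"
proof (rule dyadic_fun_ge[OF assms(1)])
  fix k n assume k: "x \<in> dyadic_nbhd U n k"
  have "dyadic_nbhd U n (2 ^ n) = U 0" using dyadic_nbhd_refine[of 0 n 1] by simp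
  then have "\<not> k \<le> 2 ^ n" using k dyadic_nbhd_mono[of k "2 ^ n" n] assms by blast
  then have "real (2 ^ n) \<le> real k" by (simp only: of_nat_le_iff)
  then show "1 \<le> real k / 2 ^ n" by simp
qed

end
end

lemma (in topological_comm_group) exists_uniform_function:
  assumes "openin X W" "\<one> \<in> W"
  obtains f :: "'a \<Rightarrow> real" where "f \<one> = 0" "\<And>x. x \<in> carrier G \<Longrightarrow> 0 \<le> f x \<and> f x \<le> 1"
    "\<And>x. \<lbrakk>x \<in> carrier G; x \<notin> W\<rbrakk> \<Longrightarrow> 1 / 2 \<le> f x"
    "\<And>e. e > 0 \<Longrightarrow> \<exists>V. openin X V \<and> \<one> \<in> V \<and> (\<forall>x\<in>carrier G. \<forall>v\<in>V. \<bar>f (x \<otimes> v) - f x\<bar> \<le> e)"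
proof -
  define nb where "nb = (\<lambda>V. openin X V \<and> \<one> \<in> V \<and> V \<subseteq> W \<and> (\<forall>x\<in>V. inv x \<in> V))"
  have root: "\<exists>V'. nb V' \<and> (\<forall>x\<in>V'. \<forall>y\<in>V'. x \<otimes> y \<in> V)" if V: "openin X V" "\<one> \<in> V" "V \<subseteq> W" for V
  proof -
    obtain V' where V': "openin X V'" "\<one> \<in> V'" "\<And>x y. \<lbrakk>x \<in> V'; y \<in> V'\<rbrakk> \<Longrightarrow> x \<otimes> y \<in> V" "\<And>x. x \<in> V' \<Longrightarrow> inv x \<in> V'"
      using symmetric_square_root_nbhd[OF V(1,2)] by metis
    have "V' \<subseteq> V"
    proof
      fix x assume "x \<in> V'"
      then show "x \<in> V" using V'(3)[of x \<one>] V'(1,2) openin_subset[OF V'(1)] topspace_eq by auto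
    qed
    then show ?thesis using V' V unfolding nb_def by (intro exI[of _ V']) auto
  qed
  have "\<exists>U. \<forall>n. nb (U n) \<and> (\<forall>x\<in>U (Suc n). \<forall>y\<in>U (Suc n). x \<otimes> y \<in> U n)"
  proof (rule dependent_nat_choice)
    show "\<exists>V. nb V" using root[OF assms] by blast
    show "\<exists>V'. nb V' \<and> (\<forall>x\<in>V'. \<forall>y\<in>V'. x \<otimes> y \<in> V)" if "nb V" for V and n :: nat
      using root that unfolding nb_def by blast
  qed
  then obtain U where U: "\<And>n. nb (U n)" "\<And>n x y. \<lbrakk>x \<in> U (Suc n); y \<in> U (Suc n)\<rbrakk> \<Longrightarrow> x \<otimes> y \<in> U n" by blast
  have UG: "U n \<subseteq> carrier G" and U1: "\<one> \<in> U n" and UI: "\<And>x. x \<in> U n \<Longrightarrow> inv x \<in> U n" for n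
    using U(1)[of n] openin_subset topspace_eq unfolding nb_def by blast+
  note D = UG U1 U(2) UI
  \<comment> \<open>\<open>dyadic_fun\<close> takes values between 0 and 2 and is at least 1 off
    \<open>U 0\<close>; halving turns this into the stated bounds.\<close>
  define f where "f = (\<lambda>x. dyadic_fun U x / 2)"
  show ?thesis
  proof
    show "f \<one> = 0" using dyadic_fun_one[of U] D by (simp add: f_def)
    show "0 \<le> f x \<and> f x \<le> 1" if "x \<in> carrier G" for x using dyadic_fun_bounds[of U x] D that by (simp add: f_def)
    show "1 / 2 \<le> f x" if "x \<in> carrier G" "x \<notin> W" for x
    proof -
      have "x \<notin> U 0" using that U(1)[of 0] by (auto simp: nb_def)
      then show ?thesis using dyadic_fun_outside[of U x] D that by (simp add: f_def)
    qed
    show "\<exists>V. openin X V \<and> \<one> \<in> V \<and> (\<forall>x\<in>carrier G. \<forall>v\<in>V. \<bar>f (x \<otimes> v) - f x\<bar> \<le> e)" if e: "e > 0" for e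
    proof -
      obtain n where n: "(1/2) ^ n < e" using real_arch_pow_inv[OF e, of "1/2"] by auto
      have "\<bar>f (x \<otimes> v) - f x\<bar> \<le> e" if "x \<in> carrier G" "v \<in> U n" for x v
      proof -
        have "\<bar>dyadic_fun U (x \<otimes> v) - dyadic_fun U x\<bar> \<le> 2 / 2 ^ n"
          using dyadic_fun_translate[of U x v n] D that by blast
        also have "\<dots> \<le> 2 * e" using n by (simp add: power_divide)
        finally show ?thesis by (simp add: f_def)
      qed
      then show ?thesis using U(1)[of n] unfolding nb_def by blast
    qed
  qed
qed

section \<open>Continuous invariant pseudometrics and their total boundedness\<close>

locale invariant_pseudometric = comm_group G for G (structure) +
  fixes d :: "'a \<Rightarrow> 'a \<Rightarrow> real"
  assumes d_refl: "x \<in> carrier G \<Longrightarrow> d x x = 0"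
    and d_sym: "\<lbrakk>x \<in> carrier G; y \<in> carrier G\<rbrakk> \<Longrightarrow> d x y = d y x"
    and d_triangle: "\<lbrakk>x \<in> carrier G; y \<in> carrier G; z \<in> carrier G\<rbrakk> \<Longrightarrow> d x z \<le> d x y + d y z"
    and d_nonneg: "\<lbrakk>x \<in> carrier G; y \<in> carrier G\<rbrakk> \<Longrightarrow> 0 \<le> d x y"
    and d_inv: "\<lbrakk>x \<in> carrier G; y \<in> carrier G; z \<in> carrier G\<rbrakk> \<Longrightarrow> d (x \<otimes> z) (y \<otimes> z) = d x y"

definition totally_bounded_pm :: "('a, 'm) monoid_scheme \<Rightarrow> ('a \<Rightarrow> 'a \<Rightarrow> real) \<Rightarrow> bool" where
  "totally_bounded_pm G d \<longleftrightarrow>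
     (\<forall>e>0. \<exists>F. finite F \<and> F \<subseteq> carrier G \<and> (\<forall>x\<in>carrier G. \<exists>y\<in>F. d x y < e))"

lemma (in invariant_pseudometric) exists_dense_sequence:
  assumes "totally_bounded_pm G d"
  obtains q :: "nat \<Rightarrow> 'a" where "range q \<subseteq> carrier G" "\<And>x e. \<lbrakk>x \<in> carrier G; e > 0\<rbrakk> \<Longrightarrow> \<exists>k. d x (q k) < e"
proof -
  have "\<exists>F. finite F \<and> F \<subseteq> carrier G \<and> (\<forall>x\<in>carrier G. \<exists>y\<in>F. d x y < 1 / real (Suc n))" for n
    using assms unfolding totally_bounded_pm_def by simp
  then obtain F where F: "\<And>n. finite (F n)" "\<And>n. F n \<subseteq> carrier G"
    "\<And>n x. x \<in> carrier G \<Longrightarrow> \<exists>y\<in>F n. d x y < 1 / real (Suc n)" by metis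
  define Q where "Q = (\<Union>n. F n)"
  have Q: "countable Q" "Q \<noteq> {}" "Q \<subseteq> carrier G"
  proof -
    show "countable Q" unfolding Q_def by (intro countable_UN countableI_type countable_finite F(1))
    show "Q \<noteq> {}" using F(3)[OF one_closed, of 0] by (auto simp: Q_def)
    show "Q \<subseteq> carrier G" using F(2) by (auto simp: Q_def)
  qed
  show ?thesis
  proof
    show "range (from_nat_into Q) \<subseteq> carrier G" using Q by (simp add: range_from_nat_into)
    show "\<exists>k. d x (from_nat_into Q k) < e" if x: "x \<in> carrier G" and "e > 0" for x e
    proof -
      obtain n where n: "1 / real (Suc n) < e" using nat_approx_posE[OF \<open>e > 0\<close>] .
      obtain y where y: "y \<in> F n" "d x y < 1 / real (Suc n)" using F(3)[OF x] by blast
      then have "y \<in> Q" by (auto simp: Q_def)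
      then have "y \<in> range (from_nat_into Q)" by (simp add: Q range_from_nat_into)
      then obtain k where "y = from_nat_into Q k" by blast
      then show ?thesis using y n by (intro exI[of _ k]) simp
    qed
  qed
qed

locale continuous_pseudometric = topological_comm_group G X + invariant_pseudometric G d
  for G (structure) and X d +
  assumes d_small: "e > 0 \<Longrightarrow> \<exists>V. openin X V \<and> \<one> \<in> V \<and> (\<forall>x\<in>carrier G. \<forall>v\<in>V. d (x \<otimes> v) x \<le> e)"
begin

lemma nbhd_in_ball:
  assumes x: "x \<in> carrier G" and e: "e > 0"
  shows "\<exists>U. openin X U \<and> x \<in> U \<and> (\<forall>y\<in>U. d y x < e)"
proof -
  obtain V where V: "openin X V" "\<one> \<in> V" "\<And>x v. \<lbrakk>x \<in> carrier G; v \<in> V\<rbrakk> \<Longrightarrow> d (x \<otimes> v) x \<le> e / 2"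
    using d_small[of "e / 2"] e by auto
  have "d y x < e" if "y \<in> carrier G" "inv x \<otimes> y \<in> V" for y
    using V(3)[OF x that(2)] that x e by (simp add: m_assoc[symmetric])
  then show ?thesis using openin_translation[of "inv x" V] V x
    by (intro exI[of _ "{y \<in> carrier G. inv x \<otimes> y \<in> V}"]) auto
qed

lemma continuous_map_Lipschitz:
  fixes h :: "'a \<Rightarrow> 'c::metric_space"
  assumes "\<And>x y. \<lbrakk>x \<in> carrier G; y \<in> carrier G\<rbrakk> \<Longrightarrow> dist (h x) (h y) \<le> K * d x y"
  shows "continuous_map X euclidean h"
proof -
  have "\<exists>U. openin X U \<and> x \<in> U \<and> (\<forall>y\<in>U. dist (h x) (h y) < e)" if x: "x \<in> carrier G" and e: "e > 0" for x e
  proof -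
    \<comment> \<open>\<open>K\<close> may have any sign; \<open>\<bar>K\<bar> + 1\<close> is a
      positive Lipschitz constant in its place, here and in later estimates.\<close>
    have pos: "e / (\<bar>K\<bar> + 1) > 0" using e by simp
    obtain U where U: "openin X U" "x \<in> U" "\<And>y. y \<in> U \<Longrightarrow> d y x < e / (\<bar>K\<bar> + 1)"
      using nbhd_in_ball[OF x pos] by blast
    have "dist (h x) (h y) < e" if y: "y \<in> U" for y
    proof -
      have yc: "y \<in> carrier G" using y openin_subset[OF U(1)] topspace_eq by auto
      have "dist (h x) (h y) \<le> K * d x y" using assms x yc .
      also have "\<dots> \<le> (\<bar>K\<bar> + 1) * d x y" using d_nonneg[OF x yc] by (intro mult_right_mono) auto
      also have "\<dots> < e" using U(3)[OF y] d_sym[OF x yc] by (simp add: field_simps)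
      finally show ?thesis .
    qed
    then show ?thesis using U by blast
  qed
  then have "continuous_map X Met_TC.mtopology h"
    unfolding Met_TC.continuous_map_to_metric using topspace_eq by auto
  then show ?thesis by simp
qed

lemma continuous_map_dist:
  assumes "a \<in> carrier G"
  shows "continuous_map X euclidean (\<lambda>x. d x a)"
proof (rule continuous_map_Lipschitz[of _ 1])
  fix x y assume "x \<in> carrier G" "y \<in> carrier G"
  then show "dist (d x a) (d y a) \<le> 1 * d x y"
    using d_triangle[of x y a] d_triangle[of y x a] assms d_sym[of x y] by (simp add: dist_real_def)
qed

lemma openin_ball: "a \<in> carrier G \<Longrightarrow> openin X {x \<in> carrier G. d x a < e}"
  using openin_continuous_map_preimage[OF continuous_map_dist, of a "{..<e}"] topspace_eq by simp

text \<open>A uniformly separated sequence would carry a continuous function, supported in disjoint balls,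
  with arbitrarily large peaks.\<close>

lemma pseudocompact_imp_totally_bounded:
  assumes "pseudocompact X"
  shows "totally_bounded_pm G d"
proof (rule ccontr)
  assume "\<not> totally_bounded_pm G d"
  then obtain e where e: "e > 0" and nF: "\<And>F. \<lbrakk>finite F; F \<subseteq> carrier G\<rbrakk> \<Longrightarrow> \<exists>x\<in>carrier G. \<forall>y\<in>F. e \<le> d x y"
    unfolding totally_bounded_pm_def by (meson not_le)
  have "\<exists>x. \<forall>n::nat. x n \<in> carrier G \<and> (\<forall>m<n. e \<le> d (x n) (x m))"
  proof (rule dependent_wellorder_choice)
    fix n and x :: "nat \<Rightarrow> 'a"
    assume x: "\<And>m. m < n \<Longrightarrow> x m \<in> carrier G \<and> (\<forall>k<m. e \<le> d (x m) (x k))"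
    show "\<exists>r. r \<in> carrier G \<and> (\<forall>m<n. e \<le> d r (x m))"
      using nF[of "x ` {..<n}"] x by force
  qed auto
  then obtain x :: "nat \<Rightarrow> 'a" where x: "\<And>n. x n \<in> carrier G" and sep: "\<And>m n. m < n \<Longrightarrow> e \<le> d (x n) (x m)" by blast
  have sep': "m = n" if "d (x n) (x m) < e" for m n
    using sep[of m n] sep[of n m] that d_sym[OF x x, of m n] by (cases m n rule: linorder_cases) auto
  \<comment> \<open>\<open>c n\<close> is a peak of height \<open>n\<close> on the ball of radius
    \<open>e / 4\<close> about \<open>x n\<close>. A point of that ball within \<open>e / 8\<close>
    of \<open>p\<close> puts \<open>x n\<close> within \<open>3 * e / 8\<close> of \<open>p\<close>,
    and two such centres would be closer than \<open>e\<close>; so on \<open>T p\<close> only the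
    peak number \<open>N p\<close> can be nonzero. Where no peak is near, the arbitrary value of
    \<open>N p\<close> does no harm.\<close>
  define c where "c = (\<lambda>n y. real n * max 0 (1 - 4 / e * d y (x n)))"
  define N where "N = (\<lambda>p. SOME n. d p (x n) < 3 * e / 8)"
  define T where "T = (\<lambda>p. {y \<in> carrier G. d y p < e / 8})"
  have N: "N p = n" if p: "p \<in> carrier G" and y: "y \<in> T p" and c: "c n y \<noteq> 0" for n p y
  proof -
    have yc: "y \<in> carrier G" and yp: "d y p < e / 8" using y by (auto simp: T_def)
    have "d y (x n) < e / 4"
    proof (rule ccontr)
      assume "\<not> d y (x n) < e / 4"
      then have "1 - 4 / e * d y (x n) \<le> 0" using e by (simp add: field_simps)
      then show False using c by (simp add: c_def)
    qed
    then have n: "d p (x n) < 3 * e / 8"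
      using d_triangle[OF p yc x, of n] yp d_sym[OF p yc] by simp
    then have "d p (x (N p)) < 3 * e / 8" unfolding N_def by (rule someI)
    then have "d (x n) (x (N p)) < e"
      using d_triangle[OF x p x, of n "N p"] n d_sym[OF p x, of n] e by simp
    then show ?thesis by (rule sep')
  qed
  have "continuous_map X euclideanreal (\<lambda>y. c (N y) y)"
  proof (rule pasting_lemma[where I = "carrier G" and T = T and f = "\<lambda>p. c (N p)"])
    fix p assume p: "p \<in> carrier G"
    show "openin X (T p)" unfolding T_def using p by (rule openin_ball)
    show "continuous_map (subtopology X (T p)) euclideanreal (c (N p))"
      unfolding c_def
      by (rule continuous_map_from_subtopology) (intro continuous_intros continuous_map_real_mult_left continuous_map_dist x)
  next
    fix i j y assume "i \<in> carrier G" "j \<in> carrier G" "y \<in> topspace X \<inter> T i \<inter> T j"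
    then show "c (N i) y = c (N j) y" using N[of i y "N j"] N[of j y "N i"] by (metis IntE)
  next
    fix y assume "y \<in> topspace X"
    then show "\<exists>j. j \<in> carrier G \<and> y \<in> T j \<and> c (N y) y = c (N j) y"
      using topspace_eq d_refl e by (intro exI[of _ y]) (auto simp: T_def)
  qed
  then have "bounded ((\<lambda>y. c (N y) y) ` carrier G)" using assms topspace_eq by (simp add: pseudocompact_def)
  then obtain B where B: "\<And>y. y \<in> carrier G \<Longrightarrow> \<bar>c (N y) y\<bar> \<le> B" by (auto simp: bounded_iff)
  obtain n where n: "B < real n" "n > 0" using reals_Archimedean2[of "max B 0"] by auto
  have cn: "c n (x n) = real n" using d_refl[OF x] by (simp add: c_def)
  then have "N (x n) = n" using N[OF x, of "x n" n n] n x d_refl[OF x] e by (simp add: T_def)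
  then show False using B[OF x, of n] cn n by simp
qed

end

text \<open>The supremum over all translates makes \<open>d\<close> invariant, and its term at the
  identity bounds the variation of \<open>f\<close>. Ordinary continuity of \<open>f\<close> would
  not control the supremum near the identity; uniform continuity does.\<close>

lemma (in topological_comm_group) exists_continuous_pseudometric:
  assumes "openin X W" "\<one> \<in> W"
  obtains f :: "'a \<Rightarrow> real" and d where "continuous_pseudometric G X d" "f \<one> = 0"
    "\<And>x. x \<in> carrier G \<Longrightarrow> 0 \<le> f x \<and> f x \<le> 1" "\<And>x. \<lbrakk>x \<in> carrier G; x \<notin> W\<rbrakk> \<Longrightarrow> 1 / 2 \<le> f x"
    "\<And>x y. \<lbrakk>x \<in> carrier G; y \<in> carrier G\<rbrakk> \<Longrightarrow> \<bar>f x - f y\<bar> \<le> d x y"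
proof -
  obtain f :: "'a \<Rightarrow> real" where f: "f \<one> = 0" "\<And>x. x \<in> carrier G \<Longrightarrow> 0 \<le> f x \<and> f x \<le> 1"
    "\<And>x. \<lbrakk>x \<in> carrier G; x \<notin> W\<rbrakk> \<Longrightarrow> 1 / 2 \<le> f x"
    and uc: "\<And>e. e > 0 \<Longrightarrow> \<exists>V. openin X V \<and> \<one> \<in> V \<and> (\<forall>x\<in>carrier G. \<forall>v\<in>V. \<bar>f (x \<otimes> v) - f x\<bar> \<le> e)"
    using exists_uniform_function[OF assms] by metis
  define d where "d = (\<lambda>x y. SUP z\<in>carrier G. \<bar>f (x \<otimes> z) - f (y \<otimes> z)\<bar>)"
  have upper: "\<bar>f (x \<otimes> z) - f (y \<otimes> z)\<bar> \<le> d x y" if "x \<in> carrier G" "y \<in> carrier G" "z \<in> carrier G" for x y z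
    unfolding d_def
  proof (rule cSUP_upper[OF that(3)], rule bdd_aboveI2)
    fix z assume "z \<in> carrier G"
    then show "\<bar>f (x \<otimes> z) - f (y \<otimes> z)\<bar> \<le> 1" using f(2)[of "x \<otimes> z"] f(2)[of "y \<otimes> z"] that by auto
  qed
  have least: "d x y \<le> c" if "\<And>z. z \<in> carrier G \<Longrightarrow> \<bar>f (x \<otimes> z) - f (y \<otimes> z)\<bar> \<le> c" for x y c
    unfolding d_def by (rule cSUP_least) (use that one_closed in auto)
  have "continuous_pseudometric G X d"
  proof
    fix x y z assume x: "x \<in> carrier G"
    show "d x x = 0" using least[of x x 0] upper[OF x x one_closed] by simp
    assume y: "y \<in> carrier G"
    show "d x y = d y x" by (simp add: d_def abs_minus_commute)
    show "0 \<le> d x y" using upper[OF x y one_closed] by linarith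
    assume z: "z \<in> carrier G"
    show "d x z \<le> d x y + d y z"
    proof (rule least)
      fix w assume w: "w \<in> carrier G"
      show "\<bar>f (x \<otimes> w) - f (z \<otimes> w)\<bar> \<le> d x y + d y z" using upper[OF x y w] upper[OF y z w] by linarith
    qed
    show "d (x \<otimes> z) (y \<otimes> z) = d x y"
    proof (rule antisym)
      show "d (x \<otimes> z) (y \<otimes> z) \<le> d x y"
      proof (rule least)
        fix w assume w: "w \<in> carrier G"
        then show "\<bar>f (x \<otimes> z \<otimes> w) - f (y \<otimes> z \<otimes> w)\<bar> \<le> d x y"
          using upper[OF x y, of "z \<otimes> w"] x y z by (simp add: m_assoc)
      qed
      show "d x y \<le> d (x \<otimes> z) (y \<otimes> z)"
      proof (rule least)
        fix w assume w: "w \<in> carrier G"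
        have "z \<otimes> (inv z \<otimes> w) = w" using z w by (simp add: m_assoc[symmetric])
        then show "\<bar>f (x \<otimes> w) - f (y \<otimes> w)\<bar> \<le> d (x \<otimes> z) (y \<otimes> z)"
          using upper[of "x \<otimes> z" "y \<otimes> z" "inv z \<otimes> w"] x y z w by (simp add: m_assoc)
      qed
    qed
  next
    fix e :: real assume "e > 0"
    from uc[OF this] obtain V where V: "openin X V" "\<one> \<in> V" "\<forall>x\<in>carrier G. \<forall>v\<in>V. \<bar>f (x \<otimes> v) - f x\<bar> \<le> e"
      by (elim exE conjE)
    have "d (x \<otimes> v) x \<le> e" if x: "x \<in> carrier G" and v: "v \<in> V" for x v
    proof (rule least)
      fix z assume z: "z \<in> carrier G"
      have "v \<in> carrier G" using v openin_subset[OF V(1)] topspace_eq by auto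
      then show "\<bar>f (x \<otimes> v \<otimes> z) - f (x \<otimes> z)\<bar> \<le> e"
        using V(3)[rule_format, of "x \<otimes> z" v] x v z by (simp add: m_ac)
    qed
    then show "\<exists>V. openin X V \<and> \<one> \<in> V \<and> (\<forall>x\<in>carrier G. \<forall>v\<in>V. d (x \<otimes> v) x \<le> e)"
      using V(1,2) by (intro exI[of _ V]) simp
  qed
  moreover have "\<bar>f x - f y\<bar> \<le> d x y" if "x \<in> carrier G" "y \<in> carrier G" for x y
    using upper[OF that one_closed] that by simp
  ultimately show ?thesis by (intro that[of d f] f)
qed

section \<open>Existence of characters\<close>

lemma norm_convex_combination_sq:
  fixes a b :: complex and t :: real
  shows "(norm (complex_of_real t * a + complex_of_real (1 - t) * b))\<^sup>2 = t * (norm a)\<^sup>2 + (1 - t) * (norm b)\<^sup>2 - t * (1 - t) * (norm (a - b))\<^sup>2"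
  unfolding cmod_power2 by (simp add: algebra_simps power2_eq_square)

text \<open>A strictly convex continuous function on a compact set is maximal at an extreme point only.\<close>

lemma compact_sequences_nonzero_extreme_point:
  fixes S :: "(nat \<Rightarrow> complex) set"
  assumes S: "compact S" and B: "\<And>s k. s \<in> S \<Longrightarrow> norm (s k) \<le> B" and s0: "s0 \<in> S" "s0 k0 \<noteq> 0"
  obtains e where "e \<in> S" "\<exists>k. e k \<noteq> 0"
    "\<forall>a\<in>S. \<forall>b\<in>S. \<forall>t. 0 < t \<longrightarrow> t < 1 \<longrightarrow> (\<forall>k. e k = complex_of_real t * a k + complex_of_real (1 - t) * b k) \<longrightarrow> a = b"
proof -
  \<comment> \<open>The weights \<open>(1/2) ^ k\<close> make the series converge uniformly on the
    bounded set \<open>S\<close>, so that \<open>Q\<close> is continuous for the coordinatewise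
    topology.\<close>
  define w where "w = (\<lambda>(s::nat \<Rightarrow> complex) k. (1/2) ^ k * (norm (s k))\<^sup>2)"
  define Q where "Q = (\<lambda>s. \<Sum>k. w s k)"
  have bnd: "norm (w s k) \<le> (1/2) ^ k * C\<^sup>2" if "norm (s k) \<le> C" for s k C
    using that by (simp add: w_def abs_mult power_mono)
  have geo: "summable (\<lambda>k. (1/2) ^ k * C\<^sup>2)" for C :: real by (intro summable_mult2 summable_geometric) simp
  have summ: "summable (w s)" if "\<And>k. norm (s k) \<le> C" for s C
    by (rule summable_comparison_test'[OF geo[of C], of 0]) (use bnd that in blast)
  have nn: "w s k \<ge> 0" for s k by (simp add: w_def)
  have "continuous_on S Q"
  proof (rule uniform_limit_theorem)
    show "uniform_limit S (\<lambda>n s. \<Sum>k<n. w s k) Q sequentially"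
      unfolding Q_def by (rule Weierstrass_m_test[OF _ geo[of B]]) (use bnd B in blast)
    show "\<forall>\<^sub>F n in sequentially. continuous_on S (\<lambda>s. \<Sum>k<n. w s k)"
      unfolding w_def
      by (intro always_eventually allI continuous_intros continuous_on_subset[OF continuous_on_product_coordinates]) auto
  qed simp
  then obtain e where e: "e \<in> S" "\<And>s. s \<in> S \<Longrightarrow> Q s \<le> Q e"
    using continuous_attains_sup[OF S, of Q] s0 by blast
  show ?thesis
  proof (rule that)
    show "e \<in> S" by fact
    have "0 < w s0 k0" using s0 by (simp add: w_def)
    then have "0 < Q s0" unfolding Q_def using suminf_pos_iff[OF summ[OF B[OF s0(1)]]] nn by auto
    then have "0 < Q e" using e(2)[OF s0(1)] by simp
    show "\<exists>k. e k \<noteq> 0"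
    proof (rule ccontr)
      assume "\<nexists>k. e k \<noteq> 0"
      then have "w e = (\<lambda>k. 0)" by (auto simp: w_def)
      then show False using \<open>0 < Q e\<close> by (simp add: Q_def)
    qed
    show "\<forall>a\<in>S. \<forall>b\<in>S. \<forall>t. 0 < t \<longrightarrow> t < 1 \<longrightarrow> (\<forall>k. e k = complex_of_real t * a k + complex_of_real (1 - t) * b k) \<longrightarrow> a = b"
    proof (intro ballI allI impI)
      fix a b :: "nat \<Rightarrow> complex" and t :: real
      assume ab: "a \<in> S" "b \<in> S" and t: "0 < t" "t < 1" and eqs: "\<forall>k. e k = complex_of_real t * a k + complex_of_real (1 - t) * b k"
      note eq = eqs[rule_format]
      define D where "D = (\<lambda>k. a k - b k)"
      have sa: "summable (w a)" and sb: "summable (w b)" using summ B ab by blast+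
      have "norm (D k) \<le> B + B" for k
        unfolding D_def by (rule order_trans[OF norm_triangle_ineq4]) (intro add_mono B ab)
      then have sD: "summable (w D)" by (rule summ)
      \<comment> \<open>Strict convexity with its exact defect: \<open>Q e\<close> falls short of
        the convex combination of \<open>Q a\<close> and \<open>Q b\<close> by
        \<open>t * (1 - t) * Q D\<close>, so maximality of \<open>e\<close> leaves
        \<open>Q D \<le> 0\<close>.\<close>
      have "w e = (\<lambda>k. t * w a k + (1 - t) * w b k - t * (1 - t) * w D k)"
        unfolding w_def eq D_def norm_convex_combination_sq by (simp add: algebra_simps)
      then have "Q e = (\<Sum>k. t * w a k + (1 - t) * w b k - t * (1 - t) * w D k)" by (simp add: Q_def)
      also have "\<dots> = t * Q a + (1 - t) * Q b - t * (1 - t) * Q D"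
        unfolding Q_def using sa sb sD
        by (simp add: suminf_diff[symmetric] suminf_add[symmetric] suminf_mult summable_mult summable_add)
      also have "\<dots> \<le> t * Q e + (1 - t) * Q e - t * (1 - t) * Q D"
        using t e(2) ab by (intro diff_right_mono add_mono mult_left_mono) auto
      finally have "t * (1 - t) * Q D \<le> 0" by (simp add: algebra_simps)
      then have "Q D \<le> 0" using t by (simp add: mult_le_0_iff zero_le_mult_iff)
      then have "Q D = 0" unfolding Q_def using suminf_nonneg[OF sD] nn by force
      then have "\<forall>k. w D k = 0" unfolding Q_def using suminf_eq_zero_iff[OF sD] nn by blast
      then show "a = b" by (auto simp: w_def D_def)
    qed
  qed
qed

section \<open>Autocorrelation and convolution with respect to an invariant mean\<close>

lemma bounded_image_mult:
  fixes f g :: "'a \<Rightarrow> complex"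
  assumes "bounded (f ` A)" "bounded (g ` A)"
  shows "bounded ((\<lambda>x. f x * g x) ` A)"
proof -
  obtain B C where "\<And>x. x \<in> A \<Longrightarrow> norm (f x) \<le> B" "\<And>x. x \<in> A \<Longrightarrow> norm (g x) \<le> C"
    using assms unfolding bounded_iff by blast
  then have "norm (f x * g x) \<le> B * C" if "x \<in> A" for x
    using that by (simp add: norm_mult mult_mono' )
  then show ?thesis unfolding bounded_iff by blast
qed

lemma bounded_image_cnj:
  fixes f :: "'a \<Rightarrow> complex"
  shows "bounded (f ` A) \<Longrightarrow> bounded ((\<lambda>x. cnj (f x)) ` A)"
  by (auto simp: bounded_iff)

lemma bounded_image_const: "bounded ((\<lambda>x. c::complex) ` A)"
  by (auto simp: bounded_iff)

locale group_mean = comm_group G + mean "carrier G" M for G (structure) and M +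
  assumes M_inv: "\<lbrakk>a \<in> carrier G; bounded (f ` carrier G)\<rbrakk> \<Longrightarrow> M (\<lambda>x. f (a \<otimes> x)) = M f"
begin

lemma bounded_translate:
  fixes f :: "'a \<Rightarrow> complex"
  assumes "bounded (f ` carrier G)" "a \<in> carrier G"
  shows "bounded ((\<lambda>x. f (a \<otimes> x)) ` carrier G)"
  by (rule bounded_subset[OF assms(1)]) (use assms in auto)

lemmas bounded_intros = bounded_image_mult bounded_image_cnj bounded_image_const
  bounded_plus_comp bounded_minus_comp

text \<open>The coefficient of translation by \<open>x\<close> at the vector \<open>u\<close>, for
  the semi-inner product given by the mean of \<open>u * cnj v\<close>.\<close>

definition autocorr :: "('a \<Rightarrow> complex) \<Rightarrow> 'a \<Rightarrow> complex" where
  "autocorr u x = M (\<lambda>t. u (x \<otimes> t) * cnj (u t))"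

lemma autocorr_one:
  assumes u: "bounded (u ` carrier G)"
  shows "autocorr u \<one> = M (\<lambda>t. of_real ((norm (u t))\<^sup>2))"
  unfolding autocorr_def
proof (rule cong)
  show "bounded ((\<lambda>t. u (\<one> \<otimes> t) * cnj (u t)) ` carrier G)"
    by (intro bounded_intros u bounded_translate[OF u one_closed])
  show "u (\<one> \<otimes> t) * cnj (u t) = of_real ((norm (u t))\<^sup>2)" if "t \<in> carrier G" for t
    using that complex_norm_square[of "u t"] by simp
qed

lemma bounded_norm_sq:
  fixes u :: "'a \<Rightarrow> complex"
  assumes u: "bounded (u ` carrier G)"
  shows "bounded ((\<lambda>t. complex_of_real ((norm (u t))\<^sup>2)) ` carrier G)"
  using bounded_image_mult[OF u bounded_image_cnj[OF u]] by (simp add: complex_norm_square del: of_real_power)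

lemma autocorr_one_nonneg:
  assumes u: "bounded (u ` carrier G)"
  shows "autocorr u \<one> \<in> \<real>\<^sub>\<ge>\<^sub>0"
  unfolding autocorr_one[OF u] by (rule nonneg[OF bounded_norm_sq[OF u]]) simp

text \<open>Cauchy-Schwarz in the form \<open>p * q \<le> (p\<^sup>2 + q\<^sup>2) / 2\<close>, where
  invariance gives both squares the same mean.\<close>

lemma norm_autocorr_le:
  assumes u: "bounded (u ` carrier G)" and x: "x \<in> carrier G"
  shows "norm (autocorr u x) \<le> Re (autocorr u \<one>)"
proof -
  let ?n = "\<lambda>t. complex_of_real ((norm (u t))\<^sup>2)"
  have b: "bounded (?n ` carrier G)" "bounded ((\<lambda>t. ?n (x \<otimes> t)) ` carrier G)"
    using bounded_norm_sq[OF u] bounded_translate[OF bounded_norm_sq[OF u] x] by auto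
  have "norm (autocorr u x) \<le> Re (M (\<lambda>t. 1/2 * (?n (x \<otimes> t) + ?n t)))"
    unfolding autocorr_def
  proof (rule dominated)
    show "bounded ((\<lambda>t. u (x \<otimes> t) * cnj (u t)) ` carrier G)"
      by (intro bounded_intros u bounded_translate[OF u x])
    show "bounded ((\<lambda>t. 1/2 * (?n (x \<otimes> t) + ?n t)) ` carrier G)"
      by (intro bounded_intros b)
    show "norm (u (x \<otimes> t) * cnj (u t)) \<le> Re (1/2 * (?n (x \<otimes> t) + ?n t))" for t
    proof -
      have "0 \<le> (norm (u (x \<otimes> t)) - norm (u t))\<^sup>2" by simp
      then show ?thesis by (simp add: norm_mult power2_diff del: of_real_power)
    qed
  qed
  also have "M (\<lambda>t. 1/2 * (?n (x \<otimes> t) + ?n t)) = 1/2 * (M (\<lambda>t. ?n (x \<otimes> t)) + M ?n)"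
    using b by (simp only: scale add bounded_plus_comp)
  also have "M (\<lambda>t. ?n (x \<otimes> t)) = M ?n" by (rule M_inv[OF x b(1)])
  finally show ?thesis by (simp add: autocorr_one[OF u])
qed

lemma bounded_autocorr:
  assumes u: "bounded (u ` carrier G)"
  shows "bounded (autocorr u ` carrier G)"
  using norm_autocorr_le[OF u] unfolding bounded_iff by blast

text \<open>By invariance both square terms are autocorrelations of \<open>u\<close>, with total
  weight \<open>\<alpha>\<^sup>2 + \<beta>\<^sup>2 = 1\<close>. The cross terms are translates of it
  by \<open>y\<close> and by the inverse of \<open>y\<close>; the phase \<open>c\<close> serves
  later to tell these two apart.\<close>

lemma autocorr_combination:
  fixes \<alpha> \<beta> :: real and c :: complex and u :: "'a \<Rightarrow> complex"
  assumes u: "bounded (u ` carrier G)" and x: "x \<in> carrier G" and y: "y \<in> carrier G" and c: "norm c = 1"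
    and ab: "\<alpha>\<^sup>2 + \<beta>\<^sup>2 = 1"
  shows "autocorr (\<lambda>t. \<alpha> * u t + \<beta> * c * u (y \<otimes> t)) x =
    autocorr u x + \<alpha> * \<beta> * (c * autocorr u (x \<otimes> y) + cnj c * autocorr u (x \<otimes> inv y))"
proof -
  let ?h = "\<lambda>z t. u (z \<otimes> t) * cnj (u t)"
  have bh: "bounded (?h z ` carrier G)" if z: "z \<in> carrier G" for z :: 'a
    using bounded_image_mult[OF bounded_translate[OF u z] bounded_image_cnj[OF u]] .
  have bh': "bounded ((\<lambda>t. ?h z (y \<otimes> t)) ` carrier G)" if z: "z \<in> carrier G" for z :: 'a
    by (rule bounded_translate[OF bh[OF z] y])
  have uy: "bounded ((\<lambda>t. u (y \<otimes> t)) ` carrier G)" by (rule bounded_translate[OF u y])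
  have "autocorr (\<lambda>t. \<alpha> * u t + \<beta> * c * u (y \<otimes> t)) x =
    M (\<lambda>t. of_real (\<alpha>\<^sup>2) * ?h x t + of_real (\<beta>\<^sup>2) * ?h x (y \<otimes> t) +
        (\<alpha> * \<beta> * c * ?h (x \<otimes> y) t + \<alpha> * \<beta> * cnj c * ?h (x \<otimes> inv y) (y \<otimes> t)))"
    unfolding autocorr_def
  proof (rule cong)
    show "bounded ((\<lambda>t. (\<alpha> * u (x \<otimes> t) + \<beta> * c * u (y \<otimes> (x \<otimes> t))) * cnj (\<alpha> * u t + \<beta> * c * u (y \<otimes> t))) ` carrier G)"
      by (intro bounded_intros u uy bounded_translate[OF uy x] bounded_translate[OF u x])
    fix t assume t: "t \<in> carrier G"
    have cc: "c * cnj c = 1" using c by (simp add: complex_norm_square[symmetric])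
    have e: "y \<otimes> (x \<otimes> t) = x \<otimes> y \<otimes> t" "x \<otimes> (y \<otimes> t) = x \<otimes> y \<otimes> t" "x \<otimes> inv y \<otimes> (y \<otimes> t) = x \<otimes> t"
    proof -
      show "y \<otimes> (x \<otimes> t) = x \<otimes> y \<otimes> t" "x \<otimes> (y \<otimes> t) = x \<otimes> y \<otimes> t" using x y t by (simp_all add: m_ac)
      have "x \<otimes> inv y \<otimes> (y \<otimes> t) = x \<otimes> (inv y \<otimes> y) \<otimes> t" using x y t by (simp only: m_assoc inv_closed m_closed)
      then show "x \<otimes> inv y \<otimes> (y \<otimes> t) = x \<otimes> t" using x y t by simp
    qed
    have "\<beta> * c * U * cnj (\<beta> * c * V) = \<beta>\<^sup>2 * (U * cnj V)" for U V
    proof -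
      have "\<beta> * c * U * cnj (\<beta> * c * V) = \<beta>\<^sup>2 * (c * cnj c) * (U * cnj V)" by (simp add: power2_eq_square)
      then show ?thesis using cc by simp
    qed
    then show "(\<alpha> * u (x \<otimes> t) + \<beta> * c * u (y \<otimes> (x \<otimes> t))) * cnj (\<alpha> * u t + \<beta> * c * u (y \<otimes> t)) =
      of_real (\<alpha>\<^sup>2) * ?h x t + of_real (\<beta>\<^sup>2) * ?h x (y \<otimes> t) +
        (\<alpha> * \<beta> * c * ?h (x \<otimes> y) t + \<alpha> * \<beta> * cnj c * ?h (x \<otimes> inv y) (y \<otimes> t))"
      unfolding e complex_cnj_add by (simp add: ring_distribs power2_eq_square)
  qed
  also have "\<dots> = of_real (\<alpha>\<^sup>2) * M (?h x) + of_real (\<beta>\<^sup>2) * M (\<lambda>t. ?h x (y \<otimes> t)) +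
        (\<alpha> * \<beta> * c * M (?h (x \<otimes> y)) + \<alpha> * \<beta> * cnj c * M (\<lambda>t. ?h (x \<otimes> inv y) (y \<otimes> t)))"
    using bh bh' x y by (simp only: add scale m_closed inv_closed bounded_image_mult[OF bounded_image_const] bounded_plus_comp)
  also have "\<dots> = of_real (\<alpha>\<^sup>2) * autocorr u x + of_real (\<beta>\<^sup>2) * autocorr u x +
        (\<alpha> * \<beta> * c * autocorr u (x \<otimes> y) + \<alpha> * \<beta> * cnj c * autocorr u (x \<otimes> inv y))"
    using bh x y M_inv[OF y bh] by (simp add: autocorr_def)
  also have "\<dots> = of_real (\<alpha>\<^sup>2 + \<beta>\<^sup>2) * autocorr u x + \<alpha> * \<beta> * (c * autocorr u (x \<otimes> y) + cnj c * autocorr u (x \<otimes> inv y))"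
    by (simp add: algebra_simps)
  finally show ?thesis by (simp add: ab)
qed

definition conv :: "('a \<Rightarrow> complex) \<Rightarrow> ('a \<Rightarrow> complex) \<Rightarrow> 'a \<Rightarrow> complex" where
  "conv r p x = M (\<lambda>s. r (x \<otimes> inv s) * p s)"

context
  fixes r :: "'a \<Rightarrow> complex"
  assumes r: "bounded (r ` carrier G)"
begin

lemma bounded_conv_integrand:
  assumes "bounded (p ` carrier G)" "x \<in> carrier G"
  shows "bounded ((\<lambda>s. r (x \<otimes> inv s) * p s) ` carrier G)"
proof (rule bounded_image_mult[OF _ assms(1)])
  show "bounded ((\<lambda>s. r (x \<otimes> inv s)) ` carrier G)"
    by (rule bounded_subset[OF r]) (use assms in auto)
qed

lemma conv_add:
  assumes "bounded (p ` carrier G)" "bounded (p' ` carrier G)" "x \<in> carrier G"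
  shows "conv r (\<lambda>s. p s + p' s) x = conv r p x + conv r p' x"
  unfolding conv_def using add[OF bounded_conv_integrand bounded_conv_integrand] assms by (simp add: algebra_simps)

lemma conv_scale:
  assumes "bounded (p ` carrier G)" "x \<in> carrier G"
  shows "conv r (\<lambda>s. c * p s) x = c * conv r p x"
  unfolding conv_def using scale[OF bounded_conv_integrand] assms by (simp add: algebra_simps)

text \<open>The substitution of \<open>y \<otimes> s\<close> for \<open>s\<close> under the mean. It
  lets a shift of the first component of a pair carry over to the second.\<close>

lemma conv_translate:
  assumes p: "bounded (p ` carrier G)" and x: "x \<in> carrier G" and y: "y \<in> carrier G"
  shows "conv r (\<lambda>s. p (s \<otimes> y)) x = conv r p (x \<otimes> y)"
proof -
  have b: "bounded ((\<lambda>s. r (x \<otimes> y \<otimes> inv s) * p s) ` carrier G)" using p x y by (intro bounded_conv_integrand) auto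
  have "conv r p (x \<otimes> y) = M (\<lambda>s. r (x \<otimes> y \<otimes> inv (y \<otimes> s)) * p (y \<otimes> s))"
    unfolding conv_def using M_inv[OF y b] by simp
  also have "\<dots> = conv r (\<lambda>s. p (s \<otimes> y)) x"
    unfolding conv_def
  proof (rule cong)
    show "bounded ((\<lambda>s. r (x \<otimes> y \<otimes> inv (y \<otimes> s)) * p (y \<otimes> s)) ` carrier G)"
      using bounded_translate[OF b y] .
    fix s assume s: "s \<in> carrier G"
    have "x \<otimes> y \<otimes> inv (y \<otimes> s) = x \<otimes> (y \<otimes> inv y) \<otimes> inv s" using x y s by (simp only: inv_mult m_assoc inv_closed m_closed)
    then show "r (x \<otimes> y \<otimes> inv (y \<otimes> s)) * p (y \<otimes> s) = r (x \<otimes> inv s) * p (s \<otimes> y)"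
      using x y s by (simp add: m_comm)
  qed
  finally show ?thesis by simp
qed

lemma norm_conv_le:
  assumes "\<And>x. x \<in> carrier G \<Longrightarrow> norm (r x) \<le> 1" "\<And>x. x \<in> carrier G \<Longrightarrow> norm (p x) \<le> B" "x \<in> carrier G"
  shows "norm (conv r p x) \<le> B"
  unfolding conv_def
proof (rule norm_le)
  fix s assume s: "s \<in> carrier G"
  have "norm (r (x \<otimes> inv s)) * norm (p s) \<le> 1 * B"
    by (intro mult_mono assms) (use assms s in auto)
  then show "norm (r (x \<otimes> inv s) * p s) \<le> B" by (simp add: norm_mult)
qed

end
end

section \<open>Lipschitz functions: dense points and strict positivity of the mean\<close>

lemma (in invariant_pseudometric) Lipschitz_eq_on_dense:
  fixes h h' :: "'a \<Rightarrow> complex"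
  assumes q: "range q \<subseteq> carrier G" "\<And>x e. \<lbrakk>x \<in> carrier G; e > 0\<rbrakk> \<Longrightarrow> \<exists>k::nat. d x (q k) < e"
    and h: "\<And>x y. \<lbrakk>x \<in> carrier G; y \<in> carrier G\<rbrakk> \<Longrightarrow> norm (h x - h y) \<le> K * d x y"
    and h': "\<And>x y. \<lbrakk>x \<in> carrier G; y \<in> carrier G\<rbrakk> \<Longrightarrow> norm (h' x - h' y) \<le> K * d x y"
    and eq: "\<And>k. h (q k) = h' (q k)" and x: "x \<in> carrier G"
  shows "h x = h' x"
proof -
  have "norm (h x - h' x) \<le> 0 + e" if "e > 0" for e
  proof -
    have "e / (2 * (\<bar>K\<bar> + 1)) > 0" using that by simp
    then obtain k where k: "d x (q k) < e / (2 * (\<bar>K\<bar> + 1))" using q(2)[OF x] by blast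
    have qk: "q k \<in> carrier G" using q(1) by blast
    have "K * d x (q k) \<le> (\<bar>K\<bar> + 1) * d x (q k)" using d_nonneg[OF x qk] by (intro mult_right_mono) auto
    also have "\<dots> \<le> e / 2" using k by (simp add: field_simps)
    finally have "K * d x (q k) \<le> e / 2" .
    moreover have "norm (h x - h' x) \<le> norm (h x - h (q k)) + norm (h' x - h' (q k))"
      unfolding eq using norm_triangle_ineq4[of "h x - h' (q k)" "h' x - h' (q k)"] by simp
    ultimately show ?thesis using h[OF x qk] h'[OF x qk] by linarith
  qed
  then have "norm (h x - h' x) \<le> 0" by (rule field_le_epsilon)
  then show ?thesis by simp
qed

locale metric_mean = invariant_pseudometric G d + group_mean G M for G (structure) and d M +
  assumes tb: "totally_bounded_pm G d"
begin

text \<open>An invariant mean can vanish on nonzero nonnegative functions; total boundedness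
  prevents it here. The norm of \<open>h\<close> is at least \<open>e\<close> on a ball about
  \<open>p\<close>, finitely many translates of this ball cover the group, and all translates of the
  squared norm have the same mean.\<close>

lemma M_norm_sq_pos:
  fixes h :: "'a \<Rightarrow> complex"
  assumes h: "\<And>x y. \<lbrakk>x \<in> carrier G; y \<in> carrier G\<rbrakk> \<Longrightarrow> norm (h x - h y) \<le> K * d x y"
    and b: "bounded (h ` carrier G)" and p: "p \<in> carrier G" "h p \<noteq> 0"
  shows "0 < Re (M (\<lambda>t. of_real ((norm (h t))\<^sup>2)))"
proof -
  define e where "e = norm (h p) / 2"
  have e: "e > 0" using p by (simp add: e_def)
  then have "e / (\<bar>K\<bar> + 1) > 0" by simp
  then obtain F where F: "finite F" "F \<subseteq> carrier G" "\<And>x. x \<in> carrier G \<Longrightarrow> \<exists>y\<in>F. d x y < e / (\<bar>K\<bar> + 1)"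
    using tb unfolding totally_bounded_pm_def by meson
  let ?n = "\<lambda>t. complex_of_real ((norm (h t))\<^sup>2)"
  have bn: "bounded (?n ` carrier G)" by (rule bounded_norm_sq[OF b])
  have bt: "bounded ((\<lambda>x. ?n (inv y \<otimes> p \<otimes> x)) ` carrier G)" if "y \<in> F" for y
    by (rule bounded_translate[OF bn]) (use that F p in auto)
  have le: "e\<^sup>2 \<le> (\<Sum>y\<in>F. (norm (h (inv y \<otimes> p \<otimes> x)))\<^sup>2)" if x: "x \<in> carrier G" for x
  proof -
    obtain y where y: "y \<in> F" "d x y < e / (\<bar>K\<bar> + 1)" using F(3)[OF x] by blast
    have yc: "y \<in> carrier G" using y F by blast
    have "y \<otimes> (inv y \<otimes> p) = (y \<otimes> inv y) \<otimes> p" using yc p by (simp only: m_assoc inv_closed)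
    then have yp: "y \<otimes> (inv y \<otimes> p) = p" using yc p by simp
    have "x \<otimes> (inv y \<otimes> p) = inv y \<otimes> p \<otimes> x" using x yc p by (simp add: m_comm)
    then have "d (inv y \<otimes> p \<otimes> x) p = d x y"
      using d_inv[OF x yc, of "inv y \<otimes> p"] yc p yp by simp
    then have "norm (h (inv y \<otimes> p \<otimes> x) - h p) \<le> K * d x y" using h[of "inv y \<otimes> p \<otimes> x" p] x yc p by simp
    also have "\<dots> \<le> (\<bar>K\<bar> + 1) * d x y" using d_nonneg[OF x yc] by (intro mult_right_mono) auto
    also have "\<dots> \<le> e" using y(2) by (simp add: field_simps)
    finally have "e \<le> norm (h (inv y \<otimes> p \<otimes> x))"
      using norm_triangle_ineq2[of "h p" "h (inv y \<otimes> p \<otimes> x)"] by (simp add: e_def norm_minus_commute)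
    then have "e\<^sup>2 \<le> (norm (h (inv y \<otimes> p \<otimes> x)))\<^sup>2" using e by (intro power_mono) auto
    also have "\<dots> \<le> (\<Sum>y\<in>F. (norm (h (inv y \<otimes> p \<otimes> x)))\<^sup>2)"
      using member_le_sum[OF y(1), of "\<lambda>y. (norm (h (inv y \<otimes> p \<otimes> x)))\<^sup>2"] F(1) by simp
    finally show ?thesis .
  qed
  note s = sum[OF F(1), of "\<lambda>y x. ?n (inv y \<otimes> p \<otimes> x)", OF bt]
  have "e\<^sup>2 = Re (M (\<lambda>x. of_real (e\<^sup>2)))" by (simp only: const Re_complex_of_real)
  also have "\<dots> \<le> Re (M (\<lambda>x. \<Sum>y\<in>F. ?n (inv y \<otimes> p \<otimes> x)))"
    by (rule Re_mono[OF bounded_image_const]) (use s le in \<open>auto simp del: of_real_power\<close>)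
  also have "\<dots> = (\<Sum>y\<in>F. Re (M (\<lambda>x. ?n (inv y \<otimes> p \<otimes> x))))" using s by simp
  also have "\<dots> = (\<Sum>y\<in>F. Re (M ?n))"
    by (intro sum.cong arg_cong[of _ _ Re] M_inv bn refl) (use F p in auto)
  also have "\<dots> = real (card F) * Re (M ?n)" by simp
  finally have "0 < real (card F) * Re (M ?n)" using e by (smt (verit) zero_less_power)
  then show ?thesis by (simp add: zero_less_mult_iff)
qed

text \<open>For real \<open>h\<close> the mean of \<open>(h (a \<otimes> t) - h t)\<^sup>2\<close>
  is twice the gap in the claim, and this function of \<open>t\<close> is nonzero at the
  identity.\<close>

lemma autocorr_translate_less:
  fixes h :: "'a \<Rightarrow> complex"
  assumes h: "\<And>x y. \<lbrakk>x \<in> carrier G; y \<in> carrier G\<rbrakk> \<Longrightarrow> norm (h x - h y) \<le> K * d x y"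
    and b: "bounded (h ` carrier G)" and real: "\<And>x. x \<in> carrier G \<Longrightarrow> h x \<in> \<real>"
    and a: "a \<in> carrier G" "h a \<noteq> h \<one>"
  shows "Re (autocorr h a) < Re (autocorr h \<one>)"
proof -
  let ?D = "\<lambda>t. h (a \<otimes> t) - h t"
  let ?n = "\<lambda>t. complex_of_real ((norm (h t))\<^sup>2)"
  have bt: "bounded ((\<lambda>t. h (a \<otimes> t)) ` carrier G)" by (rule bounded_translate[OF b a(1)])
  have bn: "bounded (?n ` carrier G)" by (rule bounded_norm_sq[OF b])
  have bnt: "bounded ((\<lambda>t. ?n (a \<otimes> t)) ` carrier G)" by (rule bounded_translate[OF bn a(1)])
  have bh: "bounded ((\<lambda>t. h (a \<otimes> t) * cnj (h t)) ` carrier G)" by (intro bounded_intros b bt)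
  have bD: "bounded (?D ` carrier G)" by (intro bounded_intros b bt)
  have "0 < Re (M (\<lambda>t. of_real ((norm (?D t))\<^sup>2)))"
  proof (rule M_norm_sq_pos[of _ "2 * \<bar>K\<bar>", OF _ bD one_closed])
    show "h (a \<otimes> \<one>) - h \<one> \<noteq> 0" using a by simp
    fix x y assume xy: "x \<in> carrier G" "y \<in> carrier G"
    have "norm (h (a \<otimes> x) - h (a \<otimes> y)) \<le> K * d x y"
      using h[of "a \<otimes> x" "a \<otimes> y"] xy a d_inv[OF xy a(1)] by (simp add: m_comm)
    moreover have "K * d x y \<le> \<bar>K\<bar> * d x y" using d_nonneg[OF xy] by (intro mult_right_mono) auto
    moreover have "norm (?D x - ?D y) \<le> norm (h (a \<otimes> x) - h (a \<otimes> y)) + norm (h x - h y)"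
      using norm_triangle_ineq4[of "h (a \<otimes> x) - h (a \<otimes> y)" "h x - h y"] by (simp add: algebra_simps)
    ultimately show "norm (?D x - ?D y) \<le> 2 * \<bar>K\<bar> * d x y" using h[OF xy] by linarith
  qed
  also have "M (\<lambda>t. of_real ((norm (?D t))\<^sup>2)) = M (\<lambda>t. (?n (a \<otimes> t) + ?n t) - 2 * (h (a \<otimes> t) * cnj (h t)))"
  proof (rule cong[OF bounded_norm_sq[OF bD]])
    fix t assume t: "t \<in> carrier G"
    obtain p q where pq: "h t = of_real p" "h (a \<otimes> t) = of_real q" using real t a by (metis Reals_cases m_closed)
    have D: "h (a \<otimes> t) - h t = of_real (q - p)" using pq by simp
    show "of_real ((norm (?D t))\<^sup>2) = (?n (a \<otimes> t) + ?n t) - 2 * (h (a \<otimes> t) * cnj (h t))"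
      unfolding D unfolding pq norm_of_real power2_abs by (simp add: power2_diff)
  qed
  also have "\<dots> = M (\<lambda>t. ?n (a \<otimes> t)) + M ?n - 2 * M (\<lambda>t. h (a \<otimes> t) * cnj (h t))"
    by (simp only: diff add scale bnt bn bh bounded_plus_comp bounded_image_mult[OF bounded_image_const])
  also have "M (\<lambda>t. ?n (a \<otimes> t)) = M ?n" by (rule M_inv[OF a(1) bn])
  finally show ?thesis by (simp add: autocorr_one[OF b]) (simp add: autocorr_def)
qed

end

section \<open>Normalised correlation pairs: bounds, moves and compact closure\<close>

context metric_mean
begin

text \<open>The values are set to \<open>undefined\<close> outside the group, so that all pairs lie
  in one compact product. Dividing both components by the value at the identity makes their bounds
  independent of \<open>u\<close>.\<close>

definition corr_pairs :: "('a \<Rightarrow> complex) \<Rightarrow> (('a \<Rightarrow> complex) \<times> ('a \<Rightarrow> complex)) set" where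
  "corr_pairs r = {(\<lambda>x\<in>carrier G. autocorr u x / autocorr u \<one>, \<lambda>x\<in>carrier G. conv r (autocorr u) x / autocorr u \<one>) | u.
     bounded (u ` carrier G) \<and> autocorr u \<one> \<noteq> 0}"

text \<open>Replacing \<open>u\<close> by \<open>\<alpha> u + \<beta> c u(y \<cdot>)\<close> with \<open>\<alpha>\<^sup>2 + \<beta>\<^sup>2 = 1\<close> and \<open>\<alpha> \<beta> = k\<close> shifts the autocorrelation by \<open>k\<close>.
  The choice \<open>k = \<plusminus>2/5\<close> keeps the normalising weight at least \<open>1/5\<close>.\<close>

definition corr_weight :: "real \<Rightarrow> complex \<Rightarrow> 'a \<Rightarrow> (('a \<Rightarrow> complex) \<times> ('a \<Rightarrow> complex)) \<Rightarrow> complex" where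
  "corr_weight k c y p = 1 + k * (c * fst p y + cnj c * fst p (inv y))"

definition corr_shift :: "real \<Rightarrow> complex \<Rightarrow> 'a \<Rightarrow> ('a \<Rightarrow> complex) \<Rightarrow> 'a \<Rightarrow> complex" where
  "corr_shift k c y h x = h x + k * (c * h (x \<otimes> y) + cnj c * h (x \<otimes> inv y))"

definition corr_move :: "real \<Rightarrow> complex \<Rightarrow> 'a \<Rightarrow> (('a \<Rightarrow> complex) \<times> ('a \<Rightarrow> complex)) \<Rightarrow> (('a \<Rightarrow> complex) \<times> ('a \<Rightarrow> complex))" where
  "corr_move k c y p = (\<lambda>x\<in>carrier G. corr_shift k c y (fst p) x / corr_weight k c y p,
     \<lambda>x\<in>carrier G. corr_shift k c y (snd p) x / corr_weight k c y p)"

lemma corr_shift_autocorr: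
  assumes u: "bounded (u ` carrier G)" and y: "y \<in> carrier G" and c: "norm c = 1" and k: "\<bar>k\<bar> = 2/5"
  obtains v where "bounded (v ` carrier G)" "\<And>x. x \<in> carrier G \<Longrightarrow> autocorr v x = corr_shift k c y (autocorr u) x"
proof -
  \<comment> \<open>The split 4/5 + 1/5 of the unit weight gives the product 2/5, with the sign put
    on \<open>\<beta>\<close>. The even split would give 1/2, for which the normalising weight could
    vanish.\<close>
  define \<alpha> :: real where "\<alpha> = 2 / sqrt 5"
  define \<beta> :: real where "\<beta> = sgn k / sqrt 5"
  have k0: "k \<noteq> 0" using k by auto
  have "(sgn k)\<^sup>2 = 1" using k0 by (simp add: sgn_real_def)
  then have 1: "\<alpha>\<^sup>2 + \<beta>\<^sup>2 = 1" by (simp add: \<alpha>_def \<beta>_def power_divide)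
  have "\<alpha> * \<beta> = 2/5 * sgn k" by (simp add: \<alpha>_def \<beta>_def)
  also have "\<dots> = k"
  proof -
    have "k = 2/5 \<or> k = -2/5" using k by arith
    then show ?thesis by auto
  qed
  finally have 2: "\<alpha> * \<beta> = k" .
  show ?thesis
  proof
    show "bounded ((\<lambda>t. \<alpha> * u t + \<beta> * c * u (y \<otimes> t)) ` carrier G)"
      by (intro bounded_intros u bounded_translate[OF u y])
    show "autocorr (\<lambda>t. \<alpha> * u t + \<beta> * c * u (y \<otimes> t)) x = corr_shift k c y (autocorr u) x" if "x \<in> carrier G" for x
      using autocorr_combination[OF u that y c 1] unfolding corr_shift_def 2[symmetric] by simp
  qed
qed

lemma ev_fst: "continuous_on S (\<lambda>p. fst p x :: complex)"
  by (rule continuous_on_product_then_coordinatewise) (intro continuous_intros)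

lemma ev_snd: "continuous_on S (\<lambda>p. snd p x :: complex)"
  by (rule continuous_on_product_then_coordinatewise) (intro continuous_intros)

context
  fixes r :: "'a \<Rightarrow> complex"
  assumes r_le_1: "\<forall>x\<in>carrier G. norm (r x) \<le> 1"
    and r_Lip_d: "\<forall>x\<in>carrier G. \<forall>y\<in>carrier G. norm (r x - r y) \<le> d x y"
begin

lemmas r_le = r_le_1[rule_format]
lemmas r_Lip = r_Lip_d[rule_format]

lemma r_bounded: "bounded (r ` carrier G)"
  using r_le unfolding bounded_iff by blast

text \<open>Everything is measured against \<open>N\<close>, the value of the autocorrelation at the
  identity, which dominates it everywhere; the Lipschitz constant of the second component then comes
  from \<open>r\<close> alone.\<close>

lemma corr_pairs_bounds:
  assumes "p \<in> corr_pairs r" "x \<in> carrier G"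
  shows "norm (fst p x) \<le> 1" "norm (snd p x) \<le> 1" "fst p \<one> = 1"
    "y \<in> carrier G \<Longrightarrow> norm (snd p x - snd p y) \<le> d x y"
proof -
  obtain u where u: "bounded (u ` carrier G)" "autocorr u \<one> \<noteq> 0"
    and p: "p = (\<lambda>x\<in>carrier G. autocorr u x / autocorr u \<one>, \<lambda>x\<in>carrier G. conv r (autocorr u) x / autocorr u \<one>)"
    using assms unfolding corr_pairs_def by blast
  define N where "N = Re (autocorr u \<one>)"
  have N: "autocorr u \<one> = of_real N" "N > 0"
    using autocorr_one_nonneg[OF u(1)] u(2) by (auto simp: N_def complex_nonneg_Reals_iff complex_eq_iff)
  have a: "norm (autocorr u z) \<le> N" if "z \<in> carrier G" for z
    using norm_autocorr_le[OF u(1) that] by (simp add: N_def)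
  note x = assms(2)
  show "norm (fst p x) \<le> 1" using a[OF x] N x by (simp add: p norm_divide)
  show "norm (snd p x) \<le> 1" using norm_conv_le[OF r_bounded r_le a x] N x by (simp add: p norm_divide)
  show "fst p \<one> = 1" using u by (simp add: p)
  assume y: "y \<in> carrier G"
  have bi: "bounded ((\<lambda>s. r (z \<otimes> inv s) * autocorr u s) ` carrier G)" if "z \<in> carrier G" for z
    using bounded_conv_integrand[OF r_bounded bounded_autocorr[OF u(1)] that] .
  have "conv r (autocorr u) x - conv r (autocorr u) y = M (\<lambda>s. r (x \<otimes> inv s) * autocorr u s - r (y \<otimes> inv s) * autocorr u s)"
    unfolding conv_def by (simp only: diff bi x y)
  also have "norm \<dots> \<le> d x y * N"
  proof (rule norm_le)
    fix s assume s: "s \<in> carrier G"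
    have "norm (r (x \<otimes> inv s) - r (y \<otimes> inv s)) * norm (autocorr u s) \<le> d x y * N"
    proof (rule mult_mono)
      show "norm (r (x \<otimes> inv s) - r (y \<otimes> inv s)) \<le> d x y"
        using r_Lip[of "x \<otimes> inv s" "y \<otimes> inv s"] d_inv[OF x y, of "inv s"] x y s by simp
    qed (use a[OF s] d_nonneg[OF x y] in auto)
    then show "norm (r (x \<otimes> inv s) * autocorr u s - r (y \<otimes> inv s) * autocorr u s) \<le> d x y * N"
      by (simp add: norm_mult[symmetric] algebra_simps)
  qed
  finally have "norm (conv r (autocorr u) x - conv r (autocorr u) y) \<le> d x y * N" .
  then show "norm (snd p x - snd p y) \<le> d x y"
    using N x y by (simp add: p diff_divide_distrib[symmetric] norm_divide pos_divide_le_eq)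
qed

lemma corr_weight_Re_ge:
  assumes "norm (fst p y) \<le> 1" "norm (fst p (inv y)) \<le> 1" "norm c = 1" "\<bar>k\<bar> = 2/5"
  shows "1/5 \<le> Re (corr_weight k c y p)"
proof -
  define z where "z = of_real k * (c * fst p y + cnj c * fst p (inv y))"
  have "norm z = 2/5 * norm (c * fst p y + cnj c * fst p (inv y))" using assms unfolding z_def by (simp only: norm_mult norm_of_real)
  also have "\<dots> \<le> 2/5 * (norm (c * fst p y) + norm (cnj c * fst p (inv y)))"
    by (intro mult_left_mono norm_triangle_ineq) simp
  also have "\<dots> \<le> 2/5 * (1 + 1)" using assms by (intro mult_left_mono add_mono) (auto simp: norm_mult)
  finally have "norm z \<le> 4/5" by simp
  then have "\<bar>Re z\<bar> \<le> 4/5" using abs_Re_le_cmod order_trans by blast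
  then have "- (4/5) \<le> Re z" unfolding abs_le_iff by linarith
  then show ?thesis unfolding corr_weight_def z_def[symmetric] by simp
qed

text \<open>Convolution is linear and commutes with translations, so it turns the shift of the
  autocorrelation into the same shift of the second component. The weight is the quotient of two
  nonnegative normalisations, hence real.\<close>

lemma corr_move_pairs:
  assumes p: "p \<in> corr_pairs r" and y: "y \<in> carrier G" and c: "norm c = 1" and k: "\<bar>k\<bar> = 2/5"
  shows "corr_move k c y p \<in> corr_pairs r" "Im (corr_weight k c y p) = 0"
proof -
  obtain u where u: "bounded (u ` carrier G)" "autocorr u \<one> \<noteq> 0"
    and p_def: "p = (\<lambda>x\<in>carrier G. autocorr u x / autocorr u \<one>, \<lambda>x\<in>carrier G. conv r (autocorr u) x / autocorr u \<one>)"
    using p unfolding corr_pairs_def by blast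
  obtain v where v: "bounded (v ` carrier G)" and av: "\<And>x. x \<in> carrier G \<Longrightarrow> autocorr v x = corr_shift k c y (autocorr u) x"
    using corr_shift_autocorr[OF u(1) y c k] by blast
  have w: "autocorr v \<one> = autocorr u \<one> * corr_weight k c y p"
    using av[OF one_closed] y u(2) unfolding corr_shift_def corr_weight_def p_def by (simp add: field_simps)
  have "1/5 \<le> Re (corr_weight k c y p)"
    by (rule corr_weight_Re_ge[OF _ _ c k]) (use corr_pairs_bounds(1)[OF p] y in auto)
  then have w0: "corr_weight k c y p \<noteq> 0" by auto
  have "Im (autocorr u \<one>) = 0" "Im (autocorr v \<one>) = 0" "Re (autocorr u \<one>) \<noteq> 0"
    using autocorr_one_nonneg[OF u(1)] autocorr_one_nonneg[OF v] u(2) by (auto simp: complex_nonneg_Reals_iff complex_eq_iff)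
  then show "Im (corr_weight k c y p) = 0" unfolding w by simp
  have b: "bounded (autocorr u ` carrier G)" by (rule bounded_autocorr[OF u(1)])
  have bt: "bounded ((\<lambda>s. autocorr u (s \<otimes> z)) ` carrier G)" if "z \<in> carrier G" for z
    by (rule bounded_subset[OF b]) (use that in auto)
  have cv: "conv r (autocorr v) x = corr_shift k c y (conv r (autocorr u)) x" if x: "x \<in> carrier G" for x
  proof -
    have "conv r (autocorr v) x = conv r (\<lambda>s. autocorr u s + k * (c * autocorr u (s \<otimes> y) + cnj c * autocorr u (s \<otimes> inv y))) x"
      unfolding conv_def
      by (rule cong[OF bounded_conv_integrand[OF r_bounded bounded_autocorr[OF v] x]]) (simp add: av corr_shift_def)
    also have "\<dots> = conv r (autocorr u) x + k * (c * conv r (\<lambda>s. autocorr u (s \<otimes> y)) x + cnj c * conv r (\<lambda>s. autocorr u (s \<otimes> inv y)) x)"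
      using y by (simp only: conv_add[OF r_bounded] conv_scale[OF r_bounded] b bt x inv_closed
          bounded_plus_comp bounded_image_mult[OF bounded_image_const])
    also have "\<dots> = corr_shift k c y (conv r (autocorr u)) x"
      using y by (simp only: conv_translate[OF r_bounded b x] inv_closed corr_shift_def)
    finally show ?thesis .
  qed
  have "corr_move k c y p = (\<lambda>x\<in>carrier G. autocorr v x / autocorr v \<one>, \<lambda>x\<in>carrier G. conv r (autocorr v) x / autocorr v \<one>)"
    unfolding corr_move_def prod.inject
  proof (intro conjI restrict_ext)
    fix x assume x: "x \<in> carrier G"
    have s: "corr_shift k c y (\<lambda>x\<in>carrier G. h x / n) x = corr_shift k c y h x / n" for h and n :: complex
      using x y by (simp add: corr_shift_def add_divide_distrib ring_distribs)
    show "corr_shift k c y (fst p) x / corr_weight k c y p = autocorr v x / autocorr v \<one>"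
      unfolding av[OF x] w using s[of "autocorr u" "autocorr u \<one>"] by (simp add: p_def)
    show "corr_shift k c y (snd p) x / corr_weight k c y p = conv r (autocorr v) x / autocorr v \<one>"
      unfolding cv[OF x] w using s[of "conv r (autocorr u)" "autocorr u \<one>"] by (simp add: p_def)
  qed
  moreover have "autocorr v \<one> \<noteq> 0" using w w0 u(2) by simp
  ultimately show "corr_move k c y p \<in> corr_pairs r"
    unfolding corr_pairs_def using v by blast
qed

text \<open>A limit of pairs need not come from any \<open>u\<close>; the bounds survive because
  each is a closed condition on finitely many coordinates.\<close>

lemma corr_closure_bounds:
  assumes p: "p \<in> closure (corr_pairs r)" and x: "x \<in> carrier G"
  shows "norm (fst p x) \<le> 1" "norm (snd p x) \<le> 1" "fst p \<one> = 1"
    "y \<in> carrier G \<Longrightarrow> norm (snd p x - snd p y) \<le> d x y"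
proof -
  have *: "P p" if "closed {p. P p}" "\<And>p. p \<in> corr_pairs r \<Longrightarrow> P p" for P
  proof -
    have "corr_pairs r \<subseteq> {p. P p}" using that(2) by blast
    from closure_minimal[OF this that(1)] show ?thesis using p by blast
  qed
  show "norm (fst p x) \<le> 1"
    by (rule *) (intro closed_Collect_le continuous_intros ev_fst, rule corr_pairs_bounds(1)[OF _ x])
  show "norm (snd p x) \<le> 1"
    by (rule *) (intro closed_Collect_le continuous_intros ev_snd, rule corr_pairs_bounds(2)[OF _ x])
  show "fst p \<one> = 1"
    by (rule *) (intro closed_Collect_eq continuous_intros ev_fst, rule corr_pairs_bounds(3)[OF _ x])
  assume y: "y \<in> carrier G"
  show "norm (snd p x - snd p y) \<le> d x y"
    by (rule *) (intro closed_Collect_le continuous_intros ev_snd, rule corr_pairs_bounds(4)[OF _ x y])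
qed

text \<open>The real part of the weight stays at least \<open>1/5\<close> on the closure, so
  division by the weight is continuous there and stability passes from the pairs to their
  limits.\<close>

lemma corr_closure_move:
  assumes p: "p \<in> closure (corr_pairs r)" and y: "y \<in> carrier G" and c: "norm c = 1" and k: "\<bar>k\<bar> = 2/5"
  shows "corr_move k c y p \<in> closure (corr_pairs r)" "Im (corr_weight k c y p) = 0"
    "1/5 \<le> Re (corr_weight k c y p)"
proof -
  have Re: "1/5 \<le> Re (corr_weight k c y p)" if "p \<in> closure (corr_pairs r)" for p
    by (rule corr_weight_Re_ge[OF _ _ c k]) (use corr_closure_bounds(1)[OF that] y in auto)
  show "1/5 \<le> Re (corr_weight k c y p)" by (rule Re[OF p])
  have cw: "continuous_on S (corr_weight k c y)" for S
    unfolding corr_weight_def by (intro continuous_intros ev_fst)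
  have "closed {p. Im (corr_weight k c y p) = 0}"
    by (intro closed_Collect_eq continuous_intros cw)
  moreover have "corr_pairs r \<subseteq> {p. Im (corr_weight k c y p) = 0}" using corr_move_pairs(2)[OF _ y c k] by blast
  ultimately show "Im (corr_weight k c y p) = 0" using closure_minimal p by blast
  have "continuous_on (closure (corr_pairs r)) (corr_move k c y)"
    unfolding corr_move_def
  proof (intro continuous_on_Pair continuous_on_coordinatewise_then_product)
    have nz: "\<forall>p\<in>closure (corr_pairs r). corr_weight k c y p \<noteq> 0"
    proof
      fix p assume "p \<in> closure (corr_pairs r)"
      from Re[OF this] show "corr_weight k c y p \<noteq> 0" by auto
    qed
    show "continuous_on (closure (corr_pairs r)) (\<lambda>p. (\<lambda>x\<in>carrier G. corr_shift k c y (fst p) x / corr_weight k c y p) x)" for x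
      by (cases "x \<in> carrier G") (auto simp: corr_shift_def intro!: continuous_intros ev_fst cw nz[rule_format])
    show "continuous_on (closure (corr_pairs r)) (\<lambda>p. (\<lambda>x\<in>carrier G. corr_shift k c y (snd p) x / corr_weight k c y p) x)" for x
      by (cases "x \<in> carrier G") (auto simp: corr_shift_def intro!: continuous_intros ev_snd cw nz[rule_format])
  qed
  moreover have "corr_move k c y ` corr_pairs r \<subseteq> closure (corr_pairs r)"
    using corr_move_pairs(1)[OF _ y c k] closure_subset by blast
  ultimately have "corr_move k c y ` closure (corr_pairs r) \<subseteq> closure (corr_pairs r)"
    by (rule image_closure_subset[OF _ closed_closure])
  then show "corr_move k c y p \<in> closure (corr_pairs r)" using p by blast
qed

lemma compact_corr_closure: "compact (closure (corr_pairs r))"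
proof -
  define B where "B = PiE UNIV (\<lambda>x. if x \<in> carrier G then cball 0 1 else {undefined::complex})"
  have "compact B" unfolding B_def by (rule compact_PiE_UNIV) auto
  moreover have "closed B"
  proof -
    have "B = {h. \<forall>x. x \<in> carrier G \<longrightarrow> norm (h x) \<le> 1} \<inter> {h. \<forall>x. x \<notin> carrier G \<longrightarrow> h x = undefined}"
      by (auto simp: B_def PiE_iff split: if_splits)
    also have "closed \<dots>"
      by (intro closed_Int closed_Collect_all closed_Collect_imp closed_Collect_le closed_Collect_eq open_Collect_const
          continuous_intros continuous_on_product_coordinates)
    finally show ?thesis .
  qed
  moreover have "corr_pairs r \<subseteq> B \<times> B"
  proof
    fix p assume p: "p \<in> corr_pairs r"
    then have "fst p x = undefined" "snd p x = undefined" if "x \<notin> carrier G" for x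
      using that unfolding corr_pairs_def by auto
    then show "p \<in> B \<times> B" using corr_pairs_bounds(1,2)[OF p] unfolding B_def by (cases p) (auto simp: PiE_iff)
  qed
  ultimately have "compact (B \<times> B)" "closure (corr_pairs r) \<subseteq> B \<times> B"
    by (simp_all add: compact_Times closed_Times closure_minimal)
  then show ?thesis by (metis Int_absorb1 closed_closure compact_Int_closed)
qed

end
end

text \<open>Extremality makes \<open>\<theta> p\<close> a common eigenfunction of all shifts: it is
  a convex combination of the functions \<open>\<theta>\<close> of the moves with
  \<open>k = 2/5\<close> and \<open>k = -2/5\<close>, hence equal to both. So the shift of
  \<open>\<theta> p\<close> is the weight times \<open>\<theta> p\<close>, and the eigenvalue is
  read off from the first component of \<open>p\<close>.\<close>

lemma (in metric_mean) exists_correlation_eigenpair: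
  fixes r :: "'a \<Rightarrow> complex"
  assumes r: "\<forall>x\<in>carrier G. norm (r x) \<le> 1" "\<forall>x\<in>carrier G. \<forall>y\<in>carrier G. norm (r x - r y) \<le> d x y"
    and a: "a \<in> carrier G"
    and p0: "p0 \<in> corr_pairs r" "z0 \<in> carrier G" "snd p0 z0 \<noteq> snd p0 (z0 \<otimes> a)"
  obtains \<phi> \<zeta> :: "'a \<Rightarrow> complex" where "\<phi> \<one> = 1" "\<And>x. x \<in> carrier G \<Longrightarrow> norm (\<phi> x) \<le> 1" "\<And>x. x \<in> carrier G \<Longrightarrow> norm (\<zeta> x) \<le> 1"
    "\<And>x y. \<lbrakk>x \<in> carrier G; y \<in> carrier G\<rbrakk> \<Longrightarrow> norm (\<zeta> x - \<zeta> y) \<le> d x y"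
    "\<exists>x\<in>carrier G. \<zeta> x - \<zeta> (x \<otimes> a) \<noteq> 0"
    "\<And>x y. \<lbrakk>x \<in> carrier G; y \<in> carrier G\<rbrakk> \<Longrightarrow> \<zeta> (x \<otimes> y) - \<zeta> (x \<otimes> y \<otimes> a) = \<phi> y * (\<zeta> x - \<zeta> (x \<otimes> a))"
proof -
  note bounds = corr_closure_bounds[OF r] and move = corr_closure_move[OF r]
  define \<theta> :: "('a \<Rightarrow> complex) \<times> ('a \<Rightarrow> complex) \<Rightarrow> 'a \<Rightarrow> complex"
    where "\<theta> = (\<lambda>p x. snd p x - snd p (x \<otimes> a))"
  let ?Z = "closure (corr_pairs r)"
  obtain q :: "nat \<Rightarrow> 'a" where q: "range q \<subseteq> carrier G" "\<And>x e. \<lbrakk>x \<in> carrier G; e > 0\<rbrakk> \<Longrightarrow> \<exists>k. d x (q k) < e"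
    using exists_dense_sequence[OF tb] by blast
  have qG: "q k \<in> carrier G" for k using q(1) by blast
  have \<theta>_Lip: "norm (\<theta> p x - \<theta> p y) \<le> 2 * d x y" if "p \<in> ?Z" "x \<in> carrier G" "y \<in> carrier G" for p x y
  proof -
    have "norm (\<theta> p x - \<theta> p y) \<le> norm (snd p x - snd p y) + norm (snd p (x \<otimes> a) - snd p (y \<otimes> a))"
      unfolding \<theta>_def using norm_triangle_ineq4[of "snd p x - snd p y" "snd p (x \<otimes> a) - snd p (y \<otimes> a)"]
      by (simp add: algebra_simps)
    also have "\<dots> \<le> d x y + d (x \<otimes> a) (y \<otimes> a)" using that a by (intro add_mono bounds(4)) auto
    finally show ?thesis using d_inv[OF that(2,3) a] by simp
  qed
  have \<theta>_le: "norm (\<theta> p x) \<le> 2" if "p \<in> ?Z" "x \<in> carrier G" for p x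
    unfolding \<theta>_def using norm_triangle_ineq4[of "snd p x" "snd p (x \<otimes> a)"] bounds(2)[OF that]
      bounds(2)[OF that(1), of "x \<otimes> a"] that a by simp
  have p0Z: "p0 \<in> ?Z" using p0 closure_subset by blast
  have "\<exists>k. \<theta> p0 (q k) \<noteq> 0"
  proof (rule ccontr)
    assume "\<nexists>k. \<theta> p0 (q k) \<noteq> 0"
    then have z: "\<theta> p0 (q k) = 0" for k by blast
    have "\<theta> p0 z0 = 0"
      by (rule Lipschitz_eq_on_dense[OF q, of "\<theta> p0" 2 "\<lambda>x. 0" z0]) (simp_all add: z \<theta>_Lip[OF p0Z] p0 d_nonneg)
    then show False using p0 by (simp add: \<theta>_def)
  qed
  then obtain k0 where k0: "\<theta> p0 (q k0) \<noteq> 0" by blast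
  \<comment> \<open>Restricting to the dense points turns functions into sequences without loss,
    since all \<open>\<theta> p\<close> share the Lipschitz constant 2.\<close>
  define S where "S = (\<lambda>p k. \<theta> p (q k)) ` ?Z"
  have "compact S" unfolding S_def
    by (intro compact_continuous_image compact_corr_closure[OF r] continuous_on_coordinatewise_then_product)
       (auto simp: \<theta>_def intro!: continuous_intros ev_snd)
  moreover have "norm (s k) \<le> 2" if "s \<in> S" for s k using that \<theta>_le[OF _ qG] unfolding S_def by blast
  moreover have "(\<lambda>k. \<theta> p0 (q k)) \<in> S" using p0Z by (auto simp: S_def)
  ultimately obtain e where e: "e \<in> S" "\<exists>k. e k \<noteq> 0"
    "\<forall>a\<in>S. \<forall>b\<in>S. \<forall>t. 0 < t \<longrightarrow> t < 1 \<longrightarrow> (\<forall>k. e k = complex_of_real t * a k + complex_of_real (1 - t) * b k) \<longrightarrow> a = b"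
    using k0 by (rule compact_sequences_nonzero_extreme_point)
  then obtain p where p: "p \<in> ?Z" and ep: "e = (\<lambda>k. \<theta> p (q k))" by (auto simp: S_def)
  have key: "c * \<theta> p (x \<otimes> y) + cnj c * \<theta> p (x \<otimes> inv y) = (c * fst p y + cnj c * fst p (inv y)) * \<theta> p x"
    if x: "x \<in> carrier G" and y: "y \<in> carrier G" and c: "norm c = 1" for c x y
  proof -
    define w where "w = (\<lambda>k. Re (corr_weight k c y p))"
    have w: "corr_weight k c y p = of_real (w k)" "1/5 \<le> w k" if "\<bar>k\<bar> = 2/5" for k
      using move(2,3)[OF p y c that] by (auto simp: w_def complex_eq_iff)
    define P where "P = (\<lambda>k. corr_move k c y p)"
    have P: "P k \<in> ?Z" if "\<bar>k\<bar> = 2/5" for k using move(1)[OF p y c that] by (simp add: P_def)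
    have \<theta>P: "\<theta> (P k) z = corr_shift k c y (\<theta> p) z / of_real (w k)" if k: "\<bar>k\<bar> = 2/5" and z: "z \<in> carrier G" for k z
    proof -
      have 1: "z \<otimes> a \<otimes> y = z \<otimes> y \<otimes> a" "z \<otimes> a \<otimes> inv y = z \<otimes> inv y \<otimes> a" using z a y by (simp_all add: m_ac)
      show ?thesis
        using z a y by (simp add: \<theta>_def P_def corr_move_def w(1)[OF k] corr_shift_def 1 diff_divide_distrib[symmetric])
          (simp add: algebra_simps)
    qed
    have 2: "\<bar>2/5\<bar> = (2/5::real)" "\<bar>-2/5\<bar> = (2/5::real)" by simp_all
    \<comment> \<open>The weights for \<open>k\<close> and \<open>-k\<close> add up to 2, as their
      parts linear in \<open>k\<close> cancel; halved, they are the coefficients of a convex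
      combination.\<close>
    define t where "t = w (2/5) / 2"
    have "corr_weight (2/5) c y p + corr_weight (-2/5) c y p = 2" by (simp add: corr_weight_def)
    then have "Re (corr_weight (2/5) c y p + corr_weight (-2/5) c y p) = 2" by simp
    then have "w (2/5) + w (-2/5) = 2" by (simp add: w_def)
    then have t: "w (2/5) = 2 * t" "w (-2/5) = 2 * (1 - t)" by (auto simp: t_def)
    have t01: "0 < t" "t < 1" using w(2)[OF 2(1)] w(2)[OF 2(2)] t by auto
    have comb: "\<theta> p z = of_real t * \<theta> (P (2/5)) z + of_real (1 - t) * \<theta> (P (-2/5)) z" if z: "z \<in> carrier G" for z
    proof -
      have tt: "complex_of_real t \<noteq> 0" "complex_of_real (1 - t) \<noteq> 0" using t01 by (simp_all only: of_real_eq_0_iff)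
      have "of_real t * \<theta> (P (2/5)) z = corr_shift (2/5) c y (\<theta> p) z / 2"
        unfolding \<theta>P[OF 2(1) z] t of_real_mult using tt by simp
      moreover have "of_real (1 - t) * \<theta> (P (-2/5)) z = corr_shift (-2/5) c y (\<theta> p) z / 2"
        unfolding \<theta>P[OF 2(2) z] t of_real_mult using tt by (simp del: of_real_diff)
      moreover have "\<theta> p z = corr_shift (2/5) c y (\<theta> p) z / 2 + corr_shift (-2/5) c y (\<theta> p) z / 2"
        by (simp add: corr_shift_def add_divide_distrib[symmetric])
      ultimately show ?thesis by (simp only:)
    qed
    \<comment> \<open>Extremality identifies the differences of the two moves at the dense points;
      the common Lipschitz bound extends this to the whole group.\<close>
    have "(\<lambda>k. \<theta> (P (2/5)) (q k)) = (\<lambda>k. \<theta> (P (-2/5)) (q k))"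
      by (rule e(3)[rule_format, OF _ _ t01]) (use P[OF 2(1)] P[OF 2(2)] comb q(1) in \<open>auto simp: S_def ep\<close>)
    then have "\<theta> (P (2/5)) (q k) = \<theta> (P (-2/5)) (q k)" for k by metis
    then have "\<theta> (P (2/5)) x = \<theta> (P (-2/5)) x"
      by (intro Lipschitz_eq_on_dense[OF q \<theta>_Lip[OF P[OF 2(1)]] \<theta>_Lip[OF P[OF 2(2)]] _ x]) auto
    then have "\<theta> p x = \<theta> (P (2/5)) x" using comb[OF x] by (simp add: algebra_simps)
    then have "corr_shift (2/5) c y (\<theta> p) x = \<theta> p x * corr_weight (2/5) c y p"
      using \<theta>P[OF 2(1) x] w[OF 2(1)] by (simp add: field_simps)
    moreover have "A = B * U" if "U + complex_of_real (2/5) * A = U * (1 + complex_of_real (2/5) * B)" for A B U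
    proof -
      have "complex_of_real (2/5) * A = complex_of_real (2/5) * (B * U)"
        using that by (simp only: distrib_left mult_1_left mult_1_right add_left_cancel mult_ac)
      then show ?thesis by simp
    qed
    ultimately show ?thesis unfolding corr_shift_def corr_weight_def by blast
  qed
  have mult: "\<theta> p (x \<otimes> y) = fst p y * \<theta> p x" if "x \<in> carrier G" "y \<in> carrier G" for x y
  proof -
    \<comment> \<open>Phase 1 gives the sum over \<open>y\<close> and its inverse, phase
      \<open>\<i>\<close> the difference; together they isolate \<open>y\<close>.\<close>
    have plus: "\<theta> p (x \<otimes> y) + \<theta> p (x \<otimes> inv y) = (fst p y + fst p (inv y)) * \<theta> p x" using key[OF that, of 1] by simp
    have "\<i> * (\<theta> p (x \<otimes> y) - \<theta> p (x \<otimes> inv y)) = \<i> * ((fst p y - fst p (inv y)) * \<theta> p x)"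
      using key[OF that, of \<i>] by (simp add: algebra_simps)
    then have minus: "\<theta> p (x \<otimes> y) - \<theta> p (x \<otimes> inv y) = (fst p y - fst p (inv y)) * \<theta> p x" by simp
    have "2 * \<theta> p (x \<otimes> y) = (\<theta> p (x \<otimes> y) + \<theta> p (x \<otimes> inv y)) + (\<theta> p (x \<otimes> y) - \<theta> p (x \<otimes> inv y))" by simp
    also have "\<dots> = 2 * (fst p y * \<theta> p x)" unfolding plus minus by (simp add: algebra_simps)
    finally show ?thesis by simp
  qed
  show ?thesis
  proof (rule that[of "fst p" "snd p"])
    show "\<exists>x\<in>carrier G. snd p x - snd p (x \<otimes> a) \<noteq> 0" using e(2) q(1) by (auto simp: ep \<theta>_def)
  qed (use bounds[OF p] mult in \<open>auto simp: \<theta>_def\<close>)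
qed

text \<open>The starting pair comes from \<open>u = F\<close>. Up to a factor its second component
  is the convolution of \<open>r\<close> with itself, that is, the autocorrelation of
  \<open>r\<close> at the inverse. Strict decrease of autocorrelations, applied to \<open>F\<close>
  and then to \<open>r\<close>, shows that this component separates the identity from the inverse of
  \<open>x0\<close>.\<close>

theorem (in invariant_pseudometric) exists_separating_character:
  fixes f :: "'a \<Rightarrow> real"
  assumes tb: "totally_bounded_pm G d"
    and f_bounds: "\<forall>x\<in>carrier G. 0 \<le> f x \<and> f x \<le> 1"
    and f_Lip: "\<forall>x\<in>carrier G. \<forall>y\<in>carrier G. \<bar>f x - f y\<bar> \<le> d x y"
    and x0: "x0 \<in> carrier G" "f x0 \<noteq> f \<one>"
  obtains ch :: "'a \<Rightarrow> complex" and K where "\<And>x. x \<in> carrier G \<Longrightarrow> norm (ch x) = 1"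
    "\<And>x y. \<lbrakk>x \<in> carrier G; y \<in> carrier G\<rbrakk> \<Longrightarrow> ch (x \<otimes> y) = ch x * ch y"
    "\<And>x y. \<lbrakk>x \<in> carrier G; y \<in> carrier G\<rbrakk> \<Longrightarrow> norm (ch x - ch y) \<le> K * d x y" "ch x0 \<noteq> 1"
proof -
  note f = f_bounds[rule_format] f_Lip[rule_format]
  obtain M where "invariant_mean G M" using exists_invariant_mean by blast
  then interpret metric_mean G d M
    by unfold_locales (auto simp: invariant_mean_def mean_def tb)
  define F where "F = (\<lambda>t. complex_of_real (f t))"
  have F1: "norm (F t) \<le> 1" if "t \<in> carrier G" for t using f(1)[OF that] by (simp add: F_def)
  have bF: "bounded (F ` carrier G)" using F1 unfolding bounded_iff by blast
  have F_Lip: "norm (F x - F y) \<le> 1 * d x y" if "x \<in> carrier G" "y \<in> carrier G" for x y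
    using f(2)[OF that] by (simp add: F_def flip: of_real_diff)
  define r where "r = autocorr F"
  have bi: "bounded ((\<lambda>t. F (x \<otimes> t) * cnj (F t)) ` carrier G)" if "x \<in> carrier G" for x
    by (intro bounded_intros bF bounded_translate[OF bF that])
  have r_nn: "r x \<in> \<real>\<^sub>\<ge>\<^sub>0" if "x \<in> carrier G" for x
    unfolding r_def autocorr_def by (rule nonneg[OF bi[OF that]]) (use f that in \<open>simp add: F_def flip: of_real_mult\<close>)
  have r_le: "norm (r x) \<le> 1" if x: "x \<in> carrier G" for x
    unfolding r_def autocorr_def
  proof (rule norm_le)
    fix t assume "t \<in> carrier G"
    then have "norm (F (x \<otimes> t)) * norm (F t) \<le> 1 * 1" using x by (intro mult_mono F1) auto
    then show "norm (F (x \<otimes> t) * cnj (F t)) \<le> 1" by (simp add: norm_mult)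
  qed
  have r_Lip: "norm (r x - r y) \<le> d x y" if x: "x \<in> carrier G" and y: "y \<in> carrier G" for x y
  proof -
    have "r x - r y = M (\<lambda>t. F (x \<otimes> t) * cnj (F t) - F (y \<otimes> t) * cnj (F t))"
      unfolding r_def autocorr_def by (simp only: diff bi x y)
    also have "norm \<dots> \<le> d x y"
    proof (rule norm_le)
      fix t assume t: "t \<in> carrier G"
      have "norm (F (x \<otimes> t) - F (y \<otimes> t)) * norm (F t) \<le> d x y * 1"
        using F_Lip[of "x \<otimes> t" "y \<otimes> t"] d_inv[OF x y t] x y t F1[OF t] d_nonneg[OF x y] by (intro mult_mono) auto
      then show "norm (F (x \<otimes> t) * cnj (F t) - F (y \<otimes> t) * cnj (F t)) \<le> d x y"
        by (simp add: left_diff_distrib[symmetric] norm_mult)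
    qed
    finally show ?thesis .
  qed
  have r_inv: "r (inv x) = r x" if x: "x \<in> carrier G" for x
  proof -
    have "r (inv x) = M (\<lambda>t. F (inv x \<otimes> (x \<otimes> t)) * cnj (F (x \<otimes> t)))"
      unfolding r_def autocorr_def using M_inv[OF x bi[of "inv x"]] x by simp
    also have "\<dots> = M (\<lambda>t. F (x \<otimes> t) * cnj (F t))"
    proof (rule cong)
      show "bounded ((\<lambda>t. F (inv x \<otimes> (x \<otimes> t)) * cnj (F (x \<otimes> t))) ` carrier G)"
        using bounded_translate[OF bi[of "inv x"] x] x by simp
      fix t assume t: "t \<in> carrier G"
      have "inv x \<otimes> (x \<otimes> t) = t" using x t by (simp add: m_assoc[symmetric])
      then show "F (inv x \<otimes> (x \<otimes> t)) * cnj (F (x \<otimes> t)) = F (x \<otimes> t) * cnj (F t)" by (simp add: F_def)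
    qed
    finally show ?thesis by (simp add: r_def autocorr_def)
  qed
  have br: "bounded (r ` carrier G)" unfolding r_def by (rule bounded_autocorr[OF bF])
  have r_real: "r x \<in> \<real>" if "x \<in> carrier G" for x using r_nn[OF that] nonneg_Reals_subset_Reals by blast
  have r_less: "Re (r x0) < Re (r \<one>)"
    unfolding r_def by (rule autocorr_translate_less[OF F_Lip bF _ x0(1)]) (use x0 in \<open>auto simp: F_def\<close>)
  then have r1: "r \<one> \<noteq> 0" using r_nn[OF x0(1)] by (auto simp: complex_nonneg_Reals_iff)
  have rr_less: "Re (autocorr r x0) < Re (autocorr r \<one>)"
    by (rule autocorr_translate_less[of _ 1, OF _ br r_real x0(1)]) (use r_Lip r_less in auto)
  have conv_rr: "conv r r (inv x) = autocorr r x" if x: "x \<in> carrier G" for x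
    unfolding conv_def autocorr_def
  proof (rule cong[OF bounded_conv_integrand[OF br br]])
    fix s assume s: "s \<in> carrier G"
    have "inv x \<otimes> inv s = inv (x \<otimes> s)" using x s by (simp add: inv_mult)
    then show "r (inv x \<otimes> inv s) * r s = r (x \<otimes> s) * cnj (r s)"
      using r_inv[of "x \<otimes> s"] x s r_real[OF s] by (simp add: Reals_cnj_iff)
  qed (use x in simp)
  define p0 where "p0 = (\<lambda>x\<in>carrier G. autocorr F x / autocorr F \<one>, \<lambda>x\<in>carrier G. conv r (autocorr F) x / autocorr F \<one>)"
  have p0: "p0 \<in> corr_pairs r" unfolding corr_pairs_def p0_def using bF r1 by (auto simp: r_def)
  have snd0: "snd p0 (inv x) = autocorr r x / r \<one>" if "x \<in> carrier G" for x
    using conv_rr[OF that] that by (simp add: p0_def flip: r_def)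
  have "autocorr r \<one> \<noteq> autocorr r x0" using rr_less by auto
  then have neq: "snd p0 \<one> \<noteq> snd p0 (\<one> \<otimes> inv x0)"
    using snd0[OF one_closed] snd0[OF x0(1)] x0 r1 by simp
  have r_ball: "\<forall>x\<in>carrier G. norm (r x) \<le> 1" "\<forall>x\<in>carrier G. \<forall>y\<in>carrier G. norm (r x - r y) \<le> d x y"
    using r_le r_Lip by auto
  obtain \<phi> \<zeta> :: "'a \<Rightarrow> complex" where one: "\<phi> \<one> = 1" and \<phi>_le: "\<And>x. x \<in> carrier G \<Longrightarrow> norm (\<phi> x) \<le> 1"
    and \<zeta>_le: "\<And>x. x \<in> carrier G \<Longrightarrow> norm (\<zeta> x) \<le> 1"
    and \<zeta>_Lip: "\<And>x y. \<lbrakk>x \<in> carrier G; y \<in> carrier G\<rbrakk> \<Longrightarrow> norm (\<zeta> x - \<zeta> y) \<le> d x y"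
    and nz: "\<exists>x\<in>carrier G. \<zeta> x - \<zeta> (x \<otimes> inv x0) \<noteq> 0"
    and mult: "\<And>x y. \<lbrakk>x \<in> carrier G; y \<in> carrier G\<rbrakk> \<Longrightarrow>
      \<zeta> (x \<otimes> y) - \<zeta> (x \<otimes> y \<otimes> inv x0) = \<phi> y * (\<zeta> x - \<zeta> (x \<otimes> inv x0))"
    using that by (rule exists_correlation_eigenpair[OF r_ball inv_closed[OF x0(1)] p0 one_closed neq])
  define T where "T = \<zeta> \<one> - \<zeta> (inv x0)"
  have \<theta>: "\<zeta> x - \<zeta> (x \<otimes> inv x0) = \<phi> x * T" if "x \<in> carrier G" for x
    using mult[OF one_closed that] that x0 by (simp add: T_def)
  have T: "T \<noteq> 0" using nz \<theta> by auto
  have hom: "\<phi> (x \<otimes> y) = \<phi> x * \<phi> y" if "x \<in> carrier G" "y \<in> carrier G" for x y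
  proof -
    have "\<phi> (x \<otimes> y) * T = \<phi> y * (\<phi> x * T)" using mult[OF that] \<theta>[of "x \<otimes> y"] \<theta>[OF that(1)] that by simp
    then show ?thesis using T by simp
  qed
  show ?thesis
  proof
    show "\<phi> (x \<otimes> y) = \<phi> x * \<phi> y" if "x \<in> carrier G" "y \<in> carrier G" for x y by (rule hom[OF that])
    show "norm (\<phi> x) = 1" if x: "x \<in> carrier G" for x
    proof -
      have "norm (\<phi> x) * norm (\<phi> (inv x)) = 1" using hom[of x "inv x"] x one by (simp flip: norm_mult)
      moreover have "norm (\<phi> x) * norm (\<phi> (inv x)) \<le> norm (\<phi> x) * 1"
        using \<phi>_le[of "inv x"] x by (intro mult_left_mono) auto
      ultimately show ?thesis using \<phi>_le[OF x] by simp
    qed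
    \<comment> \<open>Continuity of \<open>\<phi>\<close> is inherited from \<open>\<zeta>\<close>:
      times the nonzero constant \<open>T\<close> it is a difference of two Lipschitz
      functions.\<close>
    show "norm (\<phi> x - \<phi> y) \<le> 2 / norm T * d x y" if x: "x \<in> carrier G" and y: "y \<in> carrier G" for x y
    proof -
      have "(\<phi> x - \<phi> y) * T = (\<zeta> x - \<zeta> y) - (\<zeta> (x \<otimes> inv x0) - \<zeta> (y \<otimes> inv x0))"
        using \<theta>[OF x] \<theta>[OF y] by (simp add: algebra_simps)
      then have "norm (\<phi> x - \<phi> y) * norm T \<le> norm (\<zeta> x - \<zeta> y) + norm (\<zeta> (x \<otimes> inv x0) - \<zeta> (y \<otimes> inv x0))"
        by (metis norm_mult norm_triangle_ineq4)
      also have "\<dots> \<le> d x y + d x y"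
        using \<zeta>_Lip[OF x y] \<zeta>_Lip[of "x \<otimes> inv x0" "y \<otimes> inv x0"] d_inv[OF x y, of "inv x0"] x y x0 by simp
      finally show ?thesis using T by (simp add: field_simps)
    qed
    show "\<phi> x0 \<noteq> 1"
    proof
      assume 1: "\<phi> x0 = 1"
      \<comment> \<open>With the value 1 at \<open>x0\<close>, every step along the powers of
        \<open>x0\<close> adds the same nonzero \<open>T\<close> to \<open>\<zeta>\<close>, which is
        bounded by 1.\<close>
      have pow: "\<phi> (x0 [^] n) = 1" for n :: nat using hom x0(1) 1 one by (induction n) auto
      have "\<zeta> (x0 [^] n) = \<zeta> \<one> + of_nat n * T" for n :: nat
      proof (induction n)
        case (Suc n)
        have "x0 [^] Suc n \<otimes> inv x0 = x0 [^] n" using x0 by (simp add: m_assoc)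
        then have "\<zeta> (x0 [^] Suc n) - \<zeta> (x0 [^] n) = T" using \<theta>[of "x0 [^] Suc n"] pow[of "Suc n"] x0 by simp
        then show ?case using Suc by (simp add: algebra_simps)
      qed simp
      then have n: "real n * norm T \<le> 2" for n
        using norm_triangle_ineq4[of "\<zeta> (x0 [^] n)" "\<zeta> \<one>"] \<zeta>_le[of "x0 [^] n"] \<zeta>_le[OF one_closed] x0
        by (simp add: norm_mult)
      obtain n where "2 / norm T < real n" using reals_Archimedean2 by blast
      then show False using n[of n] T by (simp add: field_simps)
    qed
  qed
qed

section \<open>Characters determine the topology\<close>

lemma continuous_map_into_fun:
  assumes "\<And>i. continuous_map X euclidean (\<lambda>x. f x i)"
  shows "continuous_map X euclidean f"
proof -
  have "continuous_map X (product_topology (\<lambda>i. euclidean) UNIV) f"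
    using assms by (intro continuous_map_coordinatewise_then_product) auto
  then show ?thesis by (simp add: euclidean_product_topology)
qed

lemma tendsto_coordinate:
  assumes "(f \<longlongrightarrow> l) F"
  shows "((\<lambda>x. f x i) \<longlongrightarrow> l i) F"
  by (rule continuous_on_tendsto_compose[OF continuous_on_product_coordinates assms]) auto

text \<open>If \<open>p\<close> were a limit point outside the image, the inverse distance to
  \<open>p\<close> would be an unbounded continuous function. The metric target is the reason for
  handling countably many characters at a time.\<close>

lemma pseudocompact_image_compact:
  fixes E :: "'a \<Rightarrow> 'b::metric_space"
  assumes X: "pseudocompact X" and E: "continuous_map X euclidean E"
    and K: "compact K" "E ` topspace X \<subseteq> K"
  shows "compact (E ` topspace X)"
proof -
  have "closure (E ` topspace X) \<subseteq> E ` topspace X"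
  proof
    fix p assume p: "p \<in> closure (E ` topspace X)"
    show "p \<in> E ` topspace X"
    proof (rule ccontr)
      assume np: "p \<notin> E ` topspace X"
      have "continuous_map X euclidean (\<lambda>x. dist (E x) p)"
        using continuous_map_compose[OF E, of euclidean "\<lambda>y. dist y p"] by (simp add: o_def continuous_intros)
      then have "continuous_map X euclideanreal (\<lambda>x. inverse (dist (E x) p))"
        by (rule continuous_map_real_inverse) (use np in auto)
      then have "bounded ((\<lambda>x. inverse (dist (E x) p)) ` topspace X)" using X by (simp add: pseudocompact_def)
      then obtain B where B: "B > 0" "\<And>x. x \<in> topspace X \<Longrightarrow> inverse (dist (E x) p) \<le> B"
        by (auto simp: bounded_pos)
      obtain x where x: "x \<in> topspace X" "dist (E x) p < inverse B"
        using p B(1) unfolding closure_approachable by (metis imageE positive_imp_inverse_positive)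
      have "dist (E x) p > 0" using np x by auto
      then have "B < inverse (dist (E x) p)" using less_imp_inverse_less[OF x(2)] by simp
      then show False using B(2)[OF x(1)] by simp
    qed
  qed
  then have "closed (E ` topspace X)" by (simp add: closure_subset_eq)
  from compact_Int_closed[OF K(1) this] show ?thesis using K(2) by (simp add: Int_absorb1)
qed

lemma character_facts:
  assumes "ch \<in> characters G X" and "topspace X = carrier G"
  shows "x \<in> carrier G \<Longrightarrow> norm (ch x) = 1"
    "\<lbrakk>x \<in> carrier G; y \<in> carrier G\<rbrakk> \<Longrightarrow> ch (x \<otimes>\<^bsub>G\<^esub> y) = ch x * ch y"
    "ch \<in> extensional (carrier G)" "continuous_map X euclidean ch"
  using assms unfolding characters_def circle_top_def
  by (auto simp: continuous_map_in_subtopology)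

context topological_comm_group
begin

lemmas char = character_facts[OF _ topspace_eq]

lemma charI:
  assumes "continuous_map X euclidean ch" "\<And>x. x \<in> carrier G \<Longrightarrow> norm (ch x) = 1"
    "\<And>x y. \<lbrakk>x \<in> carrier G; y \<in> carrier G\<rbrakk> \<Longrightarrow> ch (x \<otimes> y) = ch x * ch y"
  shows "restrict ch (carrier G) \<in> characters G X"
proof -
  have "continuous_map X circle_top ch"
    using assms topspace_eq by (auto simp: circle_top_def continuous_map_in_subtopology)
  then have "continuous_map X circle_top (restrict ch (carrier G))"
    by (rule continuous_map_eq) (simp add: topspace_eq)
  then show ?thesis using assms by (simp add: characters_def)
qed

lemma compact_char_image:
  assumes "pseudocompact X" "\<And>n::nat. c n \<in> characters G X"
  shows "compact ((\<lambda>x n. c n x) ` carrier G)"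
proof -
  have "compact ((\<lambda>x n. c n x) ` topspace X)"
  proof (rule pseudocompact_image_compact[OF assms(1)])
    show "continuous_map X euclidean (\<lambda>x n. c n x)"
      by (rule continuous_map_into_fun) (use char(4) assms(2) in blast)
    show "compact (PiE UNIV (\<lambda>n::nat. sphere 0 1 :: complex set))" by (rule compact_PiE_UNIV) simp
    show "(\<lambda>x n. c n x) ` topspace X \<subseteq> PiE UNIV (\<lambda>n. sphere 0 1)"
      using char(1)[OF assms(2)] topspace_eq by auto
  qed
  then show ?thesis by (simp add: topspace_eq)
qed

text \<open>A character that is not 1 at \<open>x\<close> omits the value 1 on a small ball about a
  dense point that contains \<open>x\<close>. With radii \<open>1 / real (Suc n)\<close> there are
  countably many such balls, and one character is chosen for each.\<close>

lemma countable_separating_characters: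
  assumes X: "pseudocompact X" and d: "continuous_pseudometric G X d"
    and f_bounds: "\<forall>x\<in>carrier G. 0 \<le> f x \<and> f x \<le> 1"
    and f_Lip: "\<forall>x\<in>carrier G. \<forall>y\<in>carrier G. \<bar>f x - f y\<bar> \<le> d x y"
  obtains c :: "nat \<Rightarrow> 'a \<Rightarrow> complex" where "\<And>n. c n \<in> characters G X"
    "\<And>x. \<lbrakk>x \<in> carrier G; f x \<noteq> f \<one>\<rbrakk> \<Longrightarrow> \<exists>n. c n x \<noteq> 1"
proof -
  interpret d: continuous_pseudometric G X d by fact
  have tb: "totally_bounded_pm G d" by (rule d.pseudocompact_imp_totally_bounded[OF X])
  obtain q :: "nat \<Rightarrow> 'a" where q: "range q \<subseteq> carrier G" "\<And>x e. \<lbrakk>x \<in> carrier G; e > 0\<rbrakk> \<Longrightarrow> \<exists>k. d x (q k) < e"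
    using d.exists_dense_sequence[OF tb] by blast
  define good where "good = (\<lambda>(k,n) ch. ch \<in> characters G X \<and> (\<forall>y\<in>carrier G. d y (q k) < 1 / real (Suc n) \<longrightarrow> ch y \<noteq> 1))"
  have triv: "(\<lambda>x\<in>carrier G. 1) \<in> characters G X" by (rule charI) auto
  define c where "c = (\<lambda>m. if \<exists>ch. good (prod_decode m) ch then SOME ch. good (prod_decode m) ch else (\<lambda>x\<in>carrier G. 1))"
  have c_good: "good (prod_decode m) (c m)" if "\<exists>ch. good (prod_decode m) ch" for m
    using someI_ex[OF that] that by (simp add: c_def)
  show ?thesis
  proof
    show "c m \<in> characters G X" for m
    proof (cases "\<exists>ch. good (prod_decode m) ch")
      case True
      then show ?thesis using c_good[OF True] by (simp add: good_def split_beta)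
    next
      case False
      then have "c m = (\<lambda>x\<in>carrier G. 1)" unfolding c_def by (rule if_not_P)
      then show ?thesis using triv by simp
    qed
    fix x assume x: "x \<in> carrier G" "f x \<noteq> f \<one>"
    obtain ch :: "'a \<Rightarrow> complex" and K where ch: "\<And>x. x \<in> carrier G \<Longrightarrow> norm (ch x) = 1"
      "\<And>x y. \<lbrakk>x \<in> carrier G; y \<in> carrier G\<rbrakk> \<Longrightarrow> ch (x \<otimes> y) = ch x * ch y"
      and Lip: "\<And>x y. \<lbrakk>x \<in> carrier G; y \<in> carrier G\<rbrakk> \<Longrightarrow> norm (ch x - ch y) \<le> K * d x y" and ne: "ch x \<noteq> 1"
      using that by (rule d.exists_separating_character[OF tb f_bounds f_Lip x])
    have "continuous_map X euclidean ch" by (rule d.continuous_map_Lipschitz) (use Lip in \<open>simp add: dist_norm\<close>)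
    then have chX: "restrict ch (carrier G) \<in> characters G X" by (rule charI[OF _ ch])
    \<comment> \<open>Two points in a ball of radius below \<open>e\<close> have distance less than
      \<open>2 * e\<close>, which the Lipschitz constant turns into less than the distance of
      \<open>ch x\<close> from 1.\<close>
    define e where "e = norm (ch x - 1) / (2 * (\<bar>K\<bar> + 1))"
    have e: "e > 0" using ne by (simp add: e_def)
    obtain n where n: "1 / real (Suc n) < e" using nat_approx_posE[OF e] .
    obtain k where k: "d x (q k) < 1 / real (Suc n)" using q(2)[OF x(1), of "1 / real (Suc n)"] by auto
    have qk: "q k \<in> carrier G" using q(1) by blast
    have "good (k, n) (restrict ch (carrier G))"
      unfolding good_def prod.case
    proof (intro conjI chX ballI impI notI)
      fix y assume y: "y \<in> carrier G" "d y (q k) < 1 / real (Suc n)" "restrict ch (carrier G) y = 1"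
      have "d x y < 2 * e" using d.d_triangle[OF x(1) qk y(1)] k y(2) n d.d_sym[OF y(1) qk] by linarith
      have "norm (ch x - ch y) \<le> K * d x y" using Lip x y by blast
      also have "\<dots> \<le> (\<bar>K\<bar> + 1) * d x y" using d.d_nonneg[OF x(1) y(1)] by (intro mult_right_mono) auto
      also have "\<dots> < (\<bar>K\<bar> + 1) * (2 * e)" using \<open>d x y < 2 * e\<close> by (intro mult_strict_left_mono) auto
      also have "\<dots> = norm (ch x - 1)"
      proof -
        have "A * (2 * (N / (2 * A))) = N" if "A > 0" for A N :: real using that by simp
        from this[of "\<bar>K\<bar> + 1"] show ?thesis unfolding e_def by (simp del: times_divide_eq_right)
      qed
      finally show False using y by simp
    qed
    then have "good (prod_decode (prod_encode (k, n))) (c (prod_encode (k, n)))" by (intro c_good) auto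
    then have "c (prod_encode (k, n)) x \<noteq> 1" using x k by (simp add: good_def)
    then show "\<exists>n. c n x \<noteq> 1" by blast
  qed
qed

text \<open>On the compact joint image of \<open>f\<close> and the characters, the condition that
  \<open>f\<close> be at least \<open>1/2\<close> cuts out a compact set, to which all points off
  \<open>U\<close> belong. It is covered by the open conditions that some character is away from 1,
  and a finite subcover yields \<open>S\<close> and \<open>\<delta>\<close>.\<close>

theorem characters_determine_topology:
  assumes X: "pseudocompact X" and U: "openin X U" "\<one> \<in> U"
  obtains S \<delta> where "finite S" "S \<subseteq> characters G X" "\<delta> > 0"
    "\<And>x. \<lbrakk>x \<in> carrier G; \<forall>ch\<in>S. norm (ch x - 1) < \<delta>\<rbrakk> \<Longrightarrow> x \<in> U"
proof -
  obtain f :: "'a \<Rightarrow> real" and d where d: "continuous_pseudometric G X d" and f0: "f \<one> = 0"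
    and f: "\<And>x. x \<in> carrier G \<Longrightarrow> 0 \<le> f x \<and> f x \<le> 1" "\<And>x y. \<lbrakk>x \<in> carrier G; y \<in> carrier G\<rbrakk> \<Longrightarrow> \<bar>f x - f y\<bar> \<le> d x y"
    and fU: "\<And>x. \<lbrakk>x \<in> carrier G; x \<notin> U\<rbrakk> \<Longrightarrow> 1 / 2 \<le> f x"
    using that by (rule exists_continuous_pseudometric[OF U])
  have f': "\<forall>x\<in>carrier G. 0 \<le> f x \<and> f x \<le> 1" "\<forall>x\<in>carrier G. \<forall>y\<in>carrier G. \<bar>f x - f y\<bar> \<le> d x y"
    using f by auto
  obtain c :: "nat \<Rightarrow> 'a \<Rightarrow> complex" where c: "\<And>n. c n \<in> characters G X"
    "\<And>x. \<lbrakk>x \<in> carrier G; f x \<noteq> f \<one>\<rbrakk> \<Longrightarrow> \<exists>n. c n x \<noteq> 1"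
    using that by (rule countable_separating_characters[OF X d f'])
  have cf: "continuous_map X euclidean (\<lambda>x. complex_of_real (f x))"
    by (rule continuous_pseudometric.continuous_map_Lipschitz[OF d, of _ 1])
       (use f(2) in \<open>simp add: dist_norm flip: of_real_diff\<close>)
  \<comment> \<open>\<open>f\<close> gets a coordinate of its own, since it is not yet known to be a
    continuous function of the characters.\<close>
  define E where "E = (\<lambda>x n. case n of 0 \<Rightarrow> complex_of_real (f x) | Suc m \<Rightarrow> c m x)"
  have "compact (E ` topspace X)"
  proof (rule pseudocompact_image_compact[OF X])
    show "continuous_map X euclidean E"
    proof (rule continuous_map_into_fun)
      show "continuous_map X euclidean (\<lambda>x. E x n)" for n
        using cf char(4)[OF c(1)] by (cases n) (simp_all add: E_def)
    qed
    show "compact (PiE UNIV (\<lambda>n::nat. cball 0 1 :: complex set))" by (rule compact_PiE_UNIV) simp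
    show "E ` topspace X \<subseteq> PiE UNIV (\<lambda>n. cball 0 1)"
      using char(1)[OF c(1)] f(1) topspace_eq by (auto simp: E_def split: nat.split)
  qed
  moreover have "closed {s :: nat \<Rightarrow> complex. 1/2 \<le> Re (s 0)}"
    by (intro closed_Collect_le continuous_intros continuous_on_product_coordinates)
  ultimately have K: "compact (E ` carrier G \<inter> {s. 1/2 \<le> Re (s 0)})"
    unfolding topspace_eq by (rule compact_Int_closed)
  define V where "V = (\<lambda>(n, m). {s :: nat \<Rightarrow> complex. 1 / real (Suc m) < norm (s (Suc n) - 1)})"
  have V_open: "open (V i)" for i
    unfolding V_def split_beta by (intro open_Collect_less continuous_intros continuous_on_product_coordinates)
  have cover: "E ` carrier G \<inter> {s. 1/2 \<le> Re (s 0)} \<subseteq> (\<Union>i\<in>UNIV. V i)"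
  proof
    fix s assume "s \<in> E ` carrier G \<inter> {s. 1/2 \<le> Re (s 0)}"
    then obtain x where x: "x \<in> carrier G" "s = E x" "1/2 \<le> f x" by (auto simp: E_def)
    then obtain n where n: "c n x \<noteq> 1" using c(2)[OF x(1)] f0 by auto
    then have "norm (c n x - 1) > 0" by simp
    then obtain m where "1 / real (Suc m) < norm (c n x - 1)" by (rule nat_approx_posE)
    then have "s \<in> V (n, m)" by (simp add: V_def x E_def)
    then show "s \<in> (\<Union>i\<in>UNIV. V i)" by blast
  qed
  obtain I where I: "finite I" "E ` carrier G \<inter> {s. 1/2 \<le> Re (s 0)} \<subseteq> (\<Union>i\<in>I. V i)"
    using compactE_image[OF K V_open cover] by metis
  obtain m where m: "\<And>i. i \<in> I \<Longrightarrow> snd i \<le> m"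
    using finite_imageI[OF I(1), of snd] by (meson Max_ge imageI)
  show ?thesis
  proof
    show "finite ((\<lambda>i. c (fst i)) ` I)" using I by simp
    show "(\<lambda>i. c (fst i)) ` I \<subseteq> characters G X" using c(1) by auto
    show "1 / real (Suc m) > 0" by simp
    fix x assume x: "x \<in> carrier G" and small: "\<forall>ch\<in>(\<lambda>i. c (fst i)) ` I. norm (ch x - 1) < 1 / real (Suc m)"
    show "x \<in> U"
    proof (rule ccontr)
      assume "x \<notin> U"
      then have "E x \<in> E ` carrier G \<inter> {s. 1/2 \<le> Re (s 0)}" using fU[OF x] x by (simp add: E_def)
      then obtain n k where i: "(n, k) \<in> I" "E x \<in> V (n, k)" using I(2) by auto
      have "1 / real (Suc m) \<le> 1 / real (Suc k)" using m[OF i(1)] by (intro divide_left_mono) auto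
      moreover have "1 / real (Suc k) < norm (c n x - 1)" using i(2) by (simp add: V_def E_def)
      moreover have "norm (c n x - 1) < 1 / real (Suc m)" using bspec[OF small imageI[OF i(1)]] by simp
      ultimately show False by linarith
    qed
  qed
qed

end

section \<open>Compact sets of characters\<close>

text \<open>In \<open>w\<^sup>2 - 1 = (w + 1) * (w - 1)\<close> the first factor has norm at least
  3/2 while \<open>w\<close> is within 1/2 of 1, so repeated squaring drives \<open>z\<close> away
  from 1 geometrically.\<close>

lemma circle_no_small_subgroups:
  fixes z :: complex
  assumes z: "norm z = 1" and small: "\<And>n::nat. norm (z ^ n - 1) \<le> 1/2"
  shows "z = 1"
proof (rule ccontr)
  assume "z \<noteq> 1"
  have step: "(3/2) ^ n * norm (z - 1) \<le> norm (z ^ (2 ^ n) - 1)" for n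
  proof (induction n)
    case (Suc n)
    define w where "w = z ^ (2 ^ n)"
    have "3/2 \<le> norm (w + 1)"
    proof -
      have "norm (2::complex) \<le> norm (w + 1) + norm (w - 1)"
        using norm_triangle_ineq4[of "w + 1" "w - 1"] by simp
      then show ?thesis using small[of "2 ^ n"] by (simp add: w_def)
    qed
    then have "(3/2) * norm (w - 1) \<le> norm (w + 1) * norm (w - 1)" by (rule mult_right_mono) simp
    also have "\<dots> = norm (w ^ 2 - 1)" unfolding norm_mult[symmetric] by (simp add: algebra_simps power2_eq_square)
    also have "w ^ 2 = z ^ (2 ^ Suc n)" by (simp add: w_def power_mult[symmetric] mult.commute)
    finally show ?case using Suc by (simp add: w_def)
  qed simp
  obtain n where n: "1 / norm (z - 1) < (3/2) ^ n" using real_arch_pow[of "3/2"] by auto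
  have "1 < (3/2) ^ n * norm (z - 1)" using n \<open>z \<noteq> 1\<close> by (simp add: field_simps)
  then show False using step[of n] small[of "2 ^ n"] by linarith
qed

text \<open>Filters stand in for sequences: a compact set of functions on an arbitrary group need
  not be sequentially compact in general.\<close>

lemma compact_cluster_point:
  assumes "compact C" "F \<noteq> bot" "eventually (\<lambda>x. x \<in> C) F"
  obtains x F' where "x \<in> C" "F' \<noteq> bot" "F' \<le> F" "F' \<le> nhds x"
  using assms unfolding compact_filter by (metis inf_le1 inf_le2)

context topological_comm_group
begin

lemma char_one: "ch \<in> characters G X \<Longrightarrow> ch \<one> = 1"
  using char(2)[of ch \<one> \<one>] char(1)[of ch \<one>] by (metis mult_cancel_right1 norm_zero one_closed r_one zero_neq_one)

lemma char_inv: "\<lbrakk>ch \<in> characters G X; x \<in> carrier G\<rbrakk> \<Longrightarrow> ch (inv x) * ch x = 1"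
  by (metis char(2) char_one inv_closed l_inv)

text \<open>The quotient of the two values at \<open>x\<close> has all its powers within 1/2 of 1,
  as these are the quotients at the powers of \<open>x\<close>.\<close>

lemma characters_close_eq:
  assumes a: "a \<in> characters G X" and b: "b \<in> characters G X"
    and close: "\<And>x. x \<in> carrier G \<Longrightarrow> norm (a x - b x) \<le> 1/2"
  shows "a = b"
proof (rule extensionalityI[OF char(3)[OF a] char(3)[OF b]])
  fix x assume x: "x \<in> carrier G"
  have ab: "norm (a x) = 1" "norm (b x) = 1" using char(1) a b x by auto
  have pow: "ch (x [^] n) = ch x ^ n" if "ch \<in> characters G X" for ch and n :: nat
    using char_one[OF that] char(2)[OF that] x by (induction n) auto
  have "a x / b x = 1"
  proof (rule circle_no_small_subgroups)
    show "norm (a x / b x) = 1" using ab by (simp add: norm_divide)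
    show "norm ((a x / b x) ^ n - 1) \<le> 1/2" for n
    proof -
      have "(a x / b x) ^ n - 1 = (a (x [^] n) - b (x [^] n)) / b (x [^] n)"
        using ab by (auto simp: pow a b power_divide diff_divide_distrib)
      then show ?thesis using close[of "x [^] n"] char(1)[OF b, of "x [^] n"] x by (simp add: norm_divide)
    qed
  qed
  then show "a x = b x" using ab by (metis divide_eq_1_iff)
qed

text \<open>A countable base of the target makes up for the missing separability of the group: one
  point is picked for each basic set that the image meets.\<close>

lemma sequentially_dense_points:
  fixes E :: "'a \<Rightarrow> 'c::{metric_space,second_countable_topology}"
  obtains q :: "nat \<Rightarrow> 'a" where "\<And>k. q k \<in> carrier G" "\<And>x. x \<in> carrier G \<Longrightarrow> E x \<in> closure (range (\<lambda>k. E (q k)))"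
proof -
  obtain B :: "'c set set" where B: "countable B" "topological_basis B" using ex_countable_basis by blast
  define p where "p = (\<lambda>b. if \<exists>x\<in>carrier G. E x \<in> b then SOME x. x \<in> carrier G \<and> E x \<in> b else \<one>)"
  have p: "p b \<in> carrier G \<and> E (p b) \<in> b" if "\<exists>x\<in>carrier G. E x \<in> b" for b
    using someI_ex[of "\<lambda>x. x \<in> carrier G \<and> E x \<in> b"] that by (auto simp: p_def)
  have pc: "p b \<in> carrier G" for b using p[of b] by (cases "\<exists>x\<in>carrier G. E x \<in> b") (auto simp: p_def)
  have ne: "B \<noteq> {}" using topological_basisE[OF B(2) open_UNIV UNIV_I] by blast
  show ?thesis
  proof
    show "p (from_nat_into B k) \<in> carrier G" for k by (rule pc)
    fix x assume x: "x \<in> carrier G"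
    show "E x \<in> closure (range (\<lambda>k. E (p (from_nat_into B k))))"
      unfolding closure_iff_nhds_not_empty
    proof (intro allI impI)
      fix A U assume U: "U \<subseteq> A" "E x \<in> U" "open U"
      obtain b where b: "b \<in> B" "E x \<in> b" "b \<subseteq> U" using topological_basisE[OF B(2) U(3,2)] by blast
      obtain k where k: "b = from_nat_into B k" using from_nat_into_surj[OF B(1) b(1)] by blast
      have "E (p b) \<in> b" using p x b by blast
      then have "E (p (from_nat_into B k)) \<in> A" using b U k by auto
      then show "range (\<lambda>k. E (p (from_nat_into B k))) \<inter> A \<noteq> {}" by blast
    qed
  qed
qed

text \<open>Two characters that factor through the map given by the countable family \<open>c\<close> are determined
  by their values on a set with dense image: by compactness the image carries the quotient topology,
  even after adding the two characters to the family.\<close>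

lemma characters_eq_of_dense:
  assumes X: "pseudocompact X" and c: "\<And>n::nat. c n \<in> characters G X"
    and q: "\<And>k::nat. q k \<in> carrier G" "\<And>x. x \<in> carrier G \<Longrightarrow> (\<lambda>n. c n x) \<in> closure (range (\<lambda>k n. c n (q k)))"
    and a: "a \<in> characters G X" and b: "b \<in> characters G X"
    and fa: "\<And>x y. \<lbrakk>x \<in> carrier G; y \<in> carrier G; \<And>n. c n x = c n y\<rbrakk> \<Longrightarrow> a x = a y"
    and fb: "\<And>x y. \<lbrakk>x \<in> carrier G; y \<in> carrier G; \<And>n. c n x = c n y\<rbrakk> \<Longrightarrow> b x = b y"
    and eq: "\<And>k. a (q k) = b (q k)" and x: "x \<in> carrier G"
  shows "a x = b x"
proof -
  define c' where "c' = (\<lambda>n. case n of 0 \<Rightarrow> a | Suc m \<Rightarrow> (case m of 0 \<Rightarrow> b | Suc k \<Rightarrow> c k))"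
  have "c' n \<in> characters G X" for n using a b c by (auto simp: c'_def split: nat.split)
  then have K: "compact ((\<lambda>x n. c' n x) ` carrier G)" by (rule compact_char_image[OF X])
  obtain s where s: "\<And>j. s j \<in> range (\<lambda>k n. c n (q k))" "s \<longlonglongrightarrow> (\<lambda>n. c n x)"
    using q(2)[OF x] unfolding closure_sequential by blast
  then have "\<forall>j. \<exists>k. s j = (\<lambda>n. c n (q k))" by blast
  then obtain \<kappa> where \<kappa>: "\<And>j. s j = (\<lambda>n. c n (q (\<kappa> j)))" by metis
  have "\<forall>j. (\<lambda>n. c' n (q (\<kappa> j))) \<in> (\<lambda>x n. c' n x) ` carrier G" using q(1) by blast
  then obtain l r where l: "l \<in> (\<lambda>x n. c' n x) ` carrier G" and r: "strict_mono r"
    and lim: "((\<lambda>j n. c' n (q (\<kappa> j))) \<circ> r) \<longlonglongrightarrow> l"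
    using K unfolding compact_eq_seq_compact_metric seq_compact_def by metis
  obtain y where y: "y \<in> carrier G" "l = (\<lambda>n. c' n y)" using l by blast
  have lim': "(\<lambda>j. c' n (q (\<kappa> (r j)))) \<longlonglongrightarrow> c' n y" for n
    using tendsto_coordinate[OF lim, of n] y by (simp add: o_def)
  \<comment> \<open>The limit point \<open>y\<close> has the same coordinates \<open>c n\<close> as
    \<open>x\<close>, so the factorisation hypotheses move both characters from \<open>x\<close> to
    \<open>y\<close>, where they agree as limits along the dense points.\<close>
  have "c n x = c n y" for n
  proof (rule LIMSEQ_unique)
    show "(\<lambda>j. c n (q (\<kappa> (r j)))) \<longlonglongrightarrow> c n x"
      using LIMSEQ_subseq_LIMSEQ[OF tendsto_coordinate[OF s(2), of n] r] by (simp add: \<kappa> o_def)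
    show "(\<lambda>j. c n (q (\<kappa> (r j)))) \<longlonglongrightarrow> c n y" using lim'[of "Suc (Suc n)"] by (simp add: c'_def)
  qed
  then have "a x = a y" "b x = b y" using fa fb x y by blast+
  moreover have "a y = b y"
  proof (rule LIMSEQ_unique)
    show "(\<lambda>j. a (q (\<kappa> (r j)))) \<longlonglongrightarrow> a y" using lim'[of 0] by (simp add: c'_def)
    show "(\<lambda>j. a (q (\<kappa> (r j)))) \<longlonglongrightarrow> b y" using lim'[of "Suc 0"] by (simp add: c'_def eq)
  qed
  ultimately show ?thesis by simp
qed

text \<open>A diagonal argument fixes the limits at the dense points. Every cluster point in
  \<open>C\<close> of the subsequence has these values and factors through the family
  \<open>c\<close>, which determines it everywhere; with all cluster points agreeing on the group,
  the subsequence converges.\<close>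

lemma exists_convergent_subsequence:
  assumes X: "pseudocompact X" and C: "compact C" "C \<subseteq> characters G X" and c: "range (c :: nat \<Rightarrow> _) \<subseteq> C"
  obtains r l where "strict_mono (r :: nat \<Rightarrow> nat)" "\<And>x. x \<in> carrier G \<Longrightarrow> (\<lambda>k. c (r k) x) \<longlonglongrightarrow> l x"
proof -
  have cX: "c n \<in> characters G X" for n using C c by blast
  obtain q :: "nat \<Rightarrow> 'a" where q: "\<And>k. q k \<in> carrier G"
    "\<And>x. x \<in> carrier G \<Longrightarrow> (\<lambda>n. c n x) \<in> closure (range (\<lambda>k n. c n (q k)))"
    using sequentially_dense_points[of "\<lambda>x n. c n x"] by metis
  have "compact (PiE UNIV (\<lambda>k::nat. sphere 0 1 :: complex set))" by (rule compact_PiE_UNIV) simp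
  moreover have "\<forall>n. (\<lambda>k. c n (q k)) \<in> PiE UNIV (\<lambda>k. sphere 0 1)" using char(1)[OF cX q(1)] by auto
  ultimately obtain m r where r: "strict_mono r" and lim: "((\<lambda>n k. c n (q k)) \<circ> r) \<longlonglongrightarrow> m"
    unfolding compact_eq_seq_compact_metric seq_compact_def by metis
  have lim': "(\<lambda>n. c (r n) (q k)) \<longlonglongrightarrow> m k" for k
    using tendsto_coordinate[OF lim, of k] by (simp add: o_def)
  define W where "W = filtermap (\<lambda>n. c (r n)) sequentially"
  have W: "W \<noteq> bot" by (simp add: W_def filtermap_bot_iff)
  have evW: "eventually P W" if "\<And>n. P (c n)" for P unfolding W_def eventually_filtermap using that by simp
  have cluster: "\<exists>a F'. a \<in> C \<and> F' \<noteq> bot \<and> F' \<le> F \<and> F' \<le> nhds a \<and> (\<forall>k. a (q k) = m k) \<and>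
      (\<forall>x\<in>carrier G. \<forall>y\<in>carrier G. (\<forall>n. c n x = c n y) \<longrightarrow> a x = a y)"
    if F: "F \<noteq> bot" "F \<le> W" for F
  proof -
    have "eventually (\<lambda>x. x \<in> C) W" by (rule evW) (use c in blast)
    then have "eventually (\<lambda>x. x \<in> C) F" by (rule filter_leD[OF F(2)])
    then obtain a F' where a: "a \<in> C" "F' \<noteq> bot" "F' \<le> F" "F' \<le> nhds a" using compact_cluster_point[OF C(1) F(1)] by metis
    have lim_a: "((\<lambda>\<phi>. \<phi> x) \<longlongrightarrow> a x) F'" for x
      by (rule tendsto_coordinate) (use a(4) in \<open>simp add: filterlim_def filtermap_ident\<close>)
    have "a (q k) = m k" for k
    proof (rule tendsto_unique[OF a(2) lim_a])
      have "((\<lambda>\<phi>. \<phi> (q k)) \<longlongrightarrow> m k) W" using lim'[of k] by (simp add: W_def filterlim_filtermap)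
      then show "((\<lambda>\<phi>. \<phi> (q k)) \<longlongrightarrow> m k) F'" by (rule tendsto_mono[OF order_trans[OF a(3) F(2)]])
    qed
    \<comment> \<open>Along \<open>F'\<close> only members of the sequence matter, so identities
      valid for every \<open>c n\<close> hold in the limit.\<close>
    moreover have "a x = a y" if "\<forall>n. c n x = c n y" for x y
    proof (rule tendsto_unique[OF a(2) lim_a])
      have ev: "eventually (\<lambda>\<phi>. \<phi> y = \<phi> x) F'"
        by (rule filter_leD[OF order_trans[OF a(3) F(2)] evW]) (use that in simp)
      then show "((\<lambda>\<phi>. \<phi> x) \<longlongrightarrow> a y) F'" by (rule Lim_transform_eventually[OF lim_a])
    qed
    ultimately show ?thesis using a by blast
  qed
  from cluster[OF W order_refl] obtain a F0 where a: "a \<in> C" "F0 \<noteq> bot" "F0 \<le> W" "F0 \<le> nhds a" "\<forall>k. a (q k) = m k"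
    "\<forall>x\<in>carrier G. \<forall>y\<in>carrier G. (\<forall>n. c n x = c n y) \<longrightarrow> a x = a y"
    by (elim exE conjE)
  show ?thesis
  proof (rule that[OF r])
    fix x assume x: "x \<in> carrier G"
    show "(\<lambda>n. c (r n) x) \<longlonglongrightarrow> a x"
    proof (rule ccontr)
      assume "\<not> (\<lambda>n. c (r n) x) \<longlonglongrightarrow> a x"
      then obtain e where e: "e > 0" "\<exists>\<^sub>F n in sequentially. \<not> dist (c (r n) x) (a x) < e"
        unfolding tendsto_iff frequently_def by auto
      \<comment> \<open>If convergence fails at \<open>x\<close>, the subsequence frequently stays
        at least \<open>e\<close> away from \<open>a x\<close>. A cluster point of that part agrees
        with \<open>a\<close> at the dense points, hence at \<open>x\<close>, a
        contradiction.\<close>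
      define F where "F = inf W (principal {\<phi>. \<not> dist (\<phi> x) (a x) < e})"
      have "F \<noteq> bot" "F \<le> W" using e(2) unfolding F_def W_def trivial_limit_def eventually_inf_principal eventually_filtermap frequently_def
        by simp_all
      from cluster[OF this] obtain b F' where b: "b \<in> C" "F' \<noteq> bot" "F' \<le> F" "F' \<le> nhds b" "\<forall>k. b (q k) = m k"
        "\<forall>x\<in>carrier G. \<forall>y\<in>carrier G. (\<forall>n. c n x = c n y) \<longrightarrow> b x = b y"
        by (elim exE conjE)
      have "b x = a x"
      proof (rule characters_eq_of_dense[OF X cX q _ _ _ _ _ x])
        show "b \<in> characters G X" "a \<in> characters G X" using a(1) b(1) C(2) by blast+
        show "b y = b z" if "y \<in> carrier G" "z \<in> carrier G" "\<And>n. c n y = c n z" for y z using b(6) that by blast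
        show "a y = a z" if "y \<in> carrier G" "z \<in> carrier G" "\<And>n. c n y = c n z" for y z using a(6) that by blast
        show "b (q k) = a (q k)" for k using a(5) b(5) by simp
      qed
      have "((\<lambda>\<phi>. \<phi> x) \<longlongrightarrow> b x) F'"
        by (rule tendsto_coordinate) (use b(4) in \<open>simp add: filterlim_def filtermap_ident\<close>)
      then have "eventually (\<lambda>\<phi>. dist (\<phi> x) (a x) < e) F'" using e(1) \<open>b x = a x\<close> by (simp add: tendsto_iff)
      moreover have "eventually (\<lambda>\<phi>. \<not> dist (\<phi> x) (a x) < e) F'"
        by (rule filter_leD[OF b(3)]) (simp add: F_def eventually_inf_principal)
      ultimately have "eventually (\<lambda>\<phi>. False) F'" by eventually_elim simp
      then show False using b(2) by (simp add: trivial_limit_def)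
    qed
  qed
qed

text \<open>In the compact image of the group, one of the closed sets of sequences oscillating by at
  most 1/4 from \<open>N\<close> on has interior. Finitely many translates of this interior cover
  the image, and each translation costs only the oscillation at one fixed point.\<close>

lemma pointwise_convergent_characters_uniformly_close:
  assumes X: "pseudocompact X" and c: "\<And>n::nat. c n \<in> characters G X"
    and lim: "\<And>x. x \<in> carrier G \<Longrightarrow> (\<lambda>n. c n x) \<longlonglongrightarrow> l x"
  obtains N where "\<And>k m x. \<lbrakk>k \<ge> N; m \<ge> N; x \<in> carrier G\<rbrakk> \<Longrightarrow> norm (c k x - c m x) \<le> 1/2"
proof -
  define E where "E = (\<lambda>x n. c n x)"
  define H where "H = E ` carrier G"
  have H: "compact H" unfolding H_def E_def by (rule compact_char_image[OF X c])
  have cauchy: "\<exists>N. \<forall>k\<ge>N. \<forall>m\<ge>N. dist (c k x) (c m x) \<le> 1/4" if "x \<in> carrier G" for x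
  proof -
    have "Cauchy (\<lambda>n. c n x)" using lim[OF that] by (rule LIMSEQ_imp_Cauchy)
    then show ?thesis unfolding Cauchy_def by (metis less_imp_le zero_less_divide_1_iff zero_less_numeral)
  qed
  define A where "A = (\<lambda>N. {h \<in> H. \<forall>k\<ge>N. \<forall>m\<ge>N. dist (h k) (h m) \<le> 1/4})"
  have HA: "H = (\<Union>N. A N)" using cauchy by (auto simp: A_def H_def E_def)
  have "\<exists>N. top_of_set H interior_of A N \<noteq> {}"
  proof (rule ccontr)
    assume "\<not> ?thesis"
    then have e: "top_of_set H interior_of A N = {}" for N by blast
    have "top_of_set H interior_of (\<Union>(range A)) = {}"
    proof (rule Baire_category_alt)
      have "completely_metrizable_space (top_of_set H)"
        using completely_metrizable_space_closedin[OF completely_metrizable_space_euclidean, of H] H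
        by (simp add: compact_imp_closed)
      then show "completely_metrizable_space (top_of_set H) \<or> locally_compact_space (top_of_set H) \<and> regular_space (top_of_set H)" ..
      show "countable (range A)" by simp
      fix T assume "T \<in> range A"
      then obtain N where N: "T = A N" by blast
      have "A N = H \<inter> {h. \<forall>k m. k \<ge> N \<longrightarrow> m \<ge> N \<longrightarrow> dist (h k) (h m) \<le> 1/4}" by (auto simp: A_def)
      moreover have "closed {h :: nat \<Rightarrow> complex. \<forall>k m. k \<ge> N \<longrightarrow> m \<ge> N \<longrightarrow> dist (h k) (h m) \<le> 1/4}"
        by (intro closed_Collect_all closed_Collect_imp closed_Collect_le open_Collect_const continuous_intros
            continuous_on_product_coordinates)
      ultimately show "closedin (top_of_set H) T \<and> top_of_set H interior_of T = {}"
        using e[of N] N by (auto simp: closedin_closed)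
    qed
    moreover have "top_of_set H interior_of H = H" using interior_of_topspace[of "top_of_set H"] by simp
    ultimately have "H = {}" using HA by simp
    then show False by (auto simp: H_def)
  qed
  then obtain N where N: "top_of_set H interior_of A N \<noteq> {}" by blast
  obtain O' where O': "open O'" "top_of_set H interior_of A N = H \<inter> O'"
    using openin_interior_of[of "top_of_set H" "A N"] unfolding openin_open by blast
  have OA: "H \<inter> O' \<subseteq> A N" using O'(2) interior_of_subset by metis
  obtain x0 where x0: "x0 \<in> carrier G" "E x0 \<in> O'" using N O'(2) by (auto simp: H_def)
  \<comment> \<open>Multiplying by the values of the characters at \<open>inv a\<close> realises
    translation in the image, so there \<open>V a\<close> is the translate by \<open>a\<close> of
    the open set.\<close>
  define V where "V = (\<lambda>a. {h. (\<lambda>n. c n (inv a) * h n) \<in> O'})"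
  have V_open: "open (V a)" for a
  proof -
    have "continuous_on UNIV (\<lambda>h n. c n (inv a) * h n)"
      by (intro continuous_on_coordinatewise_then_product continuous_intros continuous_on_product_coordinates)
    from open_vimage[OF O'(1) this] show ?thesis by (simp add: V_def vimage_def)
  qed
  have V: "E x \<in> V a \<longleftrightarrow> E (inv a \<otimes> x) \<in> O'" if "x \<in> carrier G" "a \<in> carrier G" for x a
    using that char(2)[OF c] by (simp add: V_def E_def)
  have cover: "H \<subseteq> (\<Union>a\<in>carrier G. V a)"
  proof
    fix h assume "h \<in> H"
    then obtain x where x: "x \<in> carrier G" "h = E x" by (auto simp: H_def)
    have "inv (x \<otimes> inv x0) \<otimes> x = x0" using x x0 by (simp add: inv_mult m_ac l_inv r_inv)
    then have "h \<in> V (x \<otimes> inv x0)" using V[of x "x \<otimes> inv x0"] x x0 by simp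
    then show "h \<in> (\<Union>a\<in>carrier G. V a)" using x x0 by (intro UN_I[of "x \<otimes> inv x0"]) auto
  qed
  obtain D where D: "D \<subseteq> carrier G" "finite D" "H \<subseteq> (\<Union>a\<in>D. V a)"
    using that by (rule compactE_image[OF H V_open cover])
  obtain n where n: "\<And>x. x \<in> carrier G \<Longrightarrow> \<forall>k\<ge>n x. \<forall>m\<ge>n x. dist (c k x) (c m x) \<le> 1/4" using cauchy by metis
  obtain N' where N': "\<And>a. a \<in> D \<Longrightarrow> n a \<le> N'"
    using finite_imageI[OF D(2), of n] by (meson Max_ge imageI)
  show ?thesis
  proof
    fix k m x assume k: "k \<ge> max N N'" and m: "m \<ge> max N N'" and x: "x \<in> carrier G"
    obtain a where a: "a \<in> D" "E x \<in> V a" using D(3) x by (auto simp: H_def)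
    have ac: "a \<in> carrier G" using a D by blast
    define y where "y = inv a \<otimes> x"
    have y: "y \<in> carrier G" "x = a \<otimes> y" using x ac by (auto simp: y_def m_assoc[symmetric])
    have "E y \<in> O'" using V[OF x ac] a by (simp add: y_def)
    then have "E y \<in> A N" using OA y by (auto simp: H_def)
    then have 1: "dist (c k y) (c m y) \<le> 1/4" using k m by (simp add: A_def E_def)
    have 2: "dist (c k a) (c m a) \<le> 1/4" using n[OF ac] N'[OF a(1)] k m by auto
    \<comment> \<open>Oscillation 1/4 at \<open>y\<close> and 1/4 at the translating point
      \<open>a\<close> add up to the bound 1/2 required by
      \<open>characters_close_eq\<close>.\<close>
    have "c k x - c m x = c k a * (c k y - c m y) + (c k a - c m a) * c m y"
      unfolding y(2) using char(2)[OF c ac y(1)] by (simp add: algebra_simps)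
    also have "norm \<dots> \<le> norm (c k a) * norm (c k y - c m y) + norm (c k a - c m a) * norm (c m y)"
      by (rule order_trans[OF norm_triangle_ineq]) (simp add: norm_mult)
    also have "\<dots> \<le> 1/2" using 1 2 char(1)[OF c ac] char(1)[OF c y(1)] by (simp add: dist_norm)
    finally show "norm (c k x - c m x) \<le> 1/2" .
  qed
qed

theorem compact_set_of_characters_finite:
  assumes X: "pseudocompact X" and C: "compact C" "C \<subseteq> characters G X"
  shows "finite C"
proof (rule ccontr)
  assume "infinite C"
  then obtain c :: "nat \<Rightarrow> 'a \<Rightarrow> complex" where c: "inj c" "range c \<subseteq> C"
    using infinite_countable_subset by blast
  obtain r l where r: "strict_mono (r :: nat \<Rightarrow> nat)" and lim: "\<And>x. x \<in> carrier G \<Longrightarrow> (\<lambda>k. c (r k) x) \<longlonglongrightarrow> l x"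
    using exists_convergent_subsequence[OF X C c(2)] by metis
  have cr: "c (r n) \<in> characters G X" for n using C c by blast
  obtain N where "\<And>k m x. \<lbrakk>k \<ge> N; m \<ge> N; x \<in> carrier G\<rbrakk> \<Longrightarrow> norm (c (r k) x - c (r m) x) \<le> 1/2"
    using pointwise_convergent_characters_uniformly_close[OF X cr lim] by metis
  then have "c (r N) = c (r (Suc N))" by (intro characters_close_eq cr) auto
  then have "r N = r (Suc N)" using c(1) by (simp add: inj_eq)
  then show False using r by (metis n_not_Suc_n strict_mono_eq)
qed

end

section \<open>The dual group and its characters\<close>

lemma open_fun_contains_finite_box:
  fixes O' :: "('i \<Rightarrow> 'b::metric_space) set"
  assumes "open O'" "e \<in> O'"
  obtains S \<delta> where "finite S" "\<delta> > 0" "\<And>f. (\<And>i. i \<in> S \<Longrightarrow> dist (f i) (e i) < \<delta>) \<Longrightarrow> f \<in> O'"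
proof -
  have "openin (product_topology (\<lambda>i. euclidean) UNIV) O'" using assms(1) by (simp add: open_fun_def)
  from product_topology_open_contains_basis[OF this assms(2)]
  obtain V where V: "e \<in> (\<Pi>\<^sub>E i\<in>UNIV. V i)" "\<And>i. openin euclidean (V i)" "finite {i. V i \<noteq> topspace euclidean}"
    "(\<Pi>\<^sub>E i\<in>UNIV. V i) \<subseteq> O'" by blast
  define S where "S = {i. V i \<noteq> UNIV}"
  have "\<exists>d>0. \<forall>y. dist y (e i) < d \<longrightarrow> y \<in> V i" for i
    using V(1) V(2)[of i] by (simp add: open_dist PiE_iff)
  then obtain d where d: "\<And>i. d i > 0" "\<And>i y. dist y (e i) < d i \<Longrightarrow> y \<in> V i" by metis
  have S: "finite S" using V(3) by (simp add: S_def)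
  define \<delta> where "\<delta> = Min (insert 1 (d ` S))"
  show ?thesis
  proof
    show "finite S" by fact
    show "\<delta> > 0" using S d(1) by (simp add: \<delta>_def)
    fix f assume f: "\<And>i. i \<in> S \<Longrightarrow> dist (f i) (e i) < \<delta>"
    have "f i \<in> V i" for i
    proof (cases "i \<in> S")
      case True
      then have "\<delta> \<le> d i" using S by (simp add: \<delta>_def)
      then show ?thesis using f[OF True] d(2) by simp
    qed (simp add: S_def)
    then show "f \<in> O'" using V(4) by auto
  qed
qed

text \<open>Each function is rounded on \<open>S\<close> to a finite net of the unit disc; finitely
  many roundings occur, and \<open>T\<close> takes one member of \<open>\<Gamma>\<close> for
  each.\<close>

lemma finite_pointwise_net:
  fixes \<Gamma> :: "('a \<Rightarrow> complex) set"
  assumes S: "finite S" and \<Gamma>: "\<forall>f\<in>\<Gamma>. \<forall>y\<in>S. norm (f y) \<le> 1" and \<delta>: "\<delta> > 0"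
  obtains T where "finite T" "T \<subseteq> \<Gamma>" "\<And>f. f \<in> \<Gamma> \<Longrightarrow> \<exists>t\<in>T. \<forall>y\<in>S. dist (f y) (t y) < \<delta>"
proof -
  have "compact (cball 0 1 :: complex set)" by simp
  moreover have "cball 0 1 \<subseteq> (\<Union>z\<in>UNIV. ball z (\<delta> / 2) :: complex set)"
  proof
    fix z :: complex
    have "z \<in> ball z (\<delta> / 2)" using \<delta> by simp
    then show "z \<in> (\<Union>z\<in>UNIV. ball z (\<delta> / 2))" by blast
  qed
  ultimately obtain K where K: "finite K" "cball 0 1 \<subseteq> (\<Union>z\<in>K. ball z (\<delta> / 2) :: complex set)"
    using compactE_image[of "cball 0 1" UNIV "\<lambda>z. ball z (\<delta> / 2)"] by (metis open_ball)
  define \<rho> where "\<rho> = (\<lambda>f. \<lambda>y\<in>S. SOME z. z \<in> K \<and> dist z (f y) < \<delta> / 2)"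
  have \<rho>: "\<rho> f y \<in> K \<and> dist (\<rho> f y) (f y) < \<delta> / 2" if "f \<in> \<Gamma>" "y \<in> S" for f y
  proof -
    have "f y \<in> cball 0 1" using \<Gamma> that by simp
    then have "f y \<in> (\<Union>z\<in>K. ball z (\<delta> / 2))" using K(2) by blast
    then have "\<exists>z. z \<in> K \<and> dist z (f y) < \<delta> / 2" unfolding UN_iff mem_ball by blast
    from someI_ex[OF this] show ?thesis using that(2) by (simp add: \<rho>_def)
  qed
  have "\<rho> ` \<Gamma> \<subseteq> PiE S (\<lambda>_. K)"
  proof
    fix g assume "g \<in> \<rho> ` \<Gamma>"
    then obtain f where f: "f \<in> \<Gamma>" "g = \<rho> f" by blast
    have "g \<in> extensional S" unfolding f(2) \<rho>_def by simp
    then show "g \<in> PiE S (\<lambda>_. K)" using \<rho>[OF f(1)] f(2) by (simp add: PiE_iff)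
  qed
  then have "finite (\<rho> ` \<Gamma>)" using finite_PiE[OF S, of "\<lambda>_. K"] K(1) finite_subset by blast
  then obtain T where T: "T \<subseteq> \<Gamma>" "finite T" "\<rho> ` \<Gamma> = \<rho> ` T" using finite_subset_image[of "\<rho> ` \<Gamma>" \<rho> \<Gamma>] by blast
  show ?thesis
  proof
    fix f assume f: "f \<in> \<Gamma>"
    then obtain t where t: "t \<in> T" "\<rho> f = \<rho> t" using T(3) by blast
    have "dist (f y) (t y) < \<delta>" if "y \<in> S" for y
      using \<rho>[OF f that] \<rho>[of t y] t T(1) that dist_triangle3[of "f y" "t y" "\<rho> f y"] by auto
    then show "\<exists>t\<in>T. \<forall>y\<in>S. dist (f y) (t y) < \<delta>" using t(1) by blast
  qed (use T in auto)
qed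

text \<open>\<open>topology_generated_by\<close> has the union of its subbasis as its space; the
  empty compact set contributes all functions to it.\<close>

lemma compact_open_subbasis_UNIV: "UNIV \<in> {{f. f ` K \<subseteq> U} | K U. compactin X K \<and> openin Y U}"
  by (rule CollectI, rule exI[of _ "{}"], rule exI[of _ "{}"]) auto

lemma topspace_dual_topology:
  "topspace X = carrier G \<Longrightarrow> topspace (dual_topology G X) = characters G X"
proof -
  assume X: "topspace X = carrier G"
  have "ch \<in> \<Union>{{f. f ` K \<subseteq> U} | K U. compactin X K \<and> openin circle_top U}" for ch :: "'a \<Rightarrow> complex"
    using compact_open_subbasis_UNIV[of X circle_top] by blast
  then show ?thesis unfolding dual_topology_def compact_open_topology_def by auto
qed

text \<open>For finite \<open>K\<close> a subbasic set is a finite intersection of evaluation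
  conditions; conversely singletons are compact, so evaluations are continuous. The statement
  applies to the group and to its dual alike.\<close>

lemma dual_topology_eq_pointwise:
  assumes X: "topspace X = carrier G" and fin: "\<And>K. compactin X K \<Longrightarrow> finite K"
  shows "dual_topology G X = top_of_set (characters G X)"
proof -
  let ?C = "characters G X"
  let ?B = "{{f. f ` K \<subseteq> U} | K U. compactin X K \<and> openin circle_top U}"
  have val: "ch x \<in> sphere 0 1" if "ch \<in> ?C" "x \<in> carrier G" for ch x
    using character_facts(1)[OF that(1) X that(2)] by simp
  have 1: "continuous_map (top_of_set ?C) (topology_generated_by ?B) (\<lambda>f. f)"
  proof (rule continuous_on_generated_topo)
    fix W assume "W \<in> ?B"
    then obtain K U where W: "W = {f. f ` K \<subseteq> U}" and K: "compactin X K" and U: "openin circle_top U" by blast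
    obtain O' where O': "open O'" "U = sphere 0 1 \<inter> O'" using U by (auto simp: circle_top_def openin_open)
    have Kc: "K \<subseteq> carrier G" using compactin_subset_topspace[OF K] X by simp
    have "(\<lambda>f. f) -` W \<inter> topspace (top_of_set ?C) = ?C \<inter> (\<Inter>x\<in>K. {f. f x \<in> O'})"
      using val Kc by (auto simp: W O'(2) image_subset_iff subset_eq)
    moreover have "open (\<Inter>x\<in>K. {f. f x \<in> O'})"
      using fin[OF K] open_vimage[OF O'(1) continuous_on_product_coordinates] by (intro open_INT) (auto simp: vimage_def)
    ultimately show "openin (top_of_set ?C) ((\<lambda>f. f) -` W \<inter> topspace (top_of_set ?C))" by auto
  next
    have "ch \<in> \<Union>?B" for ch :: "'a \<Rightarrow> complex"
      using compact_open_subbasis_UNIV[of X circle_top] by blast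
    then show "(\<lambda>f. f) ` topspace (top_of_set ?C) \<subseteq> \<Union>?B" by blast
  qed
  have 2: "continuous_map (dual_topology G X) euclidean (\<lambda>f. f)"
  proof (rule continuous_map_into_fun)
    fix x
    show "continuous_map (dual_topology G X) euclidean (\<lambda>f. f x)"
    proof (cases "x \<in> carrier G")
      case True
      show ?thesis
        unfolding continuous_map_def
      proof (intro conjI allI impI)
        fix U :: "complex set" assume "openin euclidean U"
        then have "openin circle_top (sphere 0 1 \<inter> U)" by (simp add: circle_top_def openin_open_Int)
        moreover have "compactin X {x}" using True X by simp
        ultimately have "openin (topology_generated_by ?B) {f. f ` {x} \<subseteq> sphere 0 1 \<inter> U}"
          by (intro topology_generated_by_Basis) blast
        then have "openin (dual_topology G X) ({f. f ` {x} \<subseteq> sphere 0 1 \<inter> U} \<inter> ?C)"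
          unfolding dual_topology_def compact_open_topology_def by (rule openin_subtopology_Int)
        also have "{f. f ` {x} \<subseteq> sphere 0 1 \<inter> U} \<inter> ?C = {f \<in> topspace (dual_topology G X). f x \<in> U}"
          using val[OF _ True] by (auto simp: topspace_dual_topology[OF X])
        finally show "openin (dual_topology G X) {f \<in> topspace (dual_topology G X). f x \<in> U}" .
      qed simp
    next
      case False
      \<comment> \<open>Off the carrier every character has the value \<open>undefined\<close>, so
        this coordinate is constant.\<close>
      have "continuous_map (dual_topology G X) euclidean (\<lambda>f. undefined :: complex)" by simp
      then show ?thesis
        by (rule continuous_map_eq) (use False in \<open>auto simp: topspace_dual_topology[OF X] characters_def extensional_def\<close>)
    qed
  qed
  show ?thesis
    unfolding topology_eq
  proof (intro allI iffI)
    fix V assume "openin (dual_topology G X) V"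
    then obtain T where T: "openin (topology_generated_by ?B) T" "V = T \<inter> ?C"
      unfolding dual_topology_def compact_open_topology_def openin_subtopology by blast
    have "openin (top_of_set ?C) {f \<in> topspace (top_of_set ?C). f \<in> T}"
      by (rule openin_continuous_map_preimage[OF 1 T(1)])
    also have "{f \<in> topspace (top_of_set ?C). f \<in> T} = V" by (auto simp: T(2))
    finally show "openin (top_of_set ?C) V" .
  next
    fix V assume "openin (top_of_set ?C) V"
    then obtain T where T: "open T" "V = ?C \<inter> T" unfolding openin_open by blast
    have "openin (dual_topology G X) {f \<in> topspace (dual_topology G X). f \<in> T}"
      using openin_continuous_map_preimage[OF 2] T(1) by simp
    also have "{f \<in> topspace (dual_topology G X). f \<in> T} = V" by (auto simp: T(2) topspace_dual_topology[OF X])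
    finally show "openin (dual_topology G X) V" .
  qed
qed

section \<open>The dual as an Abelian group\<close>

context topological_comm_group
begin

lemma dual_simps:
  "carrier (dual_group G X) = characters G X"
  "mult (dual_group G X) a b = (\<lambda>x\<in>carrier G. a x * b x)"
  "one (dual_group G X) = (\<lambda>x\<in>carrier G. 1)"
  by (simp_all add: dual_group_def)

lemma char_mult:
  assumes a: "a \<in> characters G X" and b: "b \<in> characters G X"
  shows "(\<lambda>x\<in>carrier G. a x * b x) \<in> characters G X"
proof (rule charI)
  show "continuous_map X euclidean (\<lambda>x. a x * b x)"
    using continuous_map_compose[OF continuous_map_pairedI[OF char(4)[OF a] char(4)[OF b]], of euclidean "\<lambda>(u, v). u * v"]
    by (simp add: o_def split_beta continuous_intros)
  show "norm (a x * b x) = 1" if "x \<in> carrier G" for x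
    using char(1)[OF a that] char(1)[OF b that] by (simp add: norm_mult)
  show "a (x \<otimes> y) * b (x \<otimes> y) = a x * b x * (a y * b y)" if "x \<in> carrier G" "y \<in> carrier G" for x y
    using char(2)[OF a that] char(2)[OF b that] by simp
qed

lemma char_inverse:
  assumes a: "a \<in> characters G X"
  shows "(\<lambda>x\<in>carrier G. cnj (a x)) \<in> characters G X"
proof (rule charI)
  show "continuous_map X euclidean (\<lambda>x. cnj (a x))"
    using continuous_map_compose[OF char(4)[OF a], of euclidean cnj] by (simp add: o_def continuous_intros)
qed (use char(1,2)[OF a] in auto)

lemma char_cnj_mult: "\<lbrakk>a \<in> characters G X; x \<in> carrier G\<rbrakk> \<Longrightarrow> cnj (a x) * a x = 1"
  using char(1)[of a x] by (metis complex_norm_square mult.commute of_real_1 one_power2)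

lemma char_cnj: "\<lbrakk>a \<in> characters G X; x \<in> carrier G\<rbrakk> \<Longrightarrow> cnj (a x) = a (inv x)"
  using char_cnj_mult[of a x] char_inv[of a x] by (metis mult_cancel_right mult_zero_right zero_neq_one)

lemma comm_group_dual: "comm_group (dual_group G X)"
proof (rule comm_groupI)
  have triv: "(\<lambda>x\<in>carrier G. 1) \<in> characters G X" by (rule charI) auto
  then show "\<one>\<^bsub>dual_group G X\<^esub> \<in> carrier (dual_group G X)" by (simp add: dual_simps)
  fix a assume a: "a \<in> carrier (dual_group G X)"
  then have a': "a \<in> characters G X" by (simp add: dual_simps)
  show "\<one>\<^bsub>dual_group G X\<^esub> \<otimes>\<^bsub>dual_group G X\<^esub> a = a"
    by (rule extensionalityI[of _ "carrier G"]) (use char(3)[OF a'] in \<open>auto simp: dual_simps\<close>)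
  show "\<exists>b\<in>carrier (dual_group G X). b \<otimes>\<^bsub>dual_group G X\<^esub> a = \<one>\<^bsub>dual_group G X\<^esub>"
    by (rule bexI[of _ "\<lambda>x\<in>carrier G. cnj (a x)"])
       (use char_inverse[OF a'] char_cnj_mult[OF a'] in \<open>auto simp: dual_simps cong: restrict_cong\<close>)
  fix b assume "b \<in> carrier (dual_group G X)"
  then show "a \<otimes>\<^bsub>dual_group G X\<^esub> b \<in> carrier (dual_group G X)" using char_mult a' by (simp add: dual_simps)
  show "a \<otimes>\<^bsub>dual_group G X\<^esub> b = b \<otimes>\<^bsub>dual_group G X\<^esub> a" by (simp add: dual_simps mult.commute)
  fix c assume "c \<in> carrier (dual_group G X)"
  show "a \<otimes>\<^bsub>dual_group G X\<^esub> b \<otimes>\<^bsub>dual_group G X\<^esub> c = a \<otimes>\<^bsub>dual_group G X\<^esub> (b \<otimes>\<^bsub>dual_group G X\<^esub> c)"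
    by (auto simp: dual_simps mult.assoc restrict_def)
qed

end

section \<open>Orthogonality of a character of the dual to powers of a kernel\<close>

context topological_comm_group
begin

lemma dual_character_facts:
  assumes T: "dual_topology G X = top_of_set (characters G X)"
    and \<psi>: "\<psi> \<in> characters (dual_group G X) (dual_topology G X)"
  shows "a \<in> characters G X \<Longrightarrow> norm (\<psi> a) = 1"
    "\<lbrakk>a \<in> characters G X; b \<in> characters G X\<rbrakk> \<Longrightarrow> \<psi> (\<lambda>x\<in>carrier G. a x * b x) = \<psi> a * \<psi> b"
    "\<psi> \<in> extensional (characters G X)" "continuous_on (characters G X) \<psi>"
  using character_facts[OF \<psi>] T by (simp_all add: dual_simps)

lemma dual_character_near_one:
  assumes T: "dual_topology G X = top_of_set (characters G X)"
    and \<psi>: "\<psi> \<in> characters (dual_group G X) (dual_topology G X)"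
  obtains S \<delta> where "finite S" "S \<subseteq> carrier G" "S \<noteq> {}" "0 < \<delta>" "\<delta> \<le> 1"
    "\<And>a. \<lbrakk>a \<in> characters G X; \<forall>x\<in>S. norm (a x - 1) < \<delta>\<rbrakk> \<Longrightarrow> norm (\<psi> a - 1) < 1/2"
proof -
  note facts = dual_character_facts[OF T \<psi>]
  interpret D: comm_group "dual_group G X" by (rule comm_group_dual)
  let ?e = "\<lambda>x\<in>carrier G. 1 :: complex"
  have e: "?e \<in> characters G X" using D.one_closed by (simp add: dual_simps)
  have "\<psi> ?e = \<psi> ?e * \<psi> ?e" using facts(2)[OF e e] by (simp cong: restrict_cong)
  then have \<psi>e: "\<psi> ?e = 1" using facts(1)[OF e] by auto
  have "openin (top_of_set (characters G X)) (characters G X \<inter> \<psi> -` ball 1 (1/2))"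
    by (rule continuous_openin_preimage_gen[OF facts(4)]) simp
  then obtain O' where O': "open O'" "characters G X \<inter> \<psi> -` ball 1 (1/2) = characters G X \<inter> O'"
    unfolding openin_open by blast
  have "?e \<in> O'" using O'(2) e \<psi>e by auto
  then obtain S \<delta> where S: "finite S" "\<delta> > 0" "\<And>f. (\<And>i. i \<in> S \<Longrightarrow> dist (f i) (?e i) < \<delta>) \<Longrightarrow> f \<in> O'"
    using open_fun_contains_finite_box[OF O'(1)] by metis
  show ?thesis
  proof
    \<comment> \<open>Characters agree outside the carrier, so the points of \<open>S\<close> there
      impose nothing. The identity is added to make the set nonempty, as the kernel averages over
      it.\<close>
    show "finite (insert \<one> (S \<inter> carrier G))" "insert \<one> (S \<inter> carrier G) \<subseteq> carrier G" "insert \<one> (S \<inter> carrier G) \<noteq> {}"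
      using S(1) by auto
    show "0 < min \<delta> 1" "min \<delta> 1 \<le> 1" using S(2) by auto
    fix a assume a: "a \<in> characters G X" and small: "\<forall>x\<in>insert \<one> (S \<inter> carrier G). norm (a x - 1) < min \<delta> 1"
    have "a \<in> O'"
    proof (rule S(3))
      fix i assume i: "i \<in> S"
      show "dist (a i) (?e i) < \<delta>"
      proof (cases "i \<in> carrier G")
        case True
        then show ?thesis using small i by (simp add: dist_norm)
      next
        case False
        then show ?thesis using char(3)[OF a] S(2) by (simp add: extensional_def)
      qed
    qed
    then have "\<psi> a \<in> ball 1 (1/2)" using O'(2) a by blast
    then show "norm (\<psi> a - 1) < 1/2" by (simp add: dist_norm norm_minus_commute)
  qed
qed

text \<open>If \<open>\<psi>\<close> were not an evaluation, it would be orthogonal, for an invariant mean on the dual, to all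
  trigonometric polynomials, in particular to the powers of the kernel below; but these concentrate
  on a neighbourhood of the identity on which \<open>\<psi>\<close> is close to \<open>1\<close>.\<close>

definition dual_kernel :: "'a set \<Rightarrow> ('a \<Rightarrow> complex) \<Rightarrow> real" where
  "dual_kernel S a = (\<Sum>y\<in>S. (1 + Re (a y)) / 2) / card S"

lemma circle_half_Re: "norm (z::complex) = 1 \<Longrightarrow> (1 + Re z) / 2 = 1 - (norm (z - 1))\<^sup>2 / 4"
proof -
  assume "norm z = 1"
  then have "(norm (z - 1))\<^sup>2 = 2 - 2 * Re z"
    using cmod_power2[of z] cmod_power2[of "z - 1"] by (simp add: power2_eq_square algebra_simps)
  then show ?thesis by (simp add: field_simps)
qed

context
  fixes S :: "'a set"
  assumes S: "finite S" "S \<subseteq> carrier G" "S \<noteq> {}"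
begin

text \<open>One bad point lowers an average only by a fraction \<open>1 / card S\<close> of its own
  loss. With the same \<open>\<delta>\<close> the last two bounds therefore do not separate near
  from far; the third will be used with a smaller radius.\<close>

lemma dual_kernel_bounds:
  assumes a: "a \<in> characters G X"
  shows "0 \<le> dual_kernel S a" "dual_kernel S a \<le> 1"
    "(\<And>y. y \<in> S \<Longrightarrow> norm (a y - 1) < \<delta>) \<Longrightarrow> 1 - \<delta>\<^sup>2 / 4 \<le> dual_kernel S a"
    "\<lbrakk>y \<in> S; \<delta> \<le> norm (a y - 1); 0 \<le> \<delta>\<rbrakk> \<Longrightarrow> dual_kernel S a \<le> 1 - \<delta>\<^sup>2 / (4 * card S)"
proof -
  have n: "real (card S) > 0" using S by (simp add: card_gt_0_iff)
  have ay: "norm (a y) = 1" if "y \<in> S" for y using char(1)[OF a] S that by blast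
  have t: "0 \<le> (1 + Re (a y)) / 2" "(1 + Re (a y)) / 2 \<le> 1" if "y \<in> S" for y
    using abs_Re_le_cmod[of "a y"] ay[OF that] by (simp_all add: abs_le_iff)
  show "0 \<le> dual_kernel S a" unfolding dual_kernel_def using t n by (intro divide_nonneg_nonneg sum_nonneg) auto
  have "(\<Sum>y\<in>S. (1 + Re (a y)) / 2) \<le> (\<Sum>y\<in>S. 1)" by (intro sum_mono t)
  then show "dual_kernel S a \<le> 1" using n by (simp add: dual_kernel_def)
  show "1 - \<delta>\<^sup>2 / 4 \<le> dual_kernel S a" if "\<And>y. y \<in> S \<Longrightarrow> norm (a y - 1) < \<delta>"
  proof -
    have "(\<Sum>y\<in>S. 1 - \<delta>\<^sup>2 / 4) \<le> (\<Sum>y\<in>S. (1 + Re (a y)) / 2)"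
    proof (rule sum_mono)
      fix y assume y: "y \<in> S"
      have "(norm (a y - 1))\<^sup>2 \<le> \<delta>\<^sup>2" using that[OF y] by (intro power_mono) auto
      then show "1 - \<delta>\<^sup>2 / 4 \<le> (1 + Re (a y)) / 2" using circle_half_Re[OF ay[OF y]] by simp
    qed
    then have "real (card S) * (1 - \<delta>\<^sup>2 / 4) \<le> (\<Sum>y\<in>S. (1 + Re (a y)) / 2)" by simp
    then show ?thesis unfolding dual_kernel_def using n by (simp only: pos_le_divide_eq mult.commute)
  qed
  show "dual_kernel S a \<le> 1 - \<delta>\<^sup>2 / (4 * card S)" if y: "y \<in> S" and \<delta>: "\<delta> \<le> norm (a y - 1)" "0 \<le> \<delta>"
  proof -
    have "(1 + Re (a y)) / 2 \<le> 1 - \<delta>\<^sup>2 / 4"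
      using power_mono[OF \<delta>, of 2] circle_half_Re[OF ay[OF y]] by simp
    moreover have "(\<Sum>x\<in>S - {y}. (1 + Re (a x)) / 2) \<le> (\<Sum>x\<in>S - {y}. 1)" by (intro sum_mono t) auto
    moreover have "(\<Sum>x\<in>S - {y}. 1::real) = real (card S) - 1" using y S n by (simp add: of_nat_diff)
    ultimately have "(\<Sum>x\<in>S. (1 + Re (a x)) / 2) \<le> card S - \<delta>\<^sup>2 / 4"
      using sum.remove[OF S(1) y, of "\<lambda>x. (1 + Re (a x)) / 2"] by linarith
    then have "dual_kernel S a \<le> (card S - \<delta>\<^sup>2 / 4) / card S"
      unfolding dual_kernel_def using n by (intro divide_right_mono) auto
    also have "\<dots> = 1 - \<delta>\<^sup>2 / (4 * card S)" using n by (simp add: field_simps)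
    finally show ?thesis .
  qed
qed

text \<open>The real part is half of \<open>a y + a (inv y)\<close>, so the kernel is a
  trigonometric polynomial, a combination of evaluations of \<open>a\<close>.\<close>

lemma dual_kernel_complex:
  assumes a: "a \<in> characters G X"
  shows "complex_of_real (dual_kernel S a) = (\<Sum>y\<in>S. 1/2 + 1/4 * a y + 1/4 * a (inv y)) / of_nat (card S)"
proof -
  have "complex_of_real ((1 + Re (a y)) / 2) = 1/2 + 1/4 * a y + 1/4 * a (inv y)" if "y \<in> S" for y
  proof -
    have y: "y \<in> carrier G" using that S by blast
    have "1/4 * (a y + cnj (a y)) = complex_of_real (Re (a y) / 2)" unfolding complex_add_cnj by simp
    then show ?thesis using char_cnj[OF a y] by (simp add: add_divide_distrib algebra_simps)
  qed
  then show ?thesis unfolding dual_kernel_def by (simp only: of_real_divide of_real_sum of_real_of_nat_eq cong: sum.cong)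
qed

end

text \<open>For every \<open>x\<close> the function \<open>h x\<close> is a nontrivial character of
  the dual, so its mean vanishes. Multiplying by the kernel brings in \<open>h\<close> at
  \<open>y \<otimes> x\<close> and \<open>inv y \<otimes> x\<close>, so the induction runs over a
  statement about all \<open>x\<close>.\<close>

lemma dual_character_orthogonal_kernel:
  assumes M: "invariant_mean (dual_group G X) M"
    and T: "dual_topology G X = top_of_set (characters G X)"
    and \<psi>: "\<psi> \<in> characters (dual_group G X) (dual_topology G X)"
    and ne: "\<And>x. x \<in> carrier G \<Longrightarrow> \<exists>a\<in>characters G X. \<psi> a \<noteq> a x"
    and S: "finite S" "S \<subseteq> carrier G" "S \<noteq> {}"
    and x: "x \<in> carrier G"
  shows "M (\<lambda>a. of_real (dual_kernel S a) ^ N * (a x * cnj (\<psi> a))) = 0"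
proof -
  let ?\<Gamma> = "characters G X"
  interpret mean ?\<Gamma> M using M by (simp add: invariant_mean_def dual_simps)
  note facts = dual_character_facts[OF T \<psi>]
  define h where "h = (\<lambda>x a. a x * cnj (\<psi> a))"
  have nh: "norm (h x a) = 1" if "a \<in> ?\<Gamma>" "x \<in> carrier G" for a x
    using char(1)[OF that] facts(1)[OF that(1)] by (simp add: h_def norm_mult)
  have bh: "bounded ((\<lambda>a. p a * h x a) ` ?\<Gamma>)" if "bounded (p ` ?\<Gamma>)" "x \<in> carrier G" for p x
    by (rule bounded_image_mult[OF that(1)]) (use nh that in \<open>auto simp: bounded_iff intro!: exI[of _ 1]\<close>)
  define R where "R = (\<lambda>p. bounded (p ` ?\<Gamma>) \<and> (\<forall>x\<in>carrier G. M (\<lambda>a. p a * h x a) = 0))"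
  have "R (\<lambda>a. 1)"
    unfolding R_def
  proof (intro conjI ballI bounded_image_const)
    fix x assume x: "x \<in> carrier G"
    obtain b where b: "b \<in> ?\<Gamma>" "\<psi> b \<noteq> b x" using ne[OF x] by blast
    have bd: "bounded ((\<lambda>a. 1 * h x a) ` ?\<Gamma>)" using bh[OF bounded_image_const x, of 1] .
    \<comment> \<open>Translation by \<open>b\<close> multiplies the function by
      \<open>h x b\<close>, which is not 1, while invariance leaves the mean unchanged.\<close>
    have "M (\<lambda>a. 1 * h x a) = M (\<lambda>a. 1 * h x (\<lambda>z\<in>carrier G. b z * a z))"
      using M bd b(1) unfolding invariant_mean_def dual_simps by simp
    also have "\<dots> = M (\<lambda>a. h x b * (1 * h x a))"
    proof (rule cong[symmetric])
      show "bounded ((\<lambda>a. h x b * (1 * h x a)) ` ?\<Gamma>)" by (intro bounded_image_mult bounded_image_const bd)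
      fix a assume "a \<in> ?\<Gamma>"
      then show "h x b * (1 * h x a) = 1 * h x (\<lambda>z\<in>carrier G. b z * a z)"
        using x facts(2)[OF b(1)] by (simp add: h_def)
    qed
    also have "\<dots> = h x b * M (\<lambda>a. 1 * h x a)" by (rule scale[OF bd])
    finally have "(1 - h x b) * M (\<lambda>a. 1 * h x a) = 0" by (simp add: algebra_simps)
    moreover have "h x b \<noteq> 1"
    proof
      assume 1: "h x b = 1"
      have "h x b * \<psi> b = b x * (cnj (\<psi> b) * \<psi> b)" by (simp add: h_def)
      also have "cnj (\<psi> b) * \<psi> b = 1" using facts(1)[OF b(1)] by (metis complex_norm_square mult.commute of_real_1 one_power2)
      finally show False using 1 b(2) by simp
    qed
    ultimately show "M (\<lambda>a. 1 * h x a) = 0" by simp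
  qed
  moreover have "R (\<lambda>a. p a * of_real (dual_kernel S a))" if R: "R p" for p
    unfolding R_def
  proof (intro conjI ballI)
    have bp: "bounded (p ` ?\<Gamma>)" using R by (simp add: R_def)
    have "bounded ((\<lambda>a. complex_of_real (dual_kernel S a)) ` ?\<Gamma>)"
      using dual_kernel_bounds(1,2)[OF S] by (auto simp: bounded_iff intro!: exI[of _ 1])
    then show bpk: "bounded ((\<lambda>a. p a * of_real (dual_kernel S a)) ` ?\<Gamma>)" by (rule bounded_image_mult[OF bp])
    fix x assume x: "x \<in> carrier G"
    let ?g = "\<lambda>y a. 1/2 * (p a * h x a) + 1/4 * (p a * h (y \<otimes> x) a) + 1/4 * (p a * h (inv y \<otimes> x) a)"
    have b3: "bounded ((\<lambda>a. p a * h x a) ` ?\<Gamma>)" "bounded ((\<lambda>a. p a * h (y \<otimes> x) a) ` ?\<Gamma>)"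
      "bounded ((\<lambda>a. p a * h (inv y \<otimes> x) a) ` ?\<Gamma>)" if "y \<in> S" for y
      using bh[OF bp] x S that by auto
    have bg: "bounded (?g y ` ?\<Gamma>)" if "y \<in> S" for y
      by (intro bounded_plus_comp bounded_image_mult[OF bounded_image_const] b3[OF that])
    have g0: "M (?g y) = 0" if y: "y \<in> S" for y
    proof -
      have yc: "y \<in> carrier G" using y S by blast
      have "M (?g y) = 1/2 * M (\<lambda>a. p a * h x a) + 1/4 * M (\<lambda>a. p a * h (y \<otimes> x) a) + 1/4 * M (\<lambda>a. p a * h (inv y \<otimes> x) a)"
        by (simp only: add scale b3[OF y] bounded_plus_comp bounded_image_mult[OF bounded_image_const])
      then show ?thesis using R x yc by (simp add: R_def)
    qed
    have "M (\<lambda>a. p a * of_real (dual_kernel S a) * h x a) = M (\<lambda>a. 1 / of_nat (card S) * (\<Sum>y\<in>S. ?g y a))"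
    proof (rule cong[OF bh[OF bpk x]])
      fix a assume a: "a \<in> ?\<Gamma>"
      have "?g y a = (1/2 + 1/4 * a y + 1/4 * a (inv y)) * (p a * h x a)" if "y \<in> S" for y
      proof -
        have yc: "y \<in> carrier G" using that S by blast
        show ?thesis using char(2)[OF a yc x] char(2)[OF a inv_closed[OF yc] x] by (simp add: h_def algebra_simps)
      qed
      then have "(\<Sum>y\<in>S. ?g y a) = (\<Sum>y\<in>S. 1/2 + 1/4 * a y + 1/4 * a (inv y)) * (p a * h x a)"
        by (simp only: sum_distrib_right cong: sum.cong)
      then show "p a * of_real (dual_kernel S a) * h x a = 1 / of_nat (card S) * (\<Sum>y\<in>S. ?g y a)"
        unfolding dual_kernel_complex[OF S a] by simp
    qed
    also have "\<dots> = 1 / of_nat (card S) * M (\<lambda>a. \<Sum>y\<in>S. ?g y a)"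
      by (rule scale[OF conjunct2[OF sum[OF S(1) bg]]])
    also have "M (\<lambda>a. \<Sum>y\<in>S. ?g y a) = (\<Sum>y\<in>S. M (?g y))" by (rule conjunct1[OF sum[OF S(1) bg]])
    also have "\<dots> = 0" by (rule sum.neutral) (use g0 in blast)
    finally show "M (\<lambda>a. p a * of_real (dual_kernel S a) * h x a) = 0" by simp
  qed
  ultimately have "R (\<lambda>a. of_real (dual_kernel S a) ^ N)"
    by (induction N) (simp_all add: mult.commute[of _ "_ ^ _"])
  then show ?thesis using x by (simp add: R_def h_def)
qed

end

section \<open>Reflexivity\<close>

context topological_comm_group
begin

text \<open>The mean of the \<open>N\<close>-th power of the kernel is squeezed: a neighbourhood of
  the identity contributes at least \<open>c * q' ^ N\<close>, and orthogonality bounds the whole by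
  \<open>4 * q ^ N\<close>. As \<open>q < q'\<close>, this fails for large \<open>N\<close>.\<close>

theorem dual_character_is_evaluation:
  assumes T: "dual_topology G X = top_of_set (characters G X)"
    and \<psi>: "\<psi> \<in> characters (dual_group G X) (dual_topology G X)"
  shows "\<exists>x\<in>carrier G. \<psi> = evaluation_map G X x"
proof (rule ccontr)
  assume not_ev: "\<not> ?thesis"
  let ?\<Gamma> = "characters G X"
  note facts = dual_character_facts[OF T \<psi>]
  interpret D: comm_group "dual_group G X" by (rule comm_group_dual)
  obtain M where M: "invariant_mean (dual_group G X) M" using D.exists_invariant_mean by blast
  interpret mean ?\<Gamma> M using M by (simp add: invariant_mean_def dual_simps)
  have ne: "\<exists>a\<in>?\<Gamma>. \<psi> a \<noteq> a x" if x: "x \<in> carrier G" for x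
  proof (rule ccontr)
    assume "\<not> ?thesis"
    then have "\<psi> = evaluation_map G X x"
      by (intro extensionalityI[OF facts(3)]) (auto simp: evaluation_map_def)
    then show False using not_ev x by blast
  qed
  obtain S \<delta> where S: "finite S" "S \<subseteq> carrier G" "S \<noteq> {}" and \<delta>: "0 < \<delta>" "\<delta> \<le> 1"
    and near: "\<And>a. \<lbrakk>a \<in> ?\<Gamma>; \<forall>x\<in>S. norm (a x - 1) < \<delta>\<rbrakk> \<Longrightarrow> norm (\<psi> a - 1) < 1/2"
    using that by (rule dual_character_near_one[OF T \<psi>])
  let ?k = "dual_kernel S"
  note kb = dual_kernel_bounds[OF S]
  have n: "real (card S) \<ge> 1" using S by (simp add: Suc_leI card_gt_0_iff)
  define q where "q = 1 - \<delta>\<^sup>2 / (4 * card S)"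
  \<comment> \<open>Shrinking the radius by the factor \<open>2 * card S\<close> makes the kernel on
    the small neighbourhood larger than outside the big one, that is, \<open>q < q'\<close>.\<close>
  define \<delta>' where "\<delta>' = \<delta> / (2 * card S)"
  define q' where "q' = 1 - \<delta>'\<^sup>2 / 4"
  have \<delta>': "0 < \<delta>'" using \<delta> n by (simp add: \<delta>'_def)
  have "\<delta>\<^sup>2 \<le> 1" using \<delta> by (simp add: power_le_one)
  then have q: "0 < q" using n by (simp add: q_def field_simps)
  have qq': "q < q'"
  proof -
    have "\<delta>'\<^sup>2 = \<delta>\<^sup>2 / (4 * (real (card S) * real (card S)))" by (simp add: \<delta>'_def power2_eq_square)
    also have "\<dots> \<le> \<delta>\<^sup>2 / (4 * (real (card S) * 1))"
      using n by (intro divide_left_mono mult_left_mono mult_pos_pos) auto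
    also have "\<dots> < \<delta>\<^sup>2 / card S" using \<delta> n by (simp add: field_simps)
    finally show ?thesis by (simp add: q_def q'_def)
  qed
  define W where "W = {a \<in> ?\<Gamma>. \<forall>y\<in>S. norm (a y - 1) < \<delta>'}"
  let ?I = "\<lambda>a. complex_of_real (indicator W a)"
  have bI: "bounded (?I ` ?\<Gamma>)" by (auto simp: bounded_iff indicator_def intro!: exI[of _ 1])
  \<comment> \<open>Finitely many translates of \<open>W\<close> by a net of characters cover the
    dual, so by invariance \<open>W\<close> has mean at least \<open>1 / card F\<close>.\<close>
  have "\<exists>c>0. c \<le> Re (M ?I)"
  proof -
    have norm_1: "\<forall>a\<in>?\<Gamma>. \<forall>y\<in>S. norm (a y) \<le> 1" using char(1) S(2) by (auto simp: subset_eq)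
    obtain F where F: "finite F" "F \<subseteq> ?\<Gamma>" "\<And>a. a \<in> ?\<Gamma> \<Longrightarrow> \<exists>t\<in>F. \<forall>y\<in>S. dist (a y) (t y) < \<delta>'"
      using that by (rule finite_pointwise_net[OF S(1) norm_1 \<delta>'])
    define inv' where "inv' = (\<lambda>t. \<lambda>x\<in>carrier G. cnj (t x))"
    have inv': "inv' t \<in> ?\<Gamma>" if "t \<in> F" for t using char_inverse F(2) that unfolding inv'_def by blast
    let ?J = "\<lambda>t a. ?I (\<lambda>x\<in>carrier G. inv' t x * a x)"
    have bJ: "bounded (?J t ` ?\<Gamma>)" for t by (auto simp: bounded_iff indicator_def intro!: exI[of _ 1])
    have MJ: "M (?J t) = M ?I" if "t \<in> F" for t
      using M inv'[OF that] bI unfolding invariant_mean_def dual_simps by blast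
    note sJ = sum[OF F(1) bJ]
    have "1 = Re (M (\<lambda>a. 1))" using one by simp
    also have "\<dots> \<le> Re (M (\<lambda>a. \<Sum>t\<in>F. ?J t a))"
    proof (rule Re_mono[OF bounded_image_const conjunct2[OF sJ]])
      fix a assume a: "a \<in> ?\<Gamma>"
      obtain t where t: "t \<in> F" "\<And>y. y \<in> S \<Longrightarrow> dist (a y) (t y) < \<delta>'" using F(3)[OF a] by blast
      have tG: "t \<in> ?\<Gamma>" using t F by blast
      have "(\<lambda>x\<in>carrier G. inv' t x * a x) \<in> W"
      proof -
        have "norm (inv' t y * a y - 1) < \<delta>'" if y: "y \<in> S" for y
        proof -
          have yc: "y \<in> carrier G" using y S by blast
          have "inv' t y * a y - 1 = cnj (t y) * (a y - t y)"
            using char_cnj_mult[OF tG yc] yc by (simp add: inv'_def algebra_simps)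
          then show ?thesis using t(2)[OF y] char(1)[OF tG yc] by (simp add: norm_mult dist_norm)
        qed
        then show ?thesis using char_mult[OF inv'[OF t(1)] a] S(2) by (auto simp: W_def)
      qed
      then have "1 = (indicator W (\<lambda>x\<in>carrier G. inv' t x * a x) :: real)" by simp
      also have "\<dots> \<le> (\<Sum>t\<in>F. indicator W (\<lambda>x\<in>carrier G. inv' t x * a x))"
        by (rule member_le_sum[OF t(1) _ F(1)]) simp
      finally show "1 \<in> \<real> \<and> (\<Sum>t\<in>F. ?J t a) \<in> \<real> \<and> Re 1 \<le> Re (\<Sum>t\<in>F. ?J t a)" by simp
    qed
    also have "M (\<lambda>a. \<Sum>t\<in>F. ?J t a) = (\<Sum>t\<in>F. M (?J t))" by (rule conjunct1[OF sJ])
    also have "\<dots> = (\<Sum>t\<in>F. M ?I)" using MJ by (intro sum.cong) auto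
    finally have 1: "1 \<le> real (card F) * Re (M ?I)" by simp
    then have "card F > 0" by (cases "card F") auto
    then show ?thesis using 1 by (intro exI[of _ "1 / real (card F)"]) (simp add: field_simps)
  qed
  then obtain c where c: "c > 0" "c \<le> Re (M ?I)" by blast
  have main: "c * q' ^ N \<le> 4 * q ^ N" for N
  proof -
    let ?p = "\<lambda>a. complex_of_real (?k a) ^ N"
    have bp: "bounded (?p ` ?\<Gamma>)"
      using kb(1,2) by (auto simp: bounded_iff norm_power intro!: exI[of _ 1] power_le_one)
    have b\<psi>: "bounded ((\<lambda>a. cnj (\<psi> a)) ` ?\<Gamma>)" using facts(1) by (auto simp: bounded_iff intro!: exI[of _ 1])
    have bp\<psi>: "bounded ((\<lambda>a. ?p a * cnj (\<psi> a)) ` ?\<Gamma>)" by (rule bounded_image_mult[OF bp b\<psi>])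
    have "M (\<lambda>a. ?p a * cnj (\<psi> a)) = M (\<lambda>a. ?p a * (a \<one> * cnj (\<psi> a)))"
      by (rule cong[OF bp\<psi>]) (simp add: char_one)
    also have "\<dots> = 0" by (rule dual_character_orthogonal_kernel[OF M T \<psi> ne S one_closed])
    finally have "M ?p = M (\<lambda>a. ?p a - ?p a * cnj (\<psi> a))" using diff[OF bp bp\<psi>] by simp
    \<comment> \<open>Near the identity \<open>\<psi>\<close> is within 1/2 of 1, which leaves half
      of the kernel power to be absorbed on the left; elsewhere the kernel is at most
      \<open>q\<close> and the distance of \<open>\<psi>\<close> from 1 at most 2.\<close>
    also have "norm \<dots> \<le> Re (M (\<lambda>a. 1/2 * ?p a + 2 * of_real (q ^ N)))"
    proof (rule dominated)
      show "bounded ((\<lambda>a. ?p a - ?p a * cnj (\<psi> a)) ` ?\<Gamma>)" by (intro bounded_minus_comp bp bp\<psi>)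
      show "bounded ((\<lambda>a. 1/2 * ?p a + 2 * of_real (q ^ N)) ` ?\<Gamma>)"
        by (intro bounded_plus_comp bounded_image_mult bounded_image_const bp)
      fix a assume a: "a \<in> ?\<Gamma>"
      have "?p a - ?p a * cnj (\<psi> a) = of_real (?k a ^ N) * cnj (1 - \<psi> a)" by (simp add: algebra_simps)
      then have nm: "norm (?p a - ?p a * cnj (\<psi> a)) = ?k a ^ N * norm (\<psi> a - 1)"
        using kb(1)[OF a] by (simp only: norm_mult norm_of_real complex_mod_cnj norm_minus_commute) simp
      have "?k a ^ N * norm (\<psi> a - 1) \<le> 1/2 * ?k a ^ N + 2 * q ^ N"
      proof (cases "\<forall>y\<in>S. norm (a y - 1) < \<delta>")
        case True
        then have "norm (\<psi> a - 1) \<le> 1/2" using near[OF a] by (simp add: less_imp_le)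
        then have "?k a ^ N * norm (\<psi> a - 1) \<le> ?k a ^ N * (1/2)" using kb(1)[OF a] by (intro mult_left_mono) auto
        then show ?thesis using q by (simp add: mult.commute add_increasing2)
      next
        case False
        then obtain y where y: "y \<in> S" "\<delta> \<le> norm (a y - 1)" by force
        have "?k a \<le> q" using kb(4)[OF a y] \<delta> by (simp add: q_def)
        then have "?k a ^ N \<le> q ^ N" using kb(1)[OF a] by (intro power_mono)
        moreover have "norm (\<psi> a - 1) \<le> 2" using norm_triangle_ineq4[of "\<psi> a" 1] facts(1)[OF a] by simp
        ultimately have "?k a ^ N * norm (\<psi> a - 1) \<le> q ^ N * 2" using q by (intro mult_mono) auto
        then show ?thesis using kb(1)[OF a] by (simp add: mult.commute add_increasing)
      qed
      then show "norm (?p a - ?p a * cnj (\<psi> a)) \<le> Re (1/2 * ?p a + 2 * of_real (q ^ N))"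
        unfolding nm by (simp flip: of_real_power)
    qed
    also have "M (\<lambda>a. 1/2 * ?p a + 2 * of_real (q ^ N)) = 1/2 * M ?p + 2 * of_real (q ^ N)"
      by (simp only: add scale const bp bounded_image_mult[OF bounded_image_const] bounded_image_const)
    finally have "norm (M ?p) \<le> 1/2 * Re (M ?p) + 2 * q ^ N" by (simp flip: of_real_power)
    then have up: "Re (M ?p) \<le> 4 * q ^ N" using complex_Re_le_cmod[of "M ?p"] by linarith
    have "c * q' ^ N \<le> Re (M ?I) * q' ^ N" using c q qq' by (intro mult_right_mono) auto
    also have "\<dots> = Re (M (\<lambda>a. of_real (q' ^ N) * ?I a))" by (simp add: scale[OF bI] flip: of_real_power)
    also have "\<dots> \<le> Re (M ?p)"
    proof (rule Re_mono[OF bounded_image_mult[OF bounded_image_const bI] bp])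
      fix a assume a: "a \<in> ?\<Gamma>"
      have "q' ^ N * indicator W a \<le> ?k a ^ N"
      proof (cases "a \<in> W")
        case True
        then have "q' \<le> ?k a" unfolding q'_def by (intro kb(3)[OF a]) (simp add: W_def)
        then show ?thesis using True q qq' by (simp add: power_mono)
      qed (use kb(1)[OF a] in simp)
      then show "of_real (q' ^ N) * ?I a \<in> \<real> \<and> ?p a \<in> \<real> \<and> Re (of_real (q' ^ N) * ?I a) \<le> Re (?p a)"
        by (simp flip: of_real_power of_real_mult)
    qed
    finally show ?thesis using up by linarith
  qed
  obtain N where "4 / c < (q' / q) ^ N" using real_arch_pow[of "q' / q" "4 / c"] q qq' by auto
  then have "4 * q ^ N < c * q' ^ N" using q c by (simp add: power_divide field_simps)
  then show False using main[of N] by linarith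
qed

theorem pseudocompact_without_infinite_compact_reflexive:
  assumes Hausdorff: "Hausdorff_space X" and pseudocompact: "pseudocompact X"
    and compact_finite: "\<forall>K. compactin X K \<longrightarrow> finite K"
  shows "pontryagin_reflexive G X"
proof -
  let ?\<Gamma> = "characters G X" and ?D = "dual_group G X" and ?T = "dual_topology G X" and ?ev = "evaluation_map G X"
  have T: "?T = top_of_set ?\<Gamma>"
    by (rule dual_topology_eq_pointwise[OF topspace_eq]) (use compact_finite in blast)
  have fin: "finite K" if "compactin ?T K" for K
    using that compact_set_of_characters_finite[OF pseudocompact, of K] unfolding T compactin_subtopology by simp
  have T2: "dual_topology ?D ?T = top_of_set (characters ?D ?T)"
    by (rule dual_topology_eq_pointwise[OF _ fin]) (simp add: T dual_simps)
  have ev_apply: "?ev x a = a x" if "a \<in> ?\<Gamma>" for x a using that by (simp add: evaluation_map_def)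
  have ev_char: "?ev x \<in> characters ?D ?T" if x: "x \<in> carrier G" for x
  proof -
    have "continuous_on ?\<Gamma> (\<lambda>a. a x)"
      by (rule continuous_on_subset[OF continuous_on_product_coordinates]) simp
    then have "continuous_on ?\<Gamma> (?ev x)" by (rule continuous_on_eq) (simp add: ev_apply)
    then have "continuous_map ?T circle_top (?ev x)"
      using char(1)[OF _ x] by (auto simp: T circle_top_def continuous_map_in_subtopology ev_apply)
    moreover have "?ev x \<in> extensional (carrier ?D)" by (simp add: evaluation_map_def dual_simps)
    moreover have "?ev x (a \<otimes>\<^bsub>?D\<^esub> b) = ?ev x a * ?ev x b" if "a \<in> carrier ?D" "b \<in> carrier ?D" for a b
      using that char_mult x by (simp add: dual_simps ev_apply)
    ultimately show ?thesis by (simp add: characters_def)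
  qed
  have bij: "bij_betw ?ev (carrier G) (characters ?D ?T)"
  proof (rule bij_betw_imageI)
    show "?ev ` carrier G = characters ?D ?T"
      using ev_char dual_character_is_evaluation[OF T] by blast
    show "inj_on ?ev (carrier G)"
    proof (rule inj_onI, rule ccontr)
      fix x y assume xy: "x \<in> carrier G" "y \<in> carrier G" "?ev x = ?ev y" "x \<noteq> y"
      have same: "a x = a y" if "a \<in> ?\<Gamma>" for a using xy(3) ev_apply[OF that] by metis
      have "inv y \<otimes> x \<noteq> \<one>" using xy by (metis inv_closed inv_equality inv_inv)
      then obtain U where U: "openin X U" "\<one> \<in> U" "inv y \<otimes> x \<notin> U"
        using Hausdorff xy topspace_eq unfolding Hausdorff_space_def disjnt_def
        by (metis disjoint_iff inv_closed m_closed one_closed)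
      \<comment> \<open>All characters are 1 at the quotient of \<open>x\<close> and
        \<open>y\<close>, so it meets every smallness condition and lies in \<open>U\<close>,
        contrary to the choice of \<open>U\<close>.\<close>
      obtain S \<delta> where S: "finite S" "S \<subseteq> ?\<Gamma>" "\<delta> > 0"
        "\<And>z. \<lbrakk>z \<in> carrier G; \<forall>a\<in>S. norm (a z - 1) < \<delta>\<rbrakk> \<Longrightarrow> z \<in> U"
        using that by (rule characters_determine_topology[OF pseudocompact U(1,2)])
      have "inv y \<otimes> x \<in> U"
      proof (rule S(4)[OF _ ballI])
        fix a assume "a \<in> S"
        then have a: "a \<in> ?\<Gamma>" using S(2) by blast
        have "a (inv y \<otimes> x) = 1" using char(2)[OF a, of "inv y" x] char_inv[OF a xy(2)] same[OF a] xy by simp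
        then show "norm (a (inv y \<otimes> x) - 1) < \<delta>" using S(3) by simp
      qed (use xy in simp)
      then show False using U by blast
    qed
  qed
  have cont: "continuous_map X (dual_topology ?D ?T) ?ev"
  proof -
    have "continuous_map X euclidean ?ev"
    proof (rule continuous_map_into_fun)
      \<comment> \<open>Coordinates at functions that are not characters are constantly
        \<open>undefined\<close>.\<close>
      fix a show "continuous_map X euclidean (\<lambda>x. ?ev x a)"
        using char(4)[of a] by (cases "a \<in> ?\<Gamma>") (simp_all add: evaluation_map_def)
    qed
    then show ?thesis unfolding T2 continuous_map_in_subtopology using ev_char topspace_eq by auto
  qed
  have open_ev: "open_map X (dual_topology ?D ?T) ?ev"
    unfolding open_map_def T2
  proof (intro allI impI)
    fix U assume U: "openin X U"
    have Uc: "U \<subseteq> carrier G" using openin_subset[OF U] topspace_eq by simp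
    show "openin (top_of_set (characters ?D ?T)) (?ev ` U)"
    proof (rule openin_subopen[THEN iffD2], intro ballI)
      fix p assume "p \<in> ?ev ` U"
      then obtain x where x: "x \<in> U" "p = ?ev x" by blast
      have xc: "x \<in> carrier G" using x Uc by blast
      have V: "openin X {z \<in> carrier G. x \<otimes> z \<in> U}" "\<one> \<in> {z \<in> carrier G. x \<otimes> z \<in> U}"
        using openin_translation[OF xc U] xc x by auto
      obtain S \<delta> where S: "finite S" "S \<subseteq> ?\<Gamma>" "\<delta> > 0"
        "\<And>z. \<lbrakk>z \<in> carrier G; \<forall>a\<in>S. norm (a z - 1) < \<delta>\<rbrakk> \<Longrightarrow> z \<in> {z \<in> carrier G. x \<otimes> z \<in> U}"
        using that by (rule characters_determine_topology[OF pseudocompact V])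
      \<comment> \<open>A basic neighbourhood of \<open>?ev x\<close>. By surjectivity its members
        in the bidual are evaluations at some \<open>y\<close>, and closeness on \<open>S\<close>
        puts \<open>inv x \<otimes> y\<close> into the translated neighbourhood of the
        identity.\<close>
      let ?O = "\<Inter>a\<in>S. {p. norm (p a - a x) < \<delta>}"
      have "open ?O"
        by (intro open_INT S(1) ballI open_Collect_less continuous_intros continuous_on_product_coordinates)
      then have "openin (top_of_set (characters ?D ?T)) (characters ?D ?T \<inter> ?O)" by (rule openin_open_Int)
      moreover have "p \<in> characters ?D ?T \<inter> ?O"
        using ev_char[OF xc] S(2,3) by (auto simp: x(2) ev_apply subset_eq)
      moreover have "characters ?D ?T \<inter> ?O \<subseteq> ?ev ` U"
      proof
        fix p assume p: "p \<in> characters ?D ?T \<inter> ?O"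
        then obtain y where y: "y \<in> carrier G" "p = ?ev y" using dual_character_is_evaluation[OF T] by blast
        have "inv x \<otimes> y \<in> {z \<in> carrier G. x \<otimes> z \<in> U}"
        proof (rule S(4)[OF _ ballI])
          fix a assume aS: "a \<in> S"
          then have a: "a \<in> ?\<Gamma>" using S(2) by blast
          have "a (inv x \<otimes> y) - 1 = a (inv x) * (a y - a x)"
            using char(2)[OF a, of "inv x" y] char_inv[OF a xc] xc y by (simp add: algebra_simps)
          moreover have "norm (a y - a x) < \<delta>" using p aS by (auto simp: y(2) ev_apply[OF a])
          ultimately show "norm (a (inv x \<otimes> y) - 1) < \<delta>" using char(1)[OF a, of "inv x"] xc by (simp add: norm_mult)
        qed (use xc y in simp)
        then have "x \<otimes> (inv x \<otimes> y) \<in> U" by simp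
        moreover have "x \<otimes> (inv x \<otimes> y) = y" using xc y by (simp add: m_assoc[symmetric])
        ultimately show "p \<in> ?ev ` U" using y(2) by simp
      qed
      ultimately show "\<exists>T'. openin (top_of_set (characters ?D ?T)) T' \<and> p \<in> T' \<and> T' \<subseteq> ?ev ` U" by blast
    qed
  qed
  show ?thesis
    unfolding pontryagin_reflexive_def
  proof
    show "?ev \<in> iso G (dual_group ?D ?T)"
    proof (rule isoI)
      show "?ev \<in> hom G (dual_group ?D ?T)"
      proof (rule homI)
        show "?ev x \<in> carrier (dual_group ?D ?T)" if "x \<in> carrier G" for x
          using ev_char[OF that] by (simp add: dual_group_def)
        show "?ev (x \<otimes> y) = ?ev x \<otimes>\<^bsub>dual_group ?D ?T\<^esub> ?ev y" if xy: "x \<in> carrier G" "y \<in> carrier G" for x y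
        proof -
          have "?ev x \<otimes>\<^bsub>dual_group ?D ?T\<^esub> ?ev y = (\<lambda>a\<in>?\<Gamma>. ?ev x a * ?ev y a)"
            by (simp add: dual_group_def)
          also have "\<dots> = ?ev (x \<otimes> y)"
            unfolding evaluation_map_def by (rule restrict_ext) (simp add: char(2) xy)
          finally show ?thesis by simp
        qed
      qed
      show "bij_betw ?ev (carrier G) (carrier (dual_group ?D ?T))" using bij by (simp add: dual_group_def)
    qed
    show "homeomorphic_map X (dual_topology ?D ?T) ?ev"
    proof (rule bijective_open_imp_homeomorphic_map[OF cont open_ev])
      show "?ev ` topspace X = topspace (dual_topology ?D ?T)" "inj_on ?ev (topspace X)"
        using bij unfolding bij_betw_def T2 topspace_eq by simp_all
    qed
  qed
qed

end

theorem theorem6p1: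
  fixes G :: "('a, 'm) monoid_scheme" and X :: "'a topology"
  assumes "topological_abelian_group G X"
    and "Hausdorff_space X"
    and "pseudocompact X"
    and "\<forall>K. compactin X K \<longrightarrow> finite K"
  shows "pontryagin_reflexive G X"
  using topological_comm_group.pseudocompact_without_infinite_compact_reflexive[OF topological_comm_groupI] assms by blast

end
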